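(* Let $X$ be a Banach space, $A:D(A)\subset X\to X$ a Hille-Yosida operator, $X_0=\overline{D(A)}$, and let $F,V:\mathbb R\to\mathcal L(X_0,X)$ be almost periodic and continuous in the operator norm topology, where $X$ and $X_0$ have normal and generating positive cones $X_+$ and $X_0^+$ respectively. Assume that: (a) $A$ is resolvent positive, i.e., the resolvent set $\rho(A)$ contains a ray $(\omega,+\infty)$ and $(\lambda I-A)^{-1}$ is a positive operator for all $\lambda>\omega$; (b) there exists $\lambda_1>\omega_A$ such that $\lambda_1\phi-V(t)\phi\in X_+$ for all $\phi\in X_0^+$ and $t\in\mathbb R$; (c) $F(t)\phi\in X_+$ for each $t\in\mathbb R$ and each $\phi\in X_0^+$. Then the mild solution $u\in C([t_0,\infty),X_0)$ of the Cauchy problem $$\frac{du(t)}{dt}=Au(t)+F(t)u(t)-V(t)u(t),\quad t>t_0,\qquad u(t_0)=u_0\in X_0,$$ has the form $$u(t)=U(t,t_0)u_0=\Gamma(t,t_0)u_0+\lim_{\lambda\to+\infty}\int_{t_0}^t\Gamma(t,s)\lambda(\lambda I-A)^{-1}F(s)U(s,t_0)u_0\,ds,\quad\forall u_0\in X_0,$$ where the limit exists in $X_0$. Moreover, the convergence is uniform with respect to $t,t_0\in I$ for each compact interval $I\subset\mathbb R$. Furthermore, $u(t)$ satisfies the following properties: (i) $u(t)=U(t,t_0)u_0$ is a continuous function of $(t,t_0,u_0)$; (ii) $u(t)$ depends continuously on the functions $F(t)$ and $V(t)$.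
   Context: Almost periodicity: for a metric space $(Y,d)$, a function $f\in C(\mathbb R,Y)$ is almost periodic if for every $\epsilon>0$ the set $\{s\in\mathbb R:d(f(t+s),f(t))<\epsilon\ \forall t\in\mathbb R\}$ is relatively dense in $\mathbb R$, that is, there is $l>0$ such that every interval $[c,c+l]$, $c\in\mathbb R$, meets this set. Hille-Yosida operator: a linear operator $A:D(A)\subset X\to X$ (possibly unbounded and not densely defined) for which there are $\omega_A\in\mathbb R$ and $M_A\ge1$ with $(\omega_A,+\infty)\subset\rho(A)$ and $\|(\lambda I-A)^{-n}\|\le M_A(\lambda-\omega_A)^{-n}$ for all $\lambda>\omega_A$ and all integers $n\ge1$. The constant $\omega_A$ in hypothesis (b) is this one. $\mathcal L(X_0,X)$ is the space of bounded linear operators from $X_0$ to $X$. Mild solutions and evolution families: the mild (integrated) solution of the Cauchy problem is the function $u\in C([t_0,\infty),X_0)$ satisfying $u(t)=u_0+A\int_{t_0}^tu(s)\,ds+\int_{t_0}^t(F(s)-V(s))u(s)\,ds$ for $t\ge t_0$, with $\int_{t_0}^tu(s)\,ds\in D(A)$. The Cauchy problem admits an exponentially bounded evolution family $\{U(t,s)\}_{t\ge s}$ on $X_0$, so that its solution is $u(t)=U(t,t_0)u_0$ for $t\ge t_0$. Likewise, $\{\Gamma(t,s)\}_{t\ge s}$ is the exponentially bounded evolution family on $X_0$ of the Cauchy problem $\frac{dv(t)}{dt}=Av(t)-V(t)v(t)$, $t>t_0$, $v(t_0)=v_0\in X_0$, so that $v(t)=\Gamma(t,t_0)v_0$. *)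

theory Defs
  imports "HOL-Analysis.Analysis"
begin

section \<open>Bounded linear operators on a subspace\<close>

text \<open>
  A (partially defined) operator is a total function together with its domain; values
  off the domain are irrelevant.  In particular an element of \<open>\<L>(S,Y)\<close>, for a subspace \<open>S\<close>, is a
  function of which only the restriction to \<open>S\<close> matters.
\<close>

definition linear_operator :: "'a::real_vector set \<Rightarrow> ('a \<Rightarrow> 'b::real_vector) \<Rightarrow> bool" where
  "linear_operator D A \<longleftrightarrow> subspace D \<and>
     (\<forall>x\<in>D. \<forall>y\<in>D. A (x + y) = A x + A y) \<and>
     (\<forall>c. \<forall>x\<in>D. A (c *\<^sub>R x) = c *\<^sub>R A x)"

definition bounded_linear_on :: "'a::real_normed_vector set \<Rightarrow> ('a \<Rightarrow> 'b::real_normed_vector) \<Rightarrow> bool" where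
  "bounded_linear_on S f \<longleftrightarrow> linear_operator S f \<and> (\<exists>K. \<forall>x\<in>S. norm (f x) \<le> K * norm x)"

definition onorm_on :: "'a::real_normed_vector set \<Rightarrow> ('a \<Rightarrow> 'b::real_normed_vector) \<Rightarrow> real" where
  "onorm_on S f = (SUP x\<in>S. norm (f x) / norm x)"

definition op_dist :: "'a::real_normed_vector set \<Rightarrow> ('a \<Rightarrow> 'b::real_normed_vector) \<Rightarrow> ('a \<Rightarrow> 'b) \<Rightarrow> real" where
  "op_dist S f g = onorm_on S (\<lambda>x. f x - g x)"

lemma onorm_on_bound:
  assumes "bounded_linear_on S f" and "x \<in> S"
  shows "norm (f x) \<le> onorm_on S f * norm x"
proof (cases "x = 0")
  case True
  have "f (0 *\<^sub>R x) = 0 *\<^sub>R f x"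
    using assms unfolding bounded_linear_on_def linear_operator_def by blast
  with True show ?thesis by simp
next
  case False
  obtain K where K: "norm (f y) \<le> K * norm y" if "y \<in> S" for y
    using assms(1) by (auto simp: bounded_linear_on_def)
  have "norm (f y) / norm y \<le> max K 0" if "y \<in> S" for y
  proof (cases "y = 0")
    case False
    with K[OF that] have "norm (f y) / norm y \<le> K" by (simp add: divide_le_eq)
    then show ?thesis by simp
  qed auto
  then have "bdd_above ((\<lambda>y. norm (f y) / norm y) ` S)"
    by (auto simp: bdd_above_def)
  then have "norm (f x) / norm x \<le> onorm_on S f"
    unfolding onorm_on_def using assms(2) by (rule cSUP_upper[rotated])
  with False show ?thesis by (simp add: divide_le_eq)
qed


section \<open>Almost periodic functions\<close>

definition relatively_dense :: "real set \<Rightarrow> bool" where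
  "relatively_dense E \<longleftrightarrow> (\<exists>l>0. \<forall>c. {c..c + l} \<inter> E \<noteq> {})"

text \<open>
  The metric is a parameter, since the metric space needed here is \<open>\<L>(S,Y)\<close> with the operator
  norm distance \<^term>\<open>op_dist S\<close>, which is not a type.  Continuity is part of the notion.
\<close>

definition almost_periodic :: "('y \<Rightarrow> 'y \<Rightarrow> real) \<Rightarrow> (real \<Rightarrow> 'y) \<Rightarrow> bool" where
  "almost_periodic d f \<longleftrightarrow>
     (\<forall>t. \<forall>e>0. \<exists>\<delta>>0. \<forall>s. \<bar>s - t\<bar> < \<delta> \<longrightarrow> d (f s) (f t) < e) \<and>
     (\<forall>e>0. relatively_dense {s. \<forall>t. d (f (t + s)) (f t) < e})"

definition almost_periodic_operators ::
    "'a::real_normed_vector set \<Rightarrow> (real \<Rightarrow> 'a \<Rightarrow> 'b::real_normed_vector) \<Rightarrow> bool" where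
  "almost_periodic_operators S F \<longleftrightarrow>
     (\<forall>t. bounded_linear_on S (F t)) \<and> almost_periodic (op_dist S) F"


section \<open>Resolvents and Hille-Yosida operators\<close>

definition resolvent :: "'a::real_normed_vector set \<Rightarrow> ('a \<Rightarrow> 'a) \<Rightarrow> real \<Rightarrow> 'a \<Rightarrow> 'a" where
  "resolvent D A \<mu> = inv_into D (\<lambda>x. \<mu> *\<^sub>R x - A x)"

definition resolvent_set :: "'a::real_normed_vector set \<Rightarrow> ('a \<Rightarrow> 'a) \<Rightarrow> real set" where
  "resolvent_set D A =
     {\<mu>. bij_betw (\<lambda>x. \<mu> *\<^sub>R x - A x) D UNIV \<and> bounded_linear (resolvent D A \<mu>)}"

definition hille_yosida ::
    "'a::real_normed_vector set \<Rightarrow> ('a \<Rightarrow> 'a) \<Rightarrow> real \<Rightarrow> real \<Rightarrow> bool" where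
  "hille_yosida D A \<omega> M \<longleftrightarrow> linear_operator D A \<and> M \<ge> 1 \<and> {\<omega><..} \<subseteq> resolvent_set D A \<and>
     (\<forall>\<mu>>\<omega>. \<forall>n\<ge>1. onorm (resolvent D A \<mu> ^^ n) \<le> M * inverse ((\<mu> - \<omega>) ^ n))"


section \<open>Positive cones\<close>

definition positive_cone :: "'a::real_normed_vector set \<Rightarrow> bool" where
  "positive_cone P \<longleftrightarrow> closed P \<and> convex P \<and> cone P \<and> P \<inter> uminus ` P = {0}"

definition normal_cone :: "'a::real_normed_vector set \<Rightarrow> bool" where
  "normal_cone P \<longleftrightarrow> (\<exists>N. \<forall>x\<in>P. \<forall>y. y - x \<in> P \<longrightarrow> norm x \<le> N * norm y)"

definition generating_cone :: "'a::real_normed_vector set \<Rightarrow> 'a set \<Rightarrow> bool" where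
  "generating_cone Y P \<longleftrightarrow> Y = {x - y | x y. x \<in> P \<and> y \<in> P}"

definition resolvent_positive ::
    "'a::real_normed_vector set \<Rightarrow> 'a set \<Rightarrow> ('a \<Rightarrow> 'a) \<Rightarrow> bool" where
  "resolvent_positive P D A \<longleftrightarrow>
     (\<exists>\<omega>. {\<omega><..} \<subseteq> resolvent_set D A \<and> (\<forall>\<mu>>\<omega>. \<forall>x\<in>P. resolvent D A \<mu> x \<in> P))"


section \<open>Mild solutions and evolution families\<close>

text \<open>
  Mild solutions on \<open>[t\<^sub>0, \<infinity>)\<close> of \<open>du/dt = A u + B(t) u\<close>, \<open>u(t\<^sub>0) = u\<^sub>0\<close>;
  the values of \<open>u\<close> before \<open>t\<^sub>0\<close> are irrelevant.
\<close>

definition mild_solution ::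
    "'a::banach set \<Rightarrow> ('a \<Rightarrow> 'a) \<Rightarrow> (real \<Rightarrow> 'a \<Rightarrow> 'a) \<Rightarrow> real \<Rightarrow> 'a \<Rightarrow> (real \<Rightarrow> 'a) \<Rightarrow> bool" where
  "mild_solution D A B t\<^sub>0 u\<^sub>0 u \<longleftrightarrow>
     continuous_on {t\<^sub>0..} u \<and>
     (\<forall>t\<ge>t\<^sub>0. u t \<in> closure D \<and> integral {t\<^sub>0..t} u \<in> D \<and>
        u t = u\<^sub>0 + A (integral {t\<^sub>0..t} u) + integral {t\<^sub>0..t} (\<lambda>s. B s (u s)))"

definition evolution_family :: "'a::real_normed_vector set \<Rightarrow> (real \<Rightarrow> real \<Rightarrow> 'a \<Rightarrow> 'a) \<Rightarrow> bool" where
  "evolution_family S U \<longleftrightarrow>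
     (\<forall>t s. s \<le> t \<longrightarrow> bounded_linear_on S (U t s) \<and> U t s ` S \<subseteq> S) \<and>
     (\<forall>s. \<forall>x\<in>S. U s s x = x) \<and>
     (\<forall>t s r. r \<le> s \<longrightarrow> s \<le> t \<longrightarrow> (\<forall>x\<in>S. U t s (U s r x) = U t r x)) \<and>
     (\<forall>x\<in>S. continuous_on {(t, s). s \<le> t} (\<lambda>(t, s). U t s x))"

definition exponentially_bounded ::
    "'a::real_normed_vector set \<Rightarrow> (real \<Rightarrow> real \<Rightarrow> 'a \<Rightarrow> 'a) \<Rightarrow> bool" where
  "exponentially_bounded S U \<longleftrightarrow>
     (\<exists>K w. \<forall>t s. s \<le> t \<longrightarrow> onorm_on S (U t s) \<le> K * exp (w * (t - s)))"

text \<open>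
  The equivalence says that \<open>t \<mapsto> U(t,t\<^sub>0)u\<^sub>0\<close> is a mild solution on \<open>[t\<^sub>0, \<infinity>)\<close> and that there is
  no other one.
\<close>

definition evolution_family_of ::
    "'a::banach set \<Rightarrow> ('a \<Rightarrow> 'a) \<Rightarrow> (real \<Rightarrow> 'a \<Rightarrow> 'a) \<Rightarrow> (real \<Rightarrow> real \<Rightarrow> 'a \<Rightarrow> 'a) \<Rightarrow> bool" where
  "evolution_family_of D A B U \<longleftrightarrow>
     evolution_family (closure D) U \<and> exponentially_bounded (closure D) U \<and>
     (\<forall>t\<^sub>0. \<forall>u\<^sub>0\<in>closure D. \<forall>u.
        mild_solution D A B t\<^sub>0 u\<^sub>0 u \<longleftrightarrow> (\<forall>t\<ge>t\<^sub>0. u t = U t t\<^sub>0 u\<^sub>0))"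

end

theory Submission
  imports Defs
begin

text \<open>
  Everything rests on an a priori bound for the mild solutions of
  \<open>v' = A v + f\<close>, obtained by comparing the smoothed solution \<open>J \<mu> v\<close>, \<open>J \<mu> = \<mu> (\<mu> - A)\<inverse>\<close>, with the
  Yosida approximation \<open>A J \<lambda>\<close>, for which \<open>(\<lambda> - \<omega>) (\<lambda> - A)\<inverse>\<close> is a contraction in an equivalent norm.
  Because of the bound, existence passes to limits of the data: it goes from Yosida approximations to the
  homogeneous problem, then (shifting by a resolvent) to constant, affine, piecewise affine and finally
  continuous \<open>f\<close>.  A Volterra fixed point adds bounded perturbations and gives \<open>U\<close> and \<open>\<Gamma>\<close>.

  If the forcing \<open>k\<close> and \<open>A k\<close> are continuous, the solution from \<open>0\<close> is \<open>\<integral> \<Gamma>(t,s) k(s) ds\<close>, since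
  \<open>s \<mapsto> \<Gamma>(t,s) w(s)\<close> has derivative \<open>\<Gamma>(t,s) k(s)\<close>.  For \<open>g(s) = F(s) U(s,t\<^sub>0) u\<^sub>0\<close>, which need not lie in
  \<open>closure D\<close>, \<open>J \<mu> g\<close> does not converge to \<open>g\<close>, but the solution \<open>p\<close> of \<open>p' = A p + g\<close> does lie
  there, so \<open>J \<mu> p \<rightarrow> p\<close> uniformly on compact sets; Gronwall transfers this to the perturbed problem.
\<close>

section \<open>Integral inequalities and Volterra equations\<close>

text \<open>The hypothesis bounds powers of the resolvent by one constant \<open>M\<close>, which
  may exceed 1. A bound on a single resolvent would contribute M^n to the n-th term of an
  exponential series; the equivalent norm absorbs all powers at once and costs a single factor
  \<open>M\<close>.

  This fixes the constants. The Yosida flow grows like exp(2 \<omega> (t - a)), because \<mu>^2 /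
  (\<mu> - \<omega>) is at most \<mu> + 2 \<omega> once \<mu> is at least 2 \<omega>. The factor 2
  M^2 is \<open>M\<close> from the change of norm times 2 M from the norm of \<open>J \<mu>\<close>.
  Replacing \<omega> by its maximum with 0 keeps the weights exp(-2 \<omega> (s - a)) at most 1.

  Since \<open>D\<close> need not be dense and solutions need not be differentiable, the equation is
  used only in integrated form. It survives uniform limits because A is closed, and applying
  \<open>J \<mu>\<close> to it produces a differentiable function.

  Almost periodicity in operator norm supplies one bound for the coefficients at all times. All
  constants then depend on t - s alone, which gives one exponential bound for the evolution family
  and equicontinuity in the initial time.\<close>

lemma gronwall_forcing:
  fixes \<phi> h :: "real \<Rightarrow> real"
  assumes phi: "continuous_on {a..b} \<phi>" and h: "continuous_on {a..b} h" and c: "0 \<le> c"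
    and le: "\<And>t. t \<in> {a..b} \<Longrightarrow> \<phi> t \<le> \<alpha> + integral {a..t} (\<lambda>s. c * \<phi> s + h s)"
    and t: "t \<in> {a..b}"
  shows "\<phi> t \<le> exp (c * (t - a)) * (\<alpha> + integral {a..t} (\<lambda>s. exp (- c * (s - a)) * h s))"
proof -
  define G where "G = (\<lambda>t. \<alpha> + integral {a..t} (\<lambda>s. c * \<phi> s + h s))"
  \<comment> \<open>\<open>G\<close> is the right-hand side of the hypothesis, so \<phi> \<le>
    \<open>G\<close> and \<open>G\<close> has derivative c \<phi> + h. Multiplying by the
    integrating factor and subtracting the forcing leaves a derivative that is a nonnegative
    multiple of \<phi> - \<open>G\<close>, so \<open>H\<close> decreases from \<alpha>. The weighted
    integral of h is not estimated further: in \<open>yosida_estimate\<close> its weight has to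
    cancel a factor that grows with \<mu>.\<close>
  define H where "H = (\<lambda>t. exp (- c * (t - a)) * G t - integral {a..t} (\<lambda>s. exp (- c * (s - a)) * h s))"
  have c1: "continuous_on {a..b} (\<lambda>s. c * \<phi> s + h s)"
    and c2: "continuous_on {a..b} (\<lambda>s. exp (- c * (s - a)) * h s)"
    by (intro continuous_intros phi h)+
  have dG: "(G has_vector_derivative (c * \<phi> s + h s)) (at s within {a..b})" if "s \<in> {a..b}" for s
    unfolding G_def using integral_has_vector_derivative[OF c1 that]
    by (auto intro!: derivative_eq_intros)
  have dI: "((\<lambda>t. integral {a..t} (\<lambda>s. exp (- c * (s - a)) * h s)) has_vector_derivative
      (exp (- c * (s - a)) * h s)) (at s within {a..b})" if "s \<in> {a..b}" for s
    using integral_has_vector_derivative[OF c2 that] .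
  have dH: "(H has_real_derivative (exp (- c * (s - a)) * (c * (\<phi> s - G s)))) (at s within {a..b})"
    if "s \<in> {a..b}" for s
  proof -
    have "((\<lambda>t. exp (- c * (t - a))) has_real_derivative (- c * exp (- c * (s - a)))) (at s within {a..b})"
      by (auto intro!: derivative_eq_intros)
    from DERIV_diff[OF DERIV_mult[OF this dG[OF that, folded has_real_derivative_iff_has_vector_derivative]]
      dI[OF that, folded has_real_derivative_iff_has_vector_derivative]]
    show ?thesis unfolding H_def by (simp add: algebra_simps)
  qed
  have contH: "continuous_on {a..b} H"
    by (rule DERIV_continuous_on[OF dH])
  have "H t \<le> H a"
  proof (rule DERIV_nonpos_imp_decreasing_open[of a t H])
    show "a \<le> t" using t by auto
    show "continuous_on {a..t} H"
      by (rule continuous_on_subset[OF contH]) (use t in auto)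
    fix s assume s: "a < s" "s < t"
    have "(H has_real_derivative (exp (- c * (s - a)) * (c * (\<phi> s - G s)))) (at s)"
      using dH[of s] s t by (simp add: at_within_Icc_at)
    moreover have "\<phi> s - G s \<le> 0"
      using le[of s] s t by (simp add: G_def)
    hence "exp (- c * (s - a)) * (c * (\<phi> s - G s)) \<le> 0"
      using c by (simp add: mult_nonneg_nonpos)
    ultimately show "\<exists>y. (H has_real_derivative y) (at s) \<and> y \<le> 0" by blast
  qed
  also have "H a = \<alpha>" by (simp add: H_def G_def)
  finally have "exp (- c * (t - a)) * G t \<le> \<alpha> + integral {a..t} (\<lambda>s. exp (- c * (s - a)) * h s)"
    by (simp add: H_def)
  hence "exp (c * (t - a)) * (exp (- c * (t - a)) * G t)
    \<le> exp (c * (t - a)) * (\<alpha> + integral {a..t} (\<lambda>s. exp (- c * (s - a)) * h s))"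
    by (intro mult_left_mono) auto
  also have "exp (c * (t - a)) * (exp (- c * (t - a)) * G t) = G t"
    by (simp add: exp_minus)
  finally show ?thesis using le[OF t] by (simp add: G_def)
qed

lemma gronwall:
  fixes \<phi> :: "real \<Rightarrow> real"
  assumes "continuous_on {a..b} \<phi>" and "0 \<le> c"
    and "\<And>t. t \<in> {a..b} \<Longrightarrow> \<phi> t \<le> \<alpha> + c * integral {a..t} \<phi>"
    and "t \<in> {a..b}"
  shows "\<phi> t \<le> exp (c * (t - a)) * \<alpha>"
  using gronwall_forcing[of a b \<phi> "\<lambda>_. 0" c \<alpha> t] assms by simp

text \<open>Measured against the weight exp(K (s - a)) with K \<ge> 2 L, a Volterra operator with
  constant L shrinks by the factor 1/2, however long the interval is. This removes any smallness
  condition from the fixed point argument.\<close>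

lemma integral_exp_le:
  fixes a t c K L :: real
  assumes "a \<le> t" "0 \<le> c" "0 \<le> L" "2 * L \<le> K" "0 < K"
  shows "L * integral {a..t} (\<lambda>s. c * exp (K * (s - a))) \<le> c / 2 * exp (K * (t - a))"
proof -
  have "((\<lambda>s. c * exp (K * (s - a))) has_integral
      (c / K * exp (K * (t - a)) - c / K * exp (K * (a - a)))) {a..t}"
    by (rule fundamental_theorem_of_calculus[OF \<open>a \<le> t\<close>])
      (use \<open>0 < K\<close> in \<open>auto simp: has_real_derivative_iff_has_vector_derivative[symmetric]
        intro!: derivative_eq_intros\<close>)
  hence "integral {a..t} (\<lambda>s. c * exp (K * (s - a))) = c / K * exp (K * (t - a)) - c / K"
    by (subst integral_unique) auto
  hence "L * integral {a..t} (\<lambda>s. c * exp (K * (s - a))) = L * (c / K * exp (K * (t - a)) - c / K)"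
    by (rule arg_cong)
  also have "\<dots> = c * (L / K) * (exp (K * (t - a)) - 1)"
    by (simp add: algebra_simps)
  also have "\<dots> \<le> c * (1 / 2) * exp (K * (t - a))"
    using assms by (intro mult_mono mult_left_mono) (auto simp: field_simps)
  finally show ?thesis by simp
qed

text \<open>Relational form, because the Volterra operator in the application is only known
  through existence of solutions.\<close>

lemma volterra_fixpoint:
  fixes Rel :: "(real \<Rightarrow> 'a::banach) \<Rightarrow> (real \<Rightarrow> 'a) \<Rightarrow> bool"
  assumes S: "closed S" "x \<in> S"
    and step: "\<And>u. continuous_on {a..b} u \<Longrightarrow> u ` {a..b} \<subseteq> S \<Longrightarrow>
      \<exists>v. continuous_on {a..b} v \<and> v ` {a..b} \<subseteq> S \<and> Rel u v"
    and L: "0 \<le> L"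
    and contr: "\<And>u u' v v' t. \<lbrakk>continuous_on {a..b} u; u ` {a..b} \<subseteq> S;
      continuous_on {a..b} u'; u' ` {a..b} \<subseteq> S; Rel u v; Rel u' v'; t \<in> {a..b}\<rbrakk> \<Longrightarrow>
      norm (v t - v' t) \<le> L * integral {a..t} (\<lambda>s. norm (u s - u' s))"
  obtains u v where "continuous_on {a..b} u" "u ` {a..b} \<subseteq> S" "Rel u v"
    "\<And>t. t \<in> {a..b} \<Longrightarrow> v t = u t"
proof -
  define C where "C u \<longleftrightarrow> continuous_on {a..b} u \<and> u ` {a..b} \<subseteq> S" for u :: "real \<Rightarrow> 'a"
  have "\<exists>u. \<forall>n. C (u n) \<and> Rel (u n) (u (Suc n))"
  proof (rule dependent_nat_choice)
    show "\<exists>u. C u" using S by (intro exI[of _ "\<lambda>_. x"]) (auto simp: C_def)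
    show "\<exists>v. C v \<and> Rel u v" if "C u" for u n
      using step[of u] that by (auto simp: C_def)
  qed
  then obtain u where u: "\<And>n. C (u n)" "\<And>n. Rel (u n) (u (Suc n))" by blast
  \<comment> \<open>The summand 1 keeps \<open>K\<close> positive when \<open>L\<close> is
    0.\<close>
  define K where "K = 2 * L + 1"
  have "continuous_on {a..b} (\<lambda>t. u 1 t - u 0 t)"
    using u(1) by (intro continuous_intros) (auto simp: C_def)
  hence "bounded ((\<lambda>t. u 1 t - u 0 t) ` {a..b})"
    by (intro compact_imp_bounded compact_continuous_image) auto
  then obtain c where c: "0 < c" "\<And>t. t \<in> {a..b} \<Longrightarrow> norm (u 1 t - u 0 t) \<le> c"
    unfolding bounded_pos by auto
  have est: "norm (u (Suc n) t - u n t) \<le> c * (1/2)^n * exp (K * (t - a))" if "t \<in> {a..b}" for n t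
    using that
  proof (induction n arbitrary: t)
    case 0
    have "c * 1 \<le> c * exp (K * (t - a))"
      using c(1) L 0 by (intro mult_left_mono) (auto simp: K_def)
    thus ?case using c(2)[OF 0] by simp
  next
    case (Suc n)
    have sub: "{a..t} \<subseteq> {a..b}" using Suc.prems by auto
    have cu: "continuous_on {a..t} (\<lambda>s. norm (u (Suc n) s - u n s))"
      using u(1) by (intro continuous_intros continuous_on_subset[OF _ sub]) (auto simp: C_def)
    have "norm (u (Suc (Suc n)) t - u (Suc n) t)
        \<le> L * integral {a..t} (\<lambda>s. norm (u (Suc n) s - u n s))"
      using u Suc.prems by (intro contr) (auto simp: C_def)
    also have "\<dots> \<le> L * integral {a..t} (\<lambda>s. c * (1/2)^n * exp (K * (s - a)))"
    proof (intro mult_left_mono integral_le L)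
      show "(\<lambda>s. norm (u (Suc n) s - u n s)) integrable_on {a..t}"
        by (rule integrable_continuous_interval[OF cu])
      show "(\<lambda>s. c * (1/2)^n * exp (K * (s - a))) integrable_on {a..t}"
        by (intro integrable_continuous_interval continuous_intros)
      show "norm (u (Suc n) s - u n s) \<le> c * (1/2)^n * exp (K * (s - a))" if "s \<in> {a..t}" for s
        using Suc.IH[of s] that sub by auto
    qed
    also have "\<dots> \<le> c * (1/2)^n / 2 * exp (K * (t - a))"
      using Suc.prems c L by (intro integral_exp_le) (auto simp: K_def)
    finally show ?case by simp
  qed
  \<comment> \<open>The limit of the iterates, written as a telescoping series so that the
    Weierstrass test gives uniform convergence.\<close>
  define l where "l t = u 0 t + (\<Sum>i. u (Suc i) t - u i t)" for t
  have "uniform_limit {a..b} (\<lambda>n t. \<Sum>i<n. u (Suc i) t - u i t) (\<lambda>t. \<Sum>i. u (Suc i) t - u i t) sequentially"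
  proof (rule Weierstrass_m_test)
    show "norm (u (Suc n) t - u n t) \<le> c * exp (K * (b - a)) * (1/2)^n" if "t \<in> {a..b}" for n t
    proof -
      have "K * (t - a) \<le> K * (b - a)" using that L by (intro mult_left_mono) (auto simp: K_def)
      hence "c * (1/2)^n * exp (K * (t - a)) \<le> c * (1/2)^n * exp (K * (b - a))"
        using c by (intro mult_left_mono) auto
      thus ?thesis using est[OF that, of n] by (simp add: mult_ac)
    qed
    show "summable (\<lambda>n. c * exp (K * (b - a)) * (1/2)^n)"
      by (intro summable_mult summable_geometric) auto
  qed
  hence "uniform_limit {a..b} (\<lambda>n t. u 0 t + (\<Sum>i<n. u (Suc i) t - u i t)) l sequentially"
    unfolding l_def by (intro uniform_limit_intros)
  moreover have "u 0 t + (\<Sum>i<n. u (Suc i) t - u i t) = u n t" for n t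
    by (subst sum_lessThan_telescope) simp
  ultimately have lim: "uniform_limit {a..b} u l sequentially" by simp
  have cl: "continuous_on {a..b} l"
    by (rule uniform_limit_theorem[OF _ lim]) (use u(1) in \<open>auto simp: C_def\<close>)
  have ptw: "(\<lambda>n. u n t) \<longlonglongrightarrow> l t" if "t \<in> {a..b}" for t
    using lim that by (rule tendsto_uniform_limitI)
  have lS: "l ` {a..b} \<subseteq> S"
  proof clarify
    fix t assume "t \<in> {a..b}"
    show "l t \<in> S"
      by (rule Lim_in_closed_set[OF S(1) _ _ ptw[OF \<open>t \<in> {a..b}\<close>]])
        (use u(1) \<open>t \<in> {a..b}\<close> in \<open>auto simp: C_def image_subset_iff\<close>)
  qed
  obtain v where v: "continuous_on {a..b} v" "Rel l v" using step[OF cl lS] by blast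
  \<comment> \<open>\<open>step\<close> only provides some \<open>v\<close> related to
    \<open>l\<close>. By contractivity the shifted iterates converge to this \<open>v\<close>, and
    they converge to \<open>l\<close> as well.\<close>
  have "v t = l t" if t: "t \<in> {a..b}" for t
  proof -
    have "(\<lambda>n. u (Suc n) t) \<longlonglongrightarrow> v t"
    proof (rule metric_LIMSEQ_I)
      fix e :: real assume e: "0 < e"
      define e' where "e' = e / (2 * (L * (b - a) + 1))"
      have "0 \<le> L * (b - a)" using L t by auto
      hence pos: "0 < L * (b - a) + 1" by linarith
      hence e': "0 < e'" using e by (simp add: e'_def)
      obtain N where N: "\<And>n s. n \<ge> N \<Longrightarrow> s \<in> {a..b} \<Longrightarrow> norm (u n s - l s) < e'"
        using uniform_limitD[OF lim e'] unfolding eventually_sequentially dist_norm by blast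
      show "\<exists>N. \<forall>n\<ge>N. dist (u (Suc n) t) (v t) < e"
      proof (intro exI allI impI)
        fix n assume n: "n \<ge> N"
        have sub: "{a..t} \<subseteq> {a..b}" using t by auto
        have "norm (u (Suc n) t - v t) \<le> L * integral {a..t} (\<lambda>s. norm (u n s - l s))"
          using u v(2) t cl lS by (intro contr) (auto simp: C_def)
        also have "\<dots> \<le> L * integral {a..t} (\<lambda>s. e')"
        proof (intro mult_left_mono integral_le L)
          show "(\<lambda>s. norm (u n s - l s)) integrable_on {a..t}"
            using u(1)[of n] by (intro integrable_continuous_interval continuous_intros
              continuous_on_subset[OF cl sub]) (auto simp: C_def intro: continuous_on_subset[OF _ sub])
          show "norm (u n s - l s) \<le> e'" if "s \<in> {a..t}" for s
            using N[OF n, of s] that sub by auto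
        qed auto
        also have "\<dots> = L * (t - a) * e'" using t by simp
        also have "\<dots> \<le> (L * (b - a) + 1) * e'"
        proof (rule mult_right_mono)
          have "L * (t - a) \<le> L * (b - a)" using t L by (intro mult_left_mono) auto
          thus "L * (t - a) \<le> L * (b - a) + 1" by simp
        qed (use e' in auto)
        also have "\<dots> = e / 2" using pos by (simp add: e'_def field_simps)
        finally show "dist (u (Suc n) t) (v t) < e" using e by (simp add: dist_norm)
      qed
    qed
    moreover have "(\<lambda>n. u (Suc n) t) \<longlonglongrightarrow> l t" using ptw[OF t] by (rule LIMSEQ_Suc)
    ultimately show ?thesis by (rule LIMSEQ_unique)
  qed
  thus ?thesis using that[OF cl lS v(2)] by blast
qed

section \<open>Auxiliary facts on integrals, interpolation, nets and bounded equations\<close>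

lemma integral_bounded_linear_continuous:
  fixes f :: "real \<Rightarrow> 'a::banach" and L :: "'a \<Rightarrow> 'b::banach"
  assumes "bounded_linear L" and "continuous_on {a..t} f"
  shows "integral {a..t} (\<lambda>s. L (f s)) = L (integral {a..t} f)"
  using integral_linear[OF integrable_continuous_interval[OF assms(2)] assms(1)]
  by (simp add: o_def)

lemma integral_tendsto_uniform:
  fixes f :: "nat \<Rightarrow> real \<Rightarrow> 'a::banach"
  assumes u: "uniform_limit {a..b} f g sequentially" and c: "\<And>n. continuous_on {a..b} (f n)"
    and t: "t \<in> {a..b}"
  shows "(\<lambda>n. integral {a..t} (f n)) \<longlonglongrightarrow> integral {a..t} g"
proof -
  have sub: "{a..t} \<subseteq> {a..b}" using t by auto
  have "uniform_limit {a..t} f g sequentially" using u sub by (rule uniform_limit_on_subset)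
  moreover have "continuous_on {a..t} (f n)" for n by (rule continuous_on_subset[OF c sub])
  ultimately obtain I J where I: "\<And>n. (f n has_integral I n) {a..t}"
      and J: "(g has_integral J) {a..t}" and lim: "I \<longlonglongrightarrow> J"
    by (rule uniform_limit_integral) auto
  have "I = (\<lambda>n. integral {a..t} (f n))" "J = integral {a..t} g"
    by (rule ext) (rule integral_unique[OF I, symmetric], rule integral_unique[OF J, symmetric])
  thus ?thesis using lim by simp
qed

lemma subspace_closure:
  fixes S :: "'a::real_normed_vector set"
  assumes "subspace S"
  shows "subspace (closure S)"
proof (rule subspaceI)
  show "0 \<in> closure S" using subspace_0[OF assms] closure_subset by blast
next
  fix x y assume "x \<in> closure S" "y \<in> closure S"
  then obtain f g where "\<And>n. f n \<in> S" "f \<longlonglongrightarrow> x" "\<And>n. g n \<in> S" "g \<longlonglongrightarrow> y"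
    unfolding closure_sequential by blast
  thus "x + y \<in> closure S"
    unfolding closure_sequential
    by (intro exI[of _ "\<lambda>n. f n + g n"]) (auto intro: tendsto_add subspace_add[OF assms])
next
  fix c x assume "x \<in> closure S"
  then obtain f where "\<And>n. f n \<in> S" "f \<longlonglongrightarrow> x"
    unfolding closure_sequential by blast
  thus "c *\<^sub>R x \<in> closure S"
    unfolding closure_sequential
    by (intro exI[of _ "\<lambda>n. c *\<^sub>R f n"]) (auto intro: tendsto_intros subspace_scale[OF assms])
qed

lemma bounded_linear_funpow:
  fixes f :: "'a::real_normed_vector \<Rightarrow> 'a"
  assumes "bounded_linear f"
  shows "bounded_linear (f ^^ n)"
  by (induction n) (auto simp: id_def o_def bounded_linear_ident intro: bounded_linear_compose[OF assms])

lemma integral_combine_continuous: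
  fixes f :: "real \<Rightarrow> 'a::banach"
  assumes "continuous_on {a..b} f" "a \<le> c" "c \<le> t" "t \<le> b"
  shows "integral {a..t} f = integral {a..c} f + integral {c..t} f"
proof -
  have "{a..t} \<subseteq> {a..b}" using assms by auto
  thus ?thesis using assms Henstock_Kurzweil_Integration.integral_combine[OF assms(2,3)]
    by (metis integrable_continuous_interval continuous_on_subset)
qed

text \<open>Balls are convex, and the interpolant at s is the convex combination of p and q with
  weight (s - a) / (b - a).\<close>

lemma affine_interpolation_close:
  fixes p q c :: "'a::real_normed_vector"
  assumes "norm (p - c) \<le> e" "norm (q - c) \<le> e" "a \<le> s" "s \<le> b" "a < b"
  shows "norm (p + (s - a) *\<^sub>R ((q - p) /\<^sub>R (b - a)) - c) \<le> e"
proof -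
  define \<theta> where "\<theta> = (s - a) / (b - a)"
  have \<theta>: "0 \<le> \<theta>" "\<theta> \<le> 1" using assms by (auto simp: \<theta>_def)
  have "p + (s - a) *\<^sub>R ((q - p) /\<^sub>R (b - a)) - c = (1 - \<theta>) *\<^sub>R (p - c) + \<theta> *\<^sub>R (q - c)"
    by (simp add: \<theta>_def divide_inverse algebra_simps)
  also have "norm \<dots> \<le> (1 - \<theta>) * norm (p - c) + \<theta> * norm (q - c)"
    using norm_triangle_ineq[of "(1 - \<theta>) *\<^sub>R (p - c)" "\<theta> *\<^sub>R (q - c)"] \<theta> by simp
  also have "\<dots> \<le> (1 - \<theta>) * e + \<theta> * e"
    using \<theta> assms by (intro add_mono mult_left_mono) auto
  finally show ?thesis by (simp add: algebra_simps)
qed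

text \<open>The net will consist of initial times. A solution started at c can be compared with one
  started at t only if c \<le> t, so every t needs a net point on its left.\<close>

lemma finite_left_net:
  fixes a b d :: real
  assumes "0 < d"
  obtains N where "finite N" "N \<subseteq> {a..b}" "\<And>t. t \<in> {a..b} \<Longrightarrow> \<exists>c\<in>N. c \<le> t \<and> t - c < d"
proof
  define m where "m = nat \<lceil>(b - a) / d\<rceil>"
  let ?N = "(\<lambda>i. a + real i * d) ` {..m} \<inter> {a..b}"
  show "finite ?N" "?N \<subseteq> {a..b}" by auto
  fix t assume t: "t \<in> {a..b}"
  define i where "i = nat \<lfloor>(t - a) / d\<rfloor>"
  have "0 \<le> (t - a) / d" using t assms by simp
  hence i: "real i \<le> (t - a) / d" "(t - a) / d < real i + 1"
    unfolding i_def by (simp_all add: of_nat_nat)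
  have "real i * d \<le> t - a" "t - a < (real i + 1) * d"
    using i assms by (auto simp: le_divide_eq divide_less_eq)
  moreover have "i \<le> m"
  proof -
    have "(t - a) / d \<le> (b - a) / d" using t assms by (intro divide_right_mono) auto
    hence "\<lfloor>(t - a) / d\<rfloor> \<le> \<lceil>(b - a) / d\<rceil>" by linarith
    thus ?thesis unfolding i_def m_def by (rule nat_mono)
  qed
  ultimately show "\<exists>c\<in>?N. c \<le> t \<and> t - c < d"
    using t assms by (intro bexI[of _ "a + real i * d"]) (auto simp: algebra_simps)
qed

text \<open>This supplies the flows of the Yosida approximations, which are bounded
  operators.\<close>

lemma bounded_linear_ode_exists:
  fixes L :: "'a::banach \<Rightarrow> 'a"
  assumes L: "bounded_linear L" and ab: "a \<le> b"
  obtains u where "u a = x"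
    "\<And>t. t \<in> {a..b} \<Longrightarrow> (u has_vector_derivative L (u t)) (at t within {a..b})"
proof -
  obtain K where K: "0 < K" "\<And>x. norm (L x) \<le> K * norm x"
    using bounded_linear.pos_bounded[OF L] by (auto simp: mult.commute)
  have cL: "continuous_on S (\<lambda>s. L (u s))" if "continuous_on S u" for S :: "real set" and u
    by (rule bounded_linear.continuous_on[OF L that])
  define Rel where "Rel u v \<longleftrightarrow> (\<forall>t\<in>{a..b}. v t = x + integral {a..t} (\<lambda>s. L (u s)))" for u v
  obtain u v where u: "continuous_on {a..b} u" "Rel u v" "\<And>t. t \<in> {a..b} \<Longrightarrow> v t = u t"
  proof (rule volterra_fixpoint[of UNIV x a b Rel K])
    show "\<exists>v. continuous_on {a..b} v \<and> v ` {a..b} \<subseteq> UNIV \<and> Rel u v" if "continuous_on {a..b} u" for u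
      by (intro exI[of _ "\<lambda>t. x + integral {a..t} (\<lambda>s. L (u s))"] conjI continuous_intros
          indefinite_integral_continuous_1 integrable_continuous_interval cL that) (auto simp: Rel_def)
    fix u u' v v' :: "real \<Rightarrow> 'a" and t
    assume c: "continuous_on {a..b} u" "continuous_on {a..b} u'" and r: "Rel u v" "Rel u' v'"
      and t: "t \<in> {a..b}"
    have sub: "{a..t} \<subseteq> {a..b}" using t by auto
    have "v t - v' t = integral {a..t} (\<lambda>s. L (u s)) - integral {a..t} (\<lambda>s. L (u' s))"
      using r t by (auto simp: Rel_def)
    also have "\<dots> = integral {a..t} (\<lambda>s. L (u s) - L (u' s))"
      by (intro Henstock_Kurzweil_Integration.integral_diff[symmetric] integrable_continuous_interval
          continuous_on_subset[OF _ sub] cL c)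
    finally have "norm (v t - v' t) \<le> integral {a..t} (\<lambda>s. K * norm (u s - u' s))"
    proof (elim ssubst, intro integral_norm_bound_integral)
      show "norm (L (u s) - L (u' s)) \<le> K * norm (u s - u' s)" for s
        using K(2)[of "u s - u' s"] by (simp add: linear_diff[OF bounded_linear.linear[OF L]])
    qed (intro integrable_continuous_interval continuous_on_subset[OF _ sub] continuous_intros cL c)+
    thus "norm (v t - v' t) \<le> K * integral {a..t} (\<lambda>s. norm (u s - u' s))" by simp
  qed (use K in auto)
  have ueq: "u t = x + integral {a..t} (\<lambda>s. L (u s))" if "t \<in> {a..b}" for t
    using u(2,3) that by (simp add: Rel_def)
  show ?thesis
  proof
    show "u a = x" using ueq[of a] ab by simp
    fix t assume t: "t \<in> {a..b}"
    have d: "((\<lambda>t. x + integral {a..t} (\<lambda>s. L (u s))) has_vector_derivative L (u t)) (at t within {a..b})"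
      using integral_has_vector_derivative[OF cL[OF u(1)] t] by (auto intro!: derivative_eq_intros)
    show "(u has_vector_derivative L (u t)) (at t within {a..b})"
      by (rule has_vector_derivative_transform[OF t _ d]) (rule ueq)
  qed
qed

text \<open>A derivative that vanishes uniformly, phrased through increments. In
  \<open>duhamel\<close> the increments of the relevant function can be bounded directly, so the
  evolution family is never differentiated in its second argument. Subdivision adds the increments
  up, since the bound e (s' - s) is additive over adjacent intervals.\<close>

lemma constant_of_small_increments:
  fixes G :: "real \<Rightarrow> 'a::real_normed_vector"
  assumes ab: "a \<le> b"
    and small: "\<And>e. 0 < e \<Longrightarrow> \<exists>d>0. \<forall>s s'. a \<le> s \<longrightarrow> s \<le> s' \<longrightarrow> s' \<le> b \<longrightarrow> s' - s < d \<longrightarrow>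
      norm (G s' - G s) \<le> e * (s' - s)"
  shows "G b = G a"
proof -
  have bound: "norm (G b - G a) \<le> e * (b - a)" if e: "0 < e" for e
  proof -
    obtain d where d: "0 < d" "\<And>s s'. a \<le> s \<Longrightarrow> s \<le> s' \<Longrightarrow> s' \<le> b \<Longrightarrow> s' - s < d \<Longrightarrow>
        norm (G s' - G s) \<le> e * (s' - s)"
      using small[OF e] by blast
    define P where "P p q \<longleftrightarrow> (a \<le> p \<and> p \<le> q \<and> q \<le> b \<longrightarrow> norm (G q - G p) \<le> e * (q - p))" for p q
    have "P a b"
    proof (rule Bolzano[OF ab])
      fix p q r assume "P p q" "P q r" "p \<le> q" "q \<le> r"
      thus "P p r"
        unfolding P_def using norm_triangle_ineq[of "G r - G q" "G q - G p"]
        by (auto simp: algebra_simps)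
    next
      show "\<exists>d>0. \<forall>a b. a \<le> x \<and> x \<le> b \<and> b - a < d \<longrightarrow> P a b" for x
        using d by (intro exI[of _ d]) (auto simp: P_def)
    qed
    thus ?thesis using ab by (simp add: P_def)
  qed
  have "norm (G b - G a) \<le> 0"
  proof (rule field_le_epsilon)
    fix e :: real assume e: "0 < e"
    have p: "0 < b - a + 1" using ab by simp
    have "e / (b - a + 1) * (b - a) \<le> e" using p e by (simp add: divide_le_eq)
    thus "norm (G b - G a) \<le> 0 + e" using bound[of "e / (b - a + 1)"] e p by simp
  qed
  thus ?thesis by simp
qed

section \<open>Operators on a subspace\<close>

lemma linear_operator_diff:
  assumes "linear_operator S f" "linear_operator S g"
  shows "linear_operator S (\<lambda>x. f x - g x)"
  using assms unfolding linear_operator_def by (auto simp: algebra_simps)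

lemma op_dist_bound:
  assumes f: "bounded_linear_on S f" and g: "bounded_linear_on S g" and x: "x \<in> S"
  shows "norm (f x - g x) \<le> op_dist S f g * norm x"
proof -
  obtain K L where KL: "\<And>x. x \<in> S \<Longrightarrow> norm (f x) \<le> K * norm x" "\<And>x. x \<in> S \<Longrightarrow> norm (g x) \<le> L * norm x"
    using f g unfolding bounded_linear_on_def by blast
  have "norm (f x - g x) \<le> (K + L) * norm x" if "x \<in> S" for x
    using norm_triangle_ineq4[of "f x" "g x"] KL[OF that] by (simp add: algebra_simps)
  hence "bounded_linear_on S (\<lambda>x. f x - g x)"
    using f g linear_operator_diff unfolding bounded_linear_on_def by blast
  from onorm_on_bound[OF this x] show ?thesis unfolding op_dist_def .
qed

text \<open>An almost period for the tolerance 1 moves any time into [0, l] and changes the operator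
  by at most 1 in norm. On [0, l] local bounds from continuity are joined by subdivision.\<close>

lemma almost_periodic_operators_bounded:
  fixes F :: "real \<Rightarrow> 'a::real_normed_vector \<Rightarrow> 'b::real_normed_vector"
  assumes "almost_periodic_operators S F"
  obtains \<beta> where "0 \<le> \<beta>" "\<And>t x. x \<in> S \<Longrightarrow> norm (F t x) \<le> \<beta> * norm x"
proof -
  have bl: "\<And>t. bounded_linear_on S (F t)" and ap: "almost_periodic (op_dist S) F"
    using assms by (auto simp: almost_periodic_operators_def)
  \<comment> \<open>Both orders of the arguments occur: continuity delivers the second disjunct, an
    almost period the first.\<close>
  have near: "norm (F s x) \<le> (K + 1) * norm x"
    if "op_dist S (F t) (F s) < 1 \<or> op_dist S (F s) (F t) < 1" "norm (F t x) \<le> K * norm x" "x \<in> S" for s t x K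
  proof -
    have "norm (F s x - F t x) \<le> 1 * norm x"
      using op_dist_bound[OF bl bl that(3), of s t] op_dist_bound[OF bl bl that(3), of t s] that(1)
        mult_right_mono[OF less_imp_le norm_ge_zero, of _ 1 x]
      by (metis norm_minus_commute order_trans)
    thus ?thesis using that(2) norm_triangle_sub[of "F s x" "F t x"] by (simp add: algebra_simps)
  qed
  obtain l where l: "0 < l" "\<And>c. {c..c + l} \<inter> {s. \<forall>t. op_dist S (F (t + s)) (F t) < 1} \<noteq> {}"
    using ap zero_less_one unfolding almost_periodic_def relatively_dense_def by blast
  define P where "P c d \<longleftrightarrow> (\<exists>K\<ge>0. \<forall>s\<in>{c..d}. \<forall>x\<in>S. norm (F s x) \<le> K * norm x)" for c d
  have "P 0 l"
  proof (rule Bolzano)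
    show "0 \<le> l" using l by simp
    fix a b c assume "P a b" "P b c"
    then obtain K L where KL: "0 \<le> K" "0 \<le> L" "\<forall>s\<in>{a..b}. \<forall>x\<in>S. norm (F s x) \<le> K * norm x"
        "\<forall>s\<in>{b..c}. \<forall>x\<in>S. norm (F s x) \<le> L * norm x"
      unfolding P_def by blast
    have "norm (F s x) \<le> max K L * norm x" if "s \<in> {a..c}" "x \<in> S" for s x
    proof -
      have "norm (F s x) \<le> K * norm x \<or> norm (F s x) \<le> L * norm x"
        using KL that by (cases "s \<le> b") auto
      thus ?thesis
        using mult_right_mono[of K "max K L" "norm x"] mult_right_mono[of L "max K L" "norm x"] by auto
    qed
    thus "P a c" unfolding P_def using KL by (intro exI[of _ "max K L"]) auto
  next
    fix t
    obtain d where d: "0 < d" "\<And>s. \<bar>s - t\<bar> < d \<Longrightarrow> op_dist S (F s) (F t) < 1"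
      using ap zero_less_one unfolding almost_periodic_def by blast
    obtain K where K: "\<And>x. x \<in> S \<Longrightarrow> norm (F t x) \<le> K * norm x"
      using bl[of t] unfolding bounded_linear_on_def by blast
    have K': "norm (F t x) \<le> max K 0 * norm x" if "x \<in> S" for x
      using K[OF that] mult_right_mono[of K "max K 0" "norm x"] by auto
    have "P a b" if "a \<le> t" "t \<le> b" "b - a < d" for a b
      unfolding P_def
    proof (intro exI conjI ballI)
      show "0 \<le> max K 0 + 1" by simp
      fix s x assume "s \<in> {a..b}" and x: "x \<in> S"
      hence "\<bar>s - t\<bar> < d" using that by auto
      thus "norm (F s x) \<le> (max K 0 + 1) * norm x" using d(2)[of s] x by (intro near[OF _ K']) auto
    qed
    thus "\<exists>d>0. \<forall>a b. a \<le> t \<and> t \<le> b \<and> b - a < d \<longrightarrow> P a b" using d(1) by blast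
  qed
  then obtain K where K: "0 \<le> K" "\<And>s x. s \<in> {0..l} \<Longrightarrow> x \<in> S \<Longrightarrow> norm (F s x) \<le> K * norm x"
    unfolding P_def by blast
  show ?thesis
  proof
    show "0 \<le> K + 1" using K by simp
    fix t x assume x: "x \<in> S"
    \<comment> \<open>The window for the almost period starts at -t, so that t + s falls into
      [0, l].\<close>
    obtain s where s: "s \<in> {- t..- t + l}" "op_dist S (F (t + s)) (F t) < 1" using l(2)[of "- t"] by blast
    show "norm (F t x) \<le> (K + 1) * norm x"
      by (rule near[where t = "t + s"]) (use s x in \<open>auto intro: K\<close>)
  qed
qed

text \<open>This stands outside the locale because integrability in the final theorem concerns every
  \<mu> above the original growth bound, including values \<mu> \<le> 0 when that bound is negative.
  The locale covers only \<mu> above a nonnegative bound.\<close>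

lemma resolvent_in_domain: "\<mu> \<in> resolvent_set D A \<Longrightarrow> resolvent D A \<mu> y \<in> D"
  unfolding resolvent_set_def resolvent_def bij_betw_def by (auto intro: inv_into_into)

text \<open>The resolvent bound weakens when \<omega> grows. It is used to make \<omega>
  nonnegative, which makes exp(2 \<omega> (t - a)) monotone in t and its reciprocal at most 1 for t
  \<ge> a.\<close>

lemma hille_yosida_mono:
  assumes hy: "hille_yosida D A \<omega> M" and le: "\<omega> \<le> \<omega>'"
  shows "hille_yosida D A \<omega>' M"
  unfolding hille_yosida_def
proof (intro conjI allI impI)
  show "linear_operator D A" "1 \<le> M" "{\<omega>'<..} \<subseteq> resolvent_set D A"
    using assms by (auto simp: hille_yosida_def)
  fix \<mu> and n :: nat assume \<mu>: "\<omega>' < \<mu>" and n: "1 \<le> n"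
  have "onorm (resolvent D A \<mu> ^^ n) \<le> M * inverse ((\<mu> - \<omega>) ^ n)"
    using hy \<mu> n le by (auto simp: hille_yosida_def)
  also have "\<dots> \<le> M * inverse ((\<mu> - \<omega>') ^ n)"
    using hy \<mu> le by (intro mult_left_mono le_imp_inverse_le power_mono) (auto simp: hille_yosida_def)
  finally show "onorm (resolvent D A \<mu> ^^ n) \<le> M * inverse ((\<mu> - \<omega>') ^ n)" .
qed

section \<open>Resolvents and Yosida approximations\<close>

locale hille_yosida_operator =
  fixes D :: "'a::banach set" and A :: "'a \<Rightarrow> 'a" and \<omega> M :: real
  assumes hy: "hille_yosida D A \<omega> M" and \<omega>_nonneg: "0 \<le> \<omega>"
begin

abbreviation R :: "real \<Rightarrow> 'a \<Rightarrow> 'a" where "R \<equiv> resolvent D A"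

definition J :: "real \<Rightarrow> 'a \<Rightarrow> 'a" where "J \<mu> x = \<mu> *\<^sub>R R \<mu> x"

text \<open>The formula avoids A, so the operator is visibly bounded and defined everywhere. By
  \<open>A_J\<close> it is A after \<open>J \<mu>\<close>; by \<open>J_A\<close> it is
  \<open>J \<mu>\<close> after A on D.\<close>

definition yosida :: "real \<Rightarrow> 'a \<Rightarrow> 'a" where "yosida \<mu> x = \<mu> *\<^sub>R (J \<mu> x - x)"

lemma subspace_D: "subspace D"
  using hy by (auto simp: hille_yosida_def linear_operator_def)

lemma subspace_closure_D: "subspace (closure D)"
  using subspace_D by (rule subspace_closure)

lemmas D_add = subspace_add[OF subspace_D]
  and D_diff = subspace_diff[OF subspace_D]
  and D_scale = subspace_scale[OF subspace_D]
  and closure_D_add = subspace_add[OF subspace_closure_D]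
  and closure_D_diff = subspace_diff[OF subspace_closure_D]
  and closure_D_scale = subspace_scale[OF subspace_closure_D]

lemma A_add: "x \<in> D \<Longrightarrow> y \<in> D \<Longrightarrow> A (x + y) = A x + A y"
  and A_scale: "x \<in> D \<Longrightarrow> A (c *\<^sub>R x) = c *\<^sub>R A x"
  using hy by (auto simp: hille_yosida_def linear_operator_def)

lemma zero_D: "0 \<in> D" using subspace_D by (rule subspace_0)

lemma A_zero: "A 0 = 0"
  using A_scale[OF zero_D, of 0] by simp

lemma A_diff: "x \<in> D \<Longrightarrow> y \<in> D \<Longrightarrow> A (x - y) = A x - A y"
  using A_add[of x "(-1) *\<^sub>R y"] A_scale[of y "-1"] subspace_scale[OF subspace_D, of y "-1"] by simp

lemma M_ge_1: "1 \<le> M" using hy by (auto simp: hille_yosida_def)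

lemma resolvent_setI: "\<omega> < \<mu> \<Longrightarrow> \<mu> \<in> resolvent_set D A"
  using hy by (auto simp: hille_yosida_def)

lemma bounded_linear_R: "\<omega> < \<mu> \<Longrightarrow> bounded_linear (R \<mu>)"
  using resolvent_setI by (auto simp: resolvent_set_def)

lemma R_in_D: "\<omega> < \<mu> \<Longrightarrow> R \<mu> y \<in> D"
  using resolvent_setI[of \<mu>] unfolding resolvent_set_def resolvent_def bij_betw_def
  by (auto intro: inv_into_into)

lemma R_right: "\<omega> < \<mu> \<Longrightarrow> \<mu> *\<^sub>R R \<mu> y - A (R \<mu> y) = y"
  using resolvent_setI[of \<mu>] f_inv_into_f[of y "\<lambda>x. \<mu> *\<^sub>R x - A x" D]
  unfolding resolvent_set_def resolvent_def bij_betw_def by auto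

lemma R_left: "\<omega> < \<mu> \<Longrightarrow> x \<in> D \<Longrightarrow> R \<mu> (\<mu> *\<^sub>R x - A x) = x"
  using resolvent_setI[of \<mu>] inv_into_f_f[of "\<lambda>x. \<mu> *\<^sub>R x - A x" D x]
  unfolding resolvent_set_def resolvent_def bij_betw_def by auto

lemma A_R: "\<omega> < \<mu> \<Longrightarrow> A (R \<mu> y) = \<mu> *\<^sub>R R \<mu> y - y"
  using R_right[of \<mu> y] by (simp add: algebra_simps)

lemma R_A:
  assumes "\<omega> < \<mu>" "x \<in> D"
  shows "R \<mu> (A x) = \<mu> *\<^sub>R R \<mu> x - x"
  using R_left[OF assms] bounded_linear.linear[OF bounded_linear_R[OF assms(1)]]
  by (simp add: linear_diff linear_scale algebra_simps)

lemma R_power_bound: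
  assumes "\<omega> < \<mu>"
  shows "norm ((R \<mu> ^^ n) x) \<le> M / (\<mu> - \<omega>) ^ n * norm x"
proof (cases "n = 0")
  case True
  thus ?thesis using M_ge_1 mult_right_mono[of 1 M "norm x"] by simp
next
  case False
  have "norm ((R \<mu> ^^ n) x) \<le> onorm (R \<mu> ^^ n) * norm x"
    by (intro onorm bounded_linear_funpow bounded_linear_R assms)
  also have "onorm (R \<mu> ^^ n) \<le> M / (\<mu> - \<omega>) ^ n"
    using hy assms False by (auto simp: hille_yosida_def divide_inverse)
  finally show ?thesis by (simp add: mult_right_mono)
qed

lemma R_bound: "\<omega> < \<mu> \<Longrightarrow> norm (R \<mu> x) \<le> M / (\<mu> - \<omega>) * norm x"
  using R_power_bound[of \<mu> 1 x] by simp

lemma J_in_D: "\<omega> < \<mu> \<Longrightarrow> J \<mu> x \<in> D"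
  by (simp add: J_def R_in_D D_scale)

lemma bounded_linear_J: "\<omega> < \<mu> \<Longrightarrow> bounded_linear (J \<mu>)"
  unfolding J_def by (intro bounded_linear_const_scaleR bounded_linear_R)

lemma bounded_linear_yosida: "\<omega> < \<mu> \<Longrightarrow> bounded_linear (yosida \<mu>)"
  unfolding yosida_def
  by (intro bounded_linear_const_scaleR bounded_linear_sub bounded_linear_J bounded_linear_ident)

lemma A_J: "\<omega> < \<mu> \<Longrightarrow> A (J \<mu> x) = yosida \<mu> x"
  by (simp add: J_def yosida_def A_scale R_in_D A_R)

lemma J_A: "\<omega> < \<mu> \<Longrightarrow> x \<in> D \<Longrightarrow> J \<mu> (A x) = yosida \<mu> x"
  by (simp add: J_def yosida_def R_A)

lemma J_bound:
  assumes "\<omega> < \<mu>" "2 * \<omega> \<le> \<mu>"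
  shows "norm (J \<mu> x) \<le> 2 * M * norm x"
proof -
  have "norm (J \<mu> x) \<le> \<mu> * (M / (\<mu> - \<omega>) * norm x)"
    using assms \<omega>_nonneg mult_left_mono[OF R_bound[OF assms(1), of x], of \<mu>] by (simp add: J_def)
  also have "\<dots> = (\<mu> / (\<mu> - \<omega>)) * (M * norm x)" by simp
  \<comment> \<open>The threshold \<mu> \<ge> 2 \<omega> is exactly what makes \<mu> / (\<mu> -
    \<omega>) at most 2.\<close>
  also have "\<dots> \<le> 2 * (M * norm x)"
    using assms M_ge_1 by (intro mult_right_mono) (auto simp: field_simps)
  finally show ?thesis by simp
qed

lemma R_commute:
  assumes "\<omega> < \<mu>" "\<omega> < \<nu>"
  shows "R \<mu> (R \<nu> x) = R \<nu> (R \<mu> x)"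
proof -
  define z where "z = R \<mu> x"
  have z: "z \<in> D" using assms by (simp add: z_def R_in_D)
  interpret bounded_linear "R \<nu>" using assms by (intro bounded_linear_R)
  have "\<mu> *\<^sub>R R \<nu> z - A (R \<nu> z) = R \<nu> (\<mu> *\<^sub>R z - A z)"
    using assms z by (simp add: A_R R_A diff scaleR)
  also have "\<mu> *\<^sub>R z - A z = x" using assms by (simp add: z_def R_right)
  finally have "R \<mu> (R \<nu> x) = R \<mu> (\<mu> *\<^sub>R R \<nu> z - A (R \<nu> z))" by simp
  also have "\<dots> = R \<nu> z" using assms by (simp add: R_left R_in_D)
  finally show ?thesis by (simp add: z_def)
qed

lemma J_commute: "\<omega> < \<mu> \<Longrightarrow> \<omega> < \<nu> \<Longrightarrow> J \<mu> (J \<nu> x) = J \<nu> (J \<mu> x)"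
  using R_commute[of \<mu> \<nu> x]
  by (simp add: J_def linear_scale[OF bounded_linear.linear[OF bounded_linear_R]])

lemma yosida_commute:
  assumes "\<omega> < \<mu>" "\<omega> < \<nu>"
  shows "yosida \<mu> (yosida \<nu> x) = yosida \<nu> (yosida \<mu> x)"
  using J_commute[OF assms, of x]
  by (simp add: yosida_def linear_scale[OF bounded_linear.linear[OF bounded_linear_J]]
      linear_diff[OF bounded_linear.linear[OF bounded_linear_J]] assms algebra_simps)

text \<open>A single continuous resolvent suffices: each \<open>x n\<close> is
  \<open>R \<mu>\<close> of \<mu> \<open>x n\<close> - A(\<open>x n\<close>), hence the limit is
  \<open>R \<mu>\<close> of a known vector and lies in D.\<close>

lemma A_closed:
  assumes x: "x \<longlonglongrightarrow> l" and Ax: "(\<lambda>n. A (x n)) \<longlonglongrightarrow> y" and D: "\<And>n. x n \<in> D"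
  shows "l \<in> D" "A l = y"
proof -
  obtain \<mu> where \<mu>: "\<omega> < \<mu>" using gt_ex by blast
  have "(\<lambda>n. R \<mu> (\<mu> *\<^sub>R x n - A (x n))) \<longlonglongrightarrow> R \<mu> (\<mu> *\<^sub>R l - y)"
    by (intro bounded_linear.tendsto[OF bounded_linear_R[OF \<mu>]] tendsto_intros assms)
  hence "x \<longlonglongrightarrow> R \<mu> (\<mu> *\<^sub>R l - y)" using D by (simp add: R_left[OF \<mu>])
  hence l: "l = R \<mu> (\<mu> *\<^sub>R l - y)" using x LIMSEQ_unique by blast
  thus "l \<in> D" by (subst l) (rule R_in_D[OF \<mu>])
  have "\<mu> *\<^sub>R l - A l = \<mu> *\<^sub>R l - y" using R_right[OF \<mu>, of "\<mu> *\<^sub>R l - y"] l by simp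
  thus "A l = y" by simp
qed

text \<open>Again v is written as \<open>R \<mu>\<close> of \<mu> v - A v. The bounded resolvent
  passes through the integral, and the identity is then inverted.\<close>

lemma A_integral:
  fixes a t :: real
  assumes v: "continuous_on {a..t} v" "\<And>s. s \<in> {a..t} \<Longrightarrow> v s \<in> D"
    and Av: "continuous_on {a..t} (\<lambda>s. A (v s))"
  shows "integral {a..t} v \<in> D" "A (integral {a..t} v) = integral {a..t} (\<lambda>s. A (v s))"
proof -
  obtain \<mu> where \<mu>: "\<omega> < \<mu>" using gt_ex by blast
  have c: "continuous_on {a..t} (\<lambda>s. \<mu> *\<^sub>R v s - A (v s))" by (intro continuous_intros assms)
  have "integral {a..t} v = integral {a..t} (\<lambda>s. R \<mu> (\<mu> *\<^sub>R v s - A (v s)))"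
    using v(2) by (intro integral_cong) (simp add: R_left[OF \<mu>])
  also have "\<dots> = R \<mu> (integral {a..t} (\<lambda>s. \<mu> *\<^sub>R v s - A (v s)))"
    by (rule integral_bounded_linear_continuous[OF bounded_linear_R[OF \<mu>] c])
  also have "integral {a..t} (\<lambda>s. \<mu> *\<^sub>R v s - A (v s))
      = \<mu> *\<^sub>R integral {a..t} v - integral {a..t} (\<lambda>s. A (v s))"
    using assms by (subst Henstock_Kurzweil_Integration.integral_diff)
      (auto intro!: integrable_continuous_interval continuous_intros)
  finally have *: "integral {a..t} v = R \<mu> (\<mu> *\<^sub>R integral {a..t} v - integral {a..t} (\<lambda>s. A (v s)))" .
  show "integral {a..t} v \<in> D" by (subst *) (rule R_in_D[OF \<mu>])
  have "\<mu> *\<^sub>R integral {a..t} v - A (integral {a..t} v)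
      = \<mu> *\<^sub>R integral {a..t} v - integral {a..t} (\<lambda>s. A (v s))"
    using R_right[OF \<mu>, of "\<mu> *\<^sub>R integral {a..t} v - integral {a..t} (\<lambda>s. A (v s))"] *
    by simp
  thus "A (integral {a..t} v) = integral {a..t} (\<lambda>s. A (v s))" by simp
qed

text \<open>An equivalent norm in which \<open>(\<mu> - \<omega>) R \<mu>\<close> is a contraction.\<close>

definition resolvent_norm :: "real \<Rightarrow> 'a \<Rightarrow> real" where
  "resolvent_norm \<mu> x = (SUP n. norm ((\<mu> - \<omega>) ^ n *\<^sub>R (R \<mu> ^^ n) x))"

lemma resolvent_norm_term:
  assumes "\<omega> < \<mu>"
  shows "norm ((\<mu> - \<omega>) ^ n *\<^sub>R (R \<mu> ^^ n) x) \<le> M * norm x"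
proof -
  have "norm ((\<mu> - \<omega>) ^ n *\<^sub>R (R \<mu> ^^ n) x) \<le> (\<mu> - \<omega>) ^ n * (M / (\<mu> - \<omega>) ^ n * norm x)"
    using assms mult_left_mono[OF R_power_bound[OF assms, of n x], of "(\<mu> - \<omega>) ^ n"] by simp
  also have "\<dots> = M * norm x" using assms by simp
  finally show ?thesis .
qed

lemma resolvent_norm_upper:
  assumes "\<omega> < \<mu>"
  shows "norm ((\<mu> - \<omega>) ^ n *\<^sub>R (R \<mu> ^^ n) x) \<le> resolvent_norm \<mu> x"
  unfolding resolvent_norm_def
  using resolvent_norm_term[OF assms] by (intro cSUP_upper) (auto intro!: bdd_aboveI2)

lemma resolvent_norm_least:
  assumes "\<And>n. norm ((\<mu> - \<omega>) ^ n *\<^sub>R (R \<mu> ^^ n) x) \<le> c"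
  shows "resolvent_norm \<mu> x \<le> c"
  unfolding resolvent_norm_def using assms by (intro cSUP_least) auto

lemma norm_le_resolvent_norm: "\<omega> < \<mu> \<Longrightarrow> norm x \<le> resolvent_norm \<mu> x"
  using resolvent_norm_upper[of \<mu> 0 x] by simp

lemma resolvent_norm_le: "\<omega> < \<mu> \<Longrightarrow> resolvent_norm \<mu> x \<le> M * norm x"
  by (intro resolvent_norm_least resolvent_norm_term)

lemma resolvent_norm_add:
  assumes "\<omega> < \<mu>"
  shows "resolvent_norm \<mu> (x + y) \<le> resolvent_norm \<mu> x + resolvent_norm \<mu> y"
proof (rule resolvent_norm_least)
  fix n
  interpret bounded_linear "R \<mu> ^^ n"
    using assms by (intro bounded_linear_funpow bounded_linear_R)
  show "norm ((\<mu> - \<omega>) ^ n *\<^sub>R (R \<mu> ^^ n) (x + y)) \<le> resolvent_norm \<mu> x + resolvent_norm \<mu> y"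
    using resolvent_norm_upper[OF assms, of n x] resolvent_norm_upper[OF assms, of n y]
    unfolding add scaleR_add_right by (meson add_mono norm_triangle_le)
qed

lemma resolvent_norm_scale:
  assumes "\<omega> < \<mu>"
  shows "resolvent_norm \<mu> (c *\<^sub>R x) \<le> \<bar>c\<bar> * resolvent_norm \<mu> x"
proof (rule resolvent_norm_least)
  fix n
  interpret bounded_linear "R \<mu> ^^ n"
    using assms by (intro bounded_linear_funpow bounded_linear_R)
  have "norm ((\<mu> - \<omega>) ^ n *\<^sub>R (R \<mu> ^^ n) (c *\<^sub>R x))
      = \<bar>c\<bar> * norm ((\<mu> - \<omega>) ^ n *\<^sub>R (R \<mu> ^^ n) x)"
    by (simp add: scaleR abs_mult mult_ac)
  also have "\<dots> \<le> \<bar>c\<bar> * resolvent_norm \<mu> x"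
    by (intro mult_left_mono resolvent_norm_upper assms) auto
  finally show "norm ((\<mu> - \<omega>) ^ n *\<^sub>R (R \<mu> ^^ n) (c *\<^sub>R x)) \<le> \<bar>c\<bar> * resolvent_norm \<mu> x" .
qed

text \<open>Applying (\<mu> - \<omega>) \<open>R \<mu>\<close> shifts the index by one, so the
  supremum runs over fewer terms. This is the purpose of putting all powers into the norm.\<close>

lemma resolvent_norm_R:
  assumes "\<omega> < \<mu>"
  shows "resolvent_norm \<mu> ((\<mu> - \<omega>) *\<^sub>R R \<mu> x) \<le> resolvent_norm \<mu> x"
proof (rule resolvent_norm_least)
  fix n
  interpret bounded_linear "R \<mu> ^^ n"
    using assms by (intro bounded_linear_funpow bounded_linear_R)
  have "(\<mu> - \<omega>) ^ n *\<^sub>R (R \<mu> ^^ n) ((\<mu> - \<omega>) *\<^sub>R R \<mu> x)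
      = (\<mu> - \<omega>) ^ Suc n *\<^sub>R (R \<mu> ^^ Suc n) x"
    by (simp add: scaleR funpow_Suc_right del: funpow.simps)
  thus "norm ((\<mu> - \<omega>) ^ n *\<^sub>R (R \<mu> ^^ n) ((\<mu> - \<omega>) *\<^sub>R R \<mu> x)) \<le> resolvent_norm \<mu> x"
    using resolvent_norm_upper[OF assms, of "Suc n" x] by (simp only:)
qed

lemma resolvent_norm_Lipschitz:
  assumes "\<omega> < \<mu>"
  shows "\<bar>resolvent_norm \<mu> x - resolvent_norm \<mu> y\<bar> \<le> M * norm (x - y)"
proof -
  have "resolvent_norm \<mu> x \<le> resolvent_norm \<mu> y + M * norm (x - y)" for x y
    using resolvent_norm_add[OF assms, of y "x - y"] resolvent_norm_le[OF assms, of "x - y"] by simp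
  from this[of x y] this[of y x] show ?thesis by (simp add: norm_minus_commute abs_le_iff)
qed

lemma continuous_on_resolvent_norm:
  assumes "\<omega> < \<mu>" "continuous_on S f"
  shows "continuous_on S (\<lambda>s. resolvent_norm \<mu> (f s))"
proof -
  have "continuous_on UNIV (resolvent_norm \<mu>)"
  proof (rule continuous_on_iff[THEN iffD2], intro ballI allI impI)
    fix x and e :: real assume "0 < e"
    have M: "0 < M" using M_ge_1 by simp
    show "\<exists>d>0. \<forall>y\<in>UNIV. dist y x < d \<longrightarrow> dist (resolvent_norm \<mu> y) (resolvent_norm \<mu> x) < e"
    proof (intro exI conjI ballI impI)
      show "0 < e / M" using \<open>0 < e\<close> M by simp
      fix y assume "dist y x < e / M"
      hence "M * norm (y - x) < e" using M by (simp add: dist_norm field_simps)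
      thus "dist (resolvent_norm \<mu> y) (resolvent_norm \<mu> x) < e"
        using resolvent_norm_Lipschitz[OF assms(1), of y x] by (simp add: dist_real_def)
    qed
  qed
  from continuous_on_compose2[OF this assms(2)] show ?thesis by simp
qed

lemma resolvent_norm_integral:
  fixes a t :: real
  assumes \<mu>: "\<omega> < \<mu>" and f: "continuous_on {a..t} f"
  shows "resolvent_norm \<mu> (integral {a..t} f) \<le> integral {a..t} (\<lambda>s. resolvent_norm \<mu> (f s))"
proof (rule resolvent_norm_least)
  fix n
  have bl: "bounded_linear (\<lambda>x. (\<mu> - \<omega>) ^ n *\<^sub>R (R \<mu> ^^ n) x)"
    using \<mu> by (intro bounded_linear_const_scaleR bounded_linear_funpow bounded_linear_R)
  have "(\<mu> - \<omega>) ^ n *\<^sub>R (R \<mu> ^^ n) (integral {a..t} f)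
      = integral {a..t} (\<lambda>s. (\<mu> - \<omega>) ^ n *\<^sub>R (R \<mu> ^^ n) (f s))"
    by (rule integral_bounded_linear_continuous[OF bl f, symmetric])
  also have "norm \<dots> \<le> integral {a..t} (\<lambda>s. resolvent_norm \<mu> (f s))"
    by (intro integral_norm_bound_integral integrable_continuous_interval
        bounded_linear.continuous_on[OF bl] continuous_on_resolvent_norm resolvent_norm_upper \<mu> f)
  finally show "norm ((\<mu> - \<omega>) ^ n *\<^sub>R (R \<mu> ^^ n) (integral {a..t} f))
      \<le> integral {a..t} (\<lambda>s. resolvent_norm \<mu> (f s))" .
qed

text \<open>The constants do not involve \<mu>. The equation reads u' = -\<mu> u + \<mu>^2
  \<open>R \<mu>\<close> u + f, and the factor exp(\<mu> (s - a)) removes the term -\<mu> u. In the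
  equivalent norm the remaining operator has norm at most \<mu> + 2 \<omega>. Gronwall produces this
  exponent, and undoing the factor leaves only 2 \<omega>.\<close>

lemma yosida_estimate:
  assumes \<mu>: "\<omega> < \<mu>" "2 * \<omega> \<le> \<mu>" and f: "continuous_on {a..b} f"
    and u: "\<And>s. s \<in> {a..b} \<Longrightarrow> (u has_vector_derivative (yosida \<mu> (u s) + f s)) (at s within {a..b})"
    and t: "t \<in> {a..b}"
  shows "exp (- 2 * \<omega> * (t - a)) * norm (u t)
    \<le> M * norm (u a) + M * integral {a..t} (\<lambda>s. exp (- 2 * \<omega> * (s - a)) * norm (f s))"
proof -
  define N where "N = resolvent_norm \<mu>"
  define c where "c = \<mu> + 2 * \<omega>"
  have c0: "0 \<le> c" using \<mu> \<omega>_nonneg by (simp add: c_def)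
  define w where "w s = exp (\<mu> * (s - a)) *\<^sub>R u s" for s
  define g where "g s = exp (\<mu> * (s - a)) *\<^sub>R f s" for s
  have "continuous (at s within {a..b}) u" if "s \<in> {a..b}" for s
    by (rule has_vector_derivative_continuous[OF u[OF that]])
  hence cu: "continuous_on {a..b} u" by (simp add: continuous_on_eq_continuous_within)
  have cw: "continuous_on {a..b} w" and cg: "continuous_on {a..b} g"
    unfolding w_def g_def by (intro continuous_intros cu f)+
  have Rs: "R \<mu> (k *\<^sub>R x) = k *\<^sub>R R \<mu> x" for k x
    by (rule linear_scale[OF bounded_linear.linear[OF bounded_linear_R[OF \<mu>(1)]]])
  have cR: "continuous_on {a..b} (\<lambda>s. R \<mu> (w s))"
    by (intro bounded_linear.continuous_on[OF bounded_linear_R] \<mu> cw)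
  have dw: "(w has_vector_derivative (\<mu>^2 *\<^sub>R R \<mu> (w s) + g s)) (at s within {a..b})"
    if "s \<in> {a..b}" for s
  proof -
    have "((\<lambda>s. exp (\<mu> * (s - a))) has_vector_derivative \<mu> * exp (\<mu> * (s - a))) (at s within {a..b})"
      by (auto simp: has_real_derivative_iff_has_vector_derivative[symmetric] intro!: derivative_eq_intros)
    from bounded_bilinear.has_vector_derivative[OF bounded_bilinear_scaleR this u[OF that]]
    show ?thesis
      by (simp add: w_def[abs_def] g_def yosida_def J_def algebra_simps Rs power2_eq_square)
  qed
  have wint: "w s = u a + integral {a..s} (\<lambda>r. \<mu>^2 *\<^sub>R R \<mu> (w r) + g r)" if s: "s \<in> {a..b}" for s
  proof -
    have sub: "{a..s} \<subseteq> {a..b}" using s by auto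
    have "((\<lambda>r. \<mu>^2 *\<^sub>R R \<mu> (w r) + g r) has_integral (w s - w a)) {a..s}"
      by (rule fundamental_theorem_of_calculus)
        (use s in \<open>auto intro!: has_vector_derivative_within_subset[OF dw sub]\<close>)
    thus ?thesis by (simp add: integral_unique w_def)
  qed
  \<comment> \<open>The difference of the two sides is \<omega> (\<mu> - 2 \<omega>). This is the
    origin of 2 \<omega> in all later exponents.\<close>
  have mu2: "\<mu>^2 \<le> c * (\<mu> - \<omega>)"
  proof -
    have "0 \<le> \<omega> * (\<mu> - 2 * \<omega>)" using \<mu> \<omega>_nonneg by simp
    thus ?thesis by (simp add: c_def algebra_simps power2_eq_square)
  qed
  have N0: "0 \<le> N x" for x
    using norm_le_resolvent_norm[OF \<mu>(1), of x] norm_ge_zero[of x] unfolding N_def by linarith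
  have Nstep: "N (\<mu>^2 *\<^sub>R R \<mu> x + y) \<le> c * N x + M * norm y" for x y
  proof -
    have "\<mu>^2 *\<^sub>R R \<mu> x = (\<mu>^2 / (\<mu> - \<omega>)) *\<^sub>R ((\<mu> - \<omega>) *\<^sub>R R \<mu> x)" using \<mu> by simp
    hence "N (\<mu>^2 *\<^sub>R R \<mu> x) \<le> \<bar>\<mu>^2 / (\<mu> - \<omega>)\<bar> * N ((\<mu> - \<omega>) *\<^sub>R R \<mu> x)"
      unfolding N_def by (metis resolvent_norm_scale \<mu>(1))
    also have "\<dots> \<le> c * N x"
      unfolding N_def using mu2 \<mu> c0 N0[unfolded N_def]
      by (intro mult_mono resolvent_norm_R) (auto simp: divide_le_eq)
    finally have "N (\<mu>^2 *\<^sub>R R \<mu> x) \<le> c * N x" .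
    moreover have "N y \<le> M * norm y" unfolding N_def by (rule resolvent_norm_le[OF \<mu>(1)])
    ultimately show ?thesis
      using resolvent_norm_add[OF \<mu>(1), of "\<mu>^2 *\<^sub>R R \<mu> x" y] unfolding N_def by linarith
  qed
  have cN: "continuous_on {a..b} (\<lambda>s. N (w s))"
    unfolding N_def by (intro continuous_on_resolvent_norm \<mu> cw)
  have "N (w s) \<le> M * norm (u a) + integral {a..s} (\<lambda>r. c * N (w r) + M * norm (g r))"
    if s: "s \<in> {a..b}" for s
  proof -
    have sub: "{a..s} \<subseteq> {a..b}" using s by auto
    have ci: "continuous_on {a..s} (\<lambda>r. \<mu>^2 *\<^sub>R R \<mu> (w r) + g r)"
      by (rule continuous_on_subset[OF _ sub]) (intro continuous_intros cR cg)
    have "N (w s) \<le> N (u a) + N (integral {a..s} (\<lambda>r. \<mu>^2 *\<^sub>R R \<mu> (w r) + g r))"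
      unfolding wint[OF s] N_def by (rule resolvent_norm_add[OF \<mu>(1)])
    also have "N (integral {a..s} (\<lambda>r. \<mu>^2 *\<^sub>R R \<mu> (w r) + g r))
        \<le> integral {a..s} (\<lambda>r. N (\<mu>^2 *\<^sub>R R \<mu> (w r) + g r))"
      unfolding N_def by (rule resolvent_norm_integral[OF \<mu>(1) ci])
    also have "\<dots> \<le> integral {a..s} (\<lambda>r. c * N (w r) + M * norm (g r))"
    proof (rule integral_le)
      show "(\<lambda>r. N (\<mu>^2 *\<^sub>R R \<mu> (w r) + g r)) integrable_on {a..s}"
        unfolding N_def
        by (intro integrable_continuous_interval continuous_on_resolvent_norm \<mu>(1) ci)
      show "(\<lambda>r. c * N (w r) + M * norm (g r)) integrable_on {a..s}"
        by (intro integrable_continuous_interval continuous_on_subset[OF _ sub] continuous_intros cN cg)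
    qed (rule Nstep)
    also have "N (u a) \<le> M * norm (u a)" unfolding N_def by (rule resolvent_norm_le[OF \<mu>(1)])
    finally show ?thesis by simp
  qed
  hence "N (w t) \<le> exp (c * (t - a)) *
      (M * norm (u a) + integral {a..t} (\<lambda>s. exp (- c * (s - a)) * (M * norm (g s))))"
    by (intro gronwall_forcing[OF cN _ c0 _ t] continuous_intros cg)
  moreover have "norm (w t) \<le> N (w t)" unfolding N_def by (rule norm_le_resolvent_norm[OF \<mu>(1)])
  moreover have "norm (w t) = exp (c * (t - a)) * (exp (- 2 * \<omega> * (t - a)) * norm (u t))"
  proof -
    have "exp (c * (t - a)) * exp (- 2 * \<omega> * (t - a)) = exp (\<mu> * (t - a))"
      by (simp add: c_def exp_add[symmetric] algebra_simps)
    thus ?thesis unfolding w_def mult.assoc[symmetric] by simp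
  qed
  moreover have "integral {a..t} (\<lambda>s. exp (- c * (s - a)) * (M * norm (g s)))
      = M * integral {a..t} (\<lambda>s. exp (- 2 * \<omega> * (s - a)) * norm (f s))"
  proof (subst integral_mult_right[symmetric], rule integral_cong)
    fix s
    have "exp (- c * (s - a)) * exp (\<mu> * (s - a)) = exp (- 2 * \<omega> * (s - a))"
      by (simp add: c_def exp_add[symmetric] algebra_simps)
    hence "exp (- c * (s - a)) * norm (g s) = exp (- 2 * \<omega> * (s - a)) * norm (f s)"
      by (simp only: g_def norm_scaleR abs_exp_cancel mult.assoc[symmetric])
    thus "exp (- c * (s - a)) * (M * norm (g s)) = M * (exp (- 2 * \<omega> * (s - a)) * norm (f s))"
      by (simp only: mult.left_commute[of _ M])
  qed
  ultimately have "exp (c * (t - a)) * (exp (- 2 * \<omega> * (t - a)) * norm (u t)) \<le> exp (c * (t - a)) *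
     (M * norm (u a) + M * integral {a..t} (\<lambda>s. exp (- 2 * \<omega> * (s - a)) * norm (f s)))"
    by (metis order_trans)
  thus ?thesis by (rule mult_left_le_imp_le) simp
qed

section \<open>Mild solutions of the inhomogeneous problem\<close>

text \<open>For y in D the difference \<open>J \<mu>\<close> y - y equals \<open>R \<mu>\<close> (A
  y) and decays like 1 / (\<mu> - \<omega>). A compact set in the closure is covered by finitely
  many balls centred in D, and the uniform bound 2 M on \<open>J \<mu>\<close> transfers the decay
  to it at the cost of the factor 2 M + 1.\<close>

lemma uniform_limit_J:
  assumes C: "compact C" "C \<subseteq> closure D"
  shows "uniform_limit C J (\<lambda>x. x) at_top"
proof (rule uniform_limitI)
  fix e :: real assume e: "0 < e"
  define d where "d = e / (2 * (2 * M + 1))"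
  have M: "0 < M" using M_ge_1 by simp
  have d: "0 < d" using e M by (simp add: d_def)
  have "C \<subseteq> (\<Union>y\<in>D. ball y d)"
  proof
    fix x assume "x \<in> C"
    hence "x \<in> closure D" using C by auto
    then obtain y where "y \<in> D" "dist y x < d" using d unfolding closure_approachable by blast
    thus "x \<in> (\<Union>y\<in>D. ball y d)" by auto
  qed
  then obtain T where T: "T \<subseteq> D" "finite T" "C \<subseteq> (\<Union>y\<in>T. ball y d)"
    using compactE_image[OF C(1), of D "\<lambda>y. ball y d"] by auto
  have "\<forall>\<^sub>F \<mu> in at_top. norm (J \<mu> y - y) < e / 2" if "y \<in> T" for y
    using eventually_gt_at_top[of "\<omega> + (M * norm (A y) + 1) / (e / 2)"]
  proof eventually_elim
    case (elim \<mu>)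
    have "0 < (M * norm (A y) + 1) / (e / 2)"
      using M e by (intro divide_pos_pos add_nonneg_pos) auto
    with elim have \<mu>: "\<omega> < \<mu>" by linarith
    have "J \<mu> y - y = R \<mu> (A y)" using \<mu> that T by (subst R_A) (auto simp: J_def)
    hence "norm (J \<mu> y - y) \<le> M / (\<mu> - \<omega>) * norm (A y)" using R_bound[OF \<mu>] by simp
    also have "\<dots> < e / 2"
    proof -
      have "M * norm (A y) + 1 < (e / 2) * (\<mu> - \<omega>)"
        using elim e by (simp add: less_diff_eq[symmetric] pos_divide_less_eq[symmetric] add.commute[of \<omega>])
          (simp add: field_simps)
      thus ?thesis using \<mu> by (simp add: divide_less_eq)
    qed
    finally show ?case .
  qed
  hence "\<forall>\<^sub>F \<mu> in at_top. \<forall>y\<in>T. norm (J \<mu> y - y) < e / 2"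
    using T by (intro eventually_ball_finite) auto
  thus "\<forall>\<^sub>F \<mu> in at_top. \<forall>x\<in>C. dist (J \<mu> x) x < e"
    using eventually_gt_at_top[of \<omega>] eventually_ge_at_top[of "2 * \<omega>"]
  proof eventually_elim
    case (elim \<mu>)
    show ?case
    proof
      fix x assume "x \<in> C"
      then obtain y where y: "y \<in> T" "norm (x - y) < d"
        using T by (auto simp: dist_norm norm_minus_commute)
      have "J \<mu> x - x = J \<mu> (x - y) + (J \<mu> y - y) - (x - y)"
        using linear_diff[OF bounded_linear.linear[OF bounded_linear_J[OF elim(2)]], of x y]
        by simp
      hence "norm (J \<mu> x - x) \<le> norm (J \<mu> (x - y)) + norm (J \<mu> y - y) + norm (x - y)"
        by (metis norm_triangle_ineq norm_triangle_ineq4 order_trans add_right_mono)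
      also have "norm (J \<mu> (x - y)) \<le> 2 * M * norm (x - y)" using elim by (intro J_bound)
      finally have "norm (J \<mu> x - x) \<le> (2 * M + 1) * norm (x - y) + norm (J \<mu> y - y)"
        by (simp add: algebra_simps)
      also have "\<dots> < (2 * M + 1) * d + e / 2"
        using y elim M by (intro add_strict_mono mult_strict_left_mono) auto
      also have "(2 * M + 1) * d = e / 2" using M by (simp add: d_def field_simps)
      finally show "dist (J \<mu> x) x < e" by (simp add: dist_norm)
    qed
  qed
qed

lemma J_tendsto: "x \<in> closure D \<Longrightarrow> ((\<lambda>\<mu>. J \<mu> x) \<longlongrightarrow> x) at_top"
  using tendsto_uniform_limitI[OF uniform_limit_J[of "{x}"]] by auto

section \<open>Mild solutions with a given forcing on a compact interval\<close>

text \<open>The forcing is a function of time alone. The perturbed equation is the instance in which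
  the forcing is B s (v s), so estimates and limits for fixed forcing apply to it. For b < a the
  predicate holds trivially; this lets solutions on a half-line be described by all b at
  once.\<close>

definition mild :: "real \<Rightarrow> real \<Rightarrow> 'a \<Rightarrow> (real \<Rightarrow> 'a) \<Rightarrow> (real \<Rightarrow> 'a) \<Rightarrow> bool" where
  "mild a b x f v \<longleftrightarrow> continuous_on {a..b} v \<and>
     (\<forall>t\<in>{a..b}. v t \<in> closure D \<and> integral {a..t} v \<in> D \<and>
        v t = x + A (integral {a..t} v) + integral {a..t} f)"

lemma mildD:
  assumes "mild a b x f v"
  shows "continuous_on {a..b} v"
    and "t \<in> {a..b} \<Longrightarrow> v t \<in> closure D"
    and "t \<in> {a..b} \<Longrightarrow> integral {a..t} v \<in> D"
    and "t \<in> {a..b} \<Longrightarrow> v t = x + A (integral {a..t} v) + integral {a..t} f"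
  using assms unfolding mild_def by blast+

lemma mild_start: "mild a b x f v \<Longrightarrow> a \<le> b \<Longrightarrow> v a = x"
  using mildD(4)[of a b x f v a] by (simp add: A_zero)

lemma mild_cong:
  assumes "mild a b x f v" and f: "\<And>t. t \<in> {a..b} \<Longrightarrow> f t = g t"
    and v: "\<And>t. t \<in> {a..b} \<Longrightarrow> v t = w t"
  shows "mild a b x g w"
proof -
  have "integral {a..t} v = integral {a..t} w" "integral {a..t} f = integral {a..t} g"
    if "t \<in> {a..b}" for t
    using that by (auto intro!: integral_cong f v)
  moreover have "continuous_on {a..b} w"
    using mildD(1)[OF assms(1)] v by (simp cong: continuous_on_cong_simp)
  ultimately show ?thesis using assms(1) v unfolding mild_def by auto
qed

lemma mild_add:
  assumes v: "mild a b x f v" and w: "mild a b y g w"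
    and f: "continuous_on {a..b} f" and g: "continuous_on {a..b} g"
  shows "mild a b (x + y) (\<lambda>t. f t + g t) (\<lambda>t. v t + w t)"
  unfolding mild_def
proof (intro conjI ballI)
  show "continuous_on {a..b} (\<lambda>t. v t + w t)"
    by (intro continuous_intros mildD(1)[OF v] mildD(1)[OF w])
  fix t assume t: "t \<in> {a..b}"
  show "v t + w t \<in> closure D"
    by (intro closure_D_add mildD(2)[OF v t] mildD(2)[OF w t])
  have sub: "{a..t} \<subseteq> {a..b}" using t by auto
  have i: "h integrable_on {a..t}" if "continuous_on {a..b} h" for h :: "real \<Rightarrow> 'a"
    by (rule integrable_continuous_interval[OF continuous_on_subset[OF that sub]])
  have vw: "integral {a..t} (\<lambda>t. v t + w t) = integral {a..t} v + integral {a..t} w"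
    by (intro Henstock_Kurzweil_Integration.integral_add i mildD(1)[OF v] mildD(1)[OF w])
  have fg: "integral {a..t} (\<lambda>t. f t + g t) = integral {a..t} f + integral {a..t} g"
    by (intro Henstock_Kurzweil_Integration.integral_add i f g)
  show "integral {a..t} (\<lambda>t. v t + w t) \<in> D"
    unfolding vw by (intro D_add mildD(3)[OF v t] mildD(3)[OF w t])
  show "v t + w t = x + y + A (integral {a..t} (\<lambda>t. v t + w t)) + integral {a..t} (\<lambda>t. f t + g t)"
    unfolding vw fg A_add[OF mildD(3)[OF v t] mildD(3)[OF w t]]
    by (subst mildD(4)[OF v t], subst mildD(4)[OF w t]) simp
qed

lemma mild_scale:
  assumes v: "mild a b x f v"
  shows "mild a b (c *\<^sub>R x) (\<lambda>t. c *\<^sub>R f t) (\<lambda>t. c *\<^sub>R v t)"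
  unfolding mild_def
proof (intro conjI ballI)
  show "continuous_on {a..b} (\<lambda>t. c *\<^sub>R v t)"
    by (intro continuous_intros mildD(1)[OF v])
  fix t assume t: "t \<in> {a..b}"
  show "c *\<^sub>R v t \<in> closure D"
    by (intro closure_D_scale mildD(2)[OF v t])
  show "integral {a..t} (\<lambda>t. c *\<^sub>R v t) \<in> D"
    by (simp add: D_scale mildD(3)[OF v t])
  show "c *\<^sub>R v t = c *\<^sub>R x + A (integral {a..t} (\<lambda>t. c *\<^sub>R v t)) + integral {a..t} (\<lambda>t. c *\<^sub>R f t)"
    by (subst mildD(4)[OF v t]) (simp add: A_scale mildD(3)[OF v t] algebra_simps)
qed

lemma mild_diff:
  assumes v: "mild a b x f v" and w: "mild a b y g w"
    and f: "continuous_on {a..b} f" and g: "continuous_on {a..b} g"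
  shows "mild a b (x - y) (\<lambda>t. f t - g t) (\<lambda>t. v t - w t)"
  using mild_add[OF v mild_scale[OF w, of "-1"] f] g
  by (auto intro!: continuous_intros)

lemma mild_restrict:
  assumes v: "mild a b x f v" and f: "continuous_on {a..b} f" and c: "a \<le> c" "d \<le> b"
  shows "mild c d (v c) f v"
  unfolding mild_def
proof (intro conjI ballI)
  show "continuous_on {c..d} v"
    by (rule continuous_on_subset[OF mildD(1)[OF v]]) (use c in auto)
  fix t assume t: "t \<in> {c..d}"
  hence t': "t \<in> {a..b}" "c \<in> {a..b}" using c by auto
  show "v t \<in> closure D" by (rule mildD(2)[OF v t'(1)])
  have *: "integral {c..t} h = integral {a..t} h - integral {a..c} h"
    if "continuous_on {a..b} h" for h :: "real \<Rightarrow> 'a"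
    using integral_combine_continuous[OF that, of c t] t c by simp
  note ** = *[OF mildD(1)[OF v]] *[OF f]
  show "integral {c..t} v \<in> D"
    unfolding ** by (intro D_diff mildD(3)[OF v] t')
  show "v t = v c + A (integral {c..t} v) + integral {c..t} f"
    unfolding ** A_diff[OF mildD(3)[OF v t'(1)] mildD(3)[OF v t'(2)]]
    by (subst mildD(4)[OF v t'(1)], subst mildD(4)[OF v t'(2)]) simp
qed

lemma mild_concat:
  assumes v: "mild a c x f v" and w: "mild c b (v c) f w" and f: "continuous_on {a..b} f"
    and c: "a \<le> c" "c \<le> b"
  shows "mild a b x f (\<lambda>t. if t \<le> c then v t else w t)"
proof -
  define u where "u t = (if t \<le> c then v t else w t)" for t
  have wc: "w c = v c" by (rule mild_start[OF w c(2)])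
  have cu: "continuous_on ({a..c} \<union> {c..b}) u"
    unfolding u_def using wc mildD(1)[OF v] mildD(1)[OF w]
    by (intro continuous_on_If) auto
  have ab: "{a..b} = {a..c} \<union> {c..b}" using c by auto
  have uv: "integral {a..t} u = integral {a..t} v" if "t \<le> c" for t
    using that by (intro integral_cong) (auto simp: u_def)
  have uw: "integral {c..t} u = integral {c..t} w" if "c \<le> t" for t
    using wc by (intro integral_cong) (auto simp: u_def)
  have "mild a b x f u" unfolding mild_def
  proof (intro conjI ballI)
    show "continuous_on {a..b} u" using cu ab by simp
    fix t assume t: "t \<in> {a..b}"
    have "u t \<in> closure D \<and> integral {a..t} u \<in> D \<and>
       u t = x + A (integral {a..t} u) + integral {a..t} f"
    proof (cases "t \<le> c")
      case True
      thus ?thesis using mildD(2-4)[OF v, of t] t uv by (auto simp: u_def)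
    next
      case False
      have tc: "t \<in> {c..b}" and cc: "c \<in> {a..c}" using False t c by auto
      have i: "integral {a..t} u = integral {a..c} v + integral {c..t} w"
        using integral_combine_continuous[of a b u c t] cu ab False t c uv uw by simp
      have if': "integral {a..t} f = integral {a..c} f + integral {c..t} f"
        using False t c by (intro integral_combine_continuous[OF f]) auto
      have "w t = x + A (integral {a..c} v + integral {c..t} w) + integral {a..t} f"
        unfolding if' A_add[OF mildD(3)[OF v cc] mildD(3)[OF w tc]]
        by (subst mildD(4)[OF w tc], subst mildD(4)[OF v cc]) simp
      thus ?thesis
        using mildD(2)[OF w tc] D_add[OF mildD(3)[OF v cc] mildD(3)[OF w tc]]
          False i by (simp add: u_def)
    qed
    thus "u t \<in> closure D" "integral {a..t} u \<in> D"
      "u t = x + A (integral {a..t} u) + integral {a..t} f" by auto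
  qed
  thus ?thesis unfolding u_def .
qed

text \<open>Elements of D are stationary under the forcing -A z. The explicit comparison functions
  used below are built from these.\<close>

lemma mild_const: "z \<in> D \<Longrightarrow> mild a b z (\<lambda>_. - A z) (\<lambda>_. z)"
  using closure_subset[of D]
  by (auto simp: mild_def A_scale D_scale)

text \<open>Integration in time turns the initial value into forcing. It thereby converts
  solvability for some initial values into solvability for some inhomogeneous terms.\<close>

lemma mild_integral:
  assumes v: "mild a b x f v" and f: "continuous_on {a..b} f"
  shows "mild a b 0 (\<lambda>t. x + integral {a..t} f) (\<lambda>t. integral {a..t} v)"
  unfolding mild_def
proof (intro conjI ballI)
  note cv = mildD(1)[OF v]
  have cI: "continuous_on {a..b} (\<lambda>t. integral {a..t} h)" if "continuous_on {a..b} h" for h :: "real \<Rightarrow> 'a"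
    by (rule indefinite_integral_continuous_1[OF integrable_continuous_interval[OF that]])
  show "continuous_on {a..b} (\<lambda>t. integral {a..t} v)" by (rule cI[OF cv])
  fix t assume t: "t \<in> {a..b}"
  have sub: "{a..t} \<subseteq> {a..b}" using t by auto
  have AI: "A (integral {a..s} v) = v s - x - integral {a..s} f" if "s \<in> {a..b}" for s
    using mildD(4)[OF v that] by simp
  show "integral {a..t} v \<in> closure D" using mildD(3)[OF v t] closure_subset by blast
  have c1: "continuous_on {a..t} (\<lambda>s. v s - (x + integral {a..s} f))"
    by (rule continuous_on_subset[OF _ sub]) (intro continuous_intros cv cI f)
  have c2: "continuous_on {a..t} (\<lambda>s. A (integral {a..s} v))"
    using c1 sub by (subst continuous_on_cong[OF refl AI]) (auto simp: diff_diff_eq)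
  have c3: "continuous_on {a..t} (\<lambda>s. integral {a..s} v)"
    by (rule continuous_on_subset[OF cI[OF cv] sub])
  have m: "integral {a..s} v \<in> D" if "s \<in> {a..t}" for s using mildD(3)[OF v] that sub by auto
  show "integral {a..t} (\<lambda>t. integral {a..t} v) \<in> D" by (rule A_integral(1)[OF c3 m c2])
  have "A (integral {a..t} (\<lambda>t. integral {a..t} v)) = integral {a..t} (\<lambda>s. A (integral {a..s} v))"
    by (rule A_integral(2)[OF c3 m c2])
  also have "\<dots> = integral {a..t} (\<lambda>s. v s - (x + integral {a..s} f))"
    using sub AI by (intro integral_cong) (auto simp: diff_diff_eq)
  also have "\<dots> = integral {a..t} v - integral {a..t} (\<lambda>s. x + integral {a..s} f)"
    by (intro Henstock_Kurzweil_Integration.integral_diff integrable_continuous_interval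
        continuous_on_subset[OF _ sub] continuous_intros cv cI f)
  finally show "integral {a..t} v = 0 + A (integral {a..t} (\<lambda>t. integral {a..t} v))
      + integral {a..t} (\<lambda>t. x + integral {a..t} f)"
    by simp
qed

section \<open>A priori estimates\<close>

text \<open>With \<mu> fixed, \<open>J \<mu>\<close> v is differentiable with derivative q +
  \<open>J \<mu>\<close> f, where q = A \<open>J \<mu>\<close> v. Replacing A by
  \<open>yosida \<nu>\<close> changes this by q - \<open>J \<nu>\<close> q. That error tends to 0
  uniformly as \<nu> grows, because q runs through a compact subset of the closure of D. Then
  \<open>yosida_estimate\<close> applies with \<nu>.\<close>

lemma mild_estimate_J:
  assumes v: "mild a b x f v" and f: "continuous_on {a..b} f" and t: "t \<in> {a..b}"
    and \<mu>: "\<omega> < \<mu>" "2 * \<omega> \<le> \<mu>"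
  shows "exp (- 2 * \<omega> * (t - a)) * norm (J \<mu> (v t))
    \<le> 2 * M\<^sup>2 * norm x + 2 * M\<^sup>2 * integral {a..t} (\<lambda>s. exp (- 2 * \<omega> * (s - a)) * norm (f s))"
proof -
  note cv = mildD(1)[OF v]
  have M: "0 < M" using M_ge_1 by simp
  define q where "q s = yosida \<mu> (v s)" for s
  have cq: "continuous_on {a..b} q"
    unfolding q_def by (intro bounded_linear.continuous_on[OF bounded_linear_yosida] \<mu> cv)
  have cJf: "continuous_on {a..b} (\<lambda>s. J \<mu> (f s))"
    by (intro bounded_linear.continuous_on[OF bounded_linear_J] \<mu> f)
  have cg: "continuous_on {a..b} (\<lambda>s. q s + J \<mu> (f s))"
    by (intro continuous_intros cq cJf)
  interpret J: bounded_linear "J \<mu>" by (rule bounded_linear_J[OF \<mu>(1)])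
  have qD: "q s \<in> closure D" if "s \<in> {a..b}" for s
    unfolding q_def yosida_def using J_in_D[OF \<mu>(1)] closure_subset mildD(2)[OF v that]
    by (intro closure_D_scale closure_D_diff) auto
  have Jv: "J \<mu> (v s) = J \<mu> x + integral {a..s} (\<lambda>s. q s + J \<mu> (f s))" if s: "s \<in> {a..b}" for s
  proof -
    have sub: "{a..s} \<subseteq> {a..b}" using s by auto
    have "J \<mu> (v s) = J \<mu> x + yosida \<mu> (integral {a..s} v) + J \<mu> (integral {a..s} f)"
      by (subst mildD(4)[OF v s]) (simp add: J.add J_A[OF \<mu>(1) mildD(3)[OF v s]])
    also have "yosida \<mu> (integral {a..s} v) = integral {a..s} q"
      unfolding q_def
      by (rule integral_bounded_linear_continuous[OF bounded_linear_yosida[OF \<mu>(1)]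
          continuous_on_subset[OF cv sub], symmetric])
    also have "J \<mu> (integral {a..s} f) = integral {a..s} (\<lambda>s. J \<mu> (f s))"
      by (rule integral_bounded_linear_continuous[OF J.bounded_linear_axioms
          continuous_on_subset[OF f sub], symmetric])
    also have "J \<mu> x + integral {a..s} q + integral {a..s} (\<lambda>s. J \<mu> (f s))
        = J \<mu> x + integral {a..s} (\<lambda>s. q s + J \<mu> (f s))"
      by (subst Henstock_Kurzweil_Integration.integral_add)
        (auto intro!: integrable_continuous_interval continuous_on_subset[OF _ sub] cq cJf)
    finally show ?thesis .
  qed
  have dJ: "((\<lambda>s. J \<mu> (v s)) has_vector_derivative (q s + J \<mu> (f s))) (at s within {a..b})"
    if s: "s \<in> {a..b}" for s
  proof (rule has_vector_derivative_transform[OF s])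
    show "((\<lambda>s. J \<mu> x + integral {a..s} (\<lambda>s. q s + J \<mu> (f s))) has_vector_derivative
        (q s + J \<mu> (f s))) (at s within {a..b})"
      using integral_has_vector_derivative[OF cg s] by (auto intro!: derivative_eq_intros)
  qed (rule Jv)
  define e where "e s = exp (- 2 * \<omega> * (s - a))" for s
  have ce: "continuous_on S e" for S unfolding e_def by (intro continuous_intros)
  have e1: "e s \<le> 1" "0 \<le> e s" if "s \<in> {a..b}" for s
    using that \<omega>_nonneg by (auto simp: e_def)
  have sub: "{a..t} \<subseteq> {a..b}" using t by auto
  define I where "I = integral {a..t} (\<lambda>s. e s * norm (f s))"
  \<comment> \<open>\<eta> bounds the error of replacing A by \<open>yosida \<nu>\<close>. The
    remaining constants do not depend on \<nu>, so \<eta> may tend to 0.\<close>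
  have main: "e t * norm (J \<mu> (v t)) \<le> 2 * M\<^sup>2 * norm x + 2 * M\<^sup>2 * I + M * (t - a) * \<eta>" if \<eta>: "0 < \<eta>" for \<eta>
  proof -
    have "compact (q ` {a..b})" by (intro compact_continuous_image cq) auto
    hence "\<forall>\<^sub>F \<nu> in at_top. \<forall>y\<in>q ` {a..b}. dist (J \<nu> y) y < \<eta>"
      using qD by (intro uniform_limitD[OF uniform_limit_J] \<eta>) auto
    hence "\<forall>\<^sub>F \<nu> in at_top. (\<forall>y\<in>q ` {a..b}. dist (J \<nu> y) y < \<eta>) \<and> \<omega> < \<nu> \<and> 2 * \<omega> \<le> \<nu>"
      using eventually_gt_at_top[of \<omega>] eventually_ge_at_top[of "2 * \<omega>"]
      by eventually_elim auto
    then obtain \<nu> where \<nu>: "\<And>s. s \<in> {a..b} \<Longrightarrow> norm (q s - J \<nu> (q s)) < \<eta>" "\<omega> < \<nu>" "2 * \<omega> \<le> \<nu>"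
      unfolding dist_norm norm_minus_commute[of "J _ _"] by (fastforce dest!: eventually_happens)
    define g where "g s = q s - J \<nu> (q s) + J \<mu> (f s)" for s
    have cg': "continuous_on {a..b} g"
      unfolding g_def by (intro continuous_intros cq cJf bounded_linear.continuous_on[OF bounded_linear_J] \<nu>)
    have "exp (- 2 * \<omega> * (t - a)) * norm (J \<mu> (v t))
      \<le> M * norm (J \<mu> (v a)) + M * integral {a..t} (\<lambda>s. exp (- 2 * \<omega> * (s - a)) * norm (g s))"
    proof (rule yosida_estimate[OF \<nu>(2,3) cg' _ t])
      fix s assume s: "s \<in> {a..b}"
      have "yosida \<nu> (J \<mu> (v s)) = J \<nu> (q s)"
        unfolding q_def using A_J[OF \<mu>(1)] J_A[OF \<nu>(2) J_in_D[OF \<mu>(1)]] by metis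
      hence "yosida \<nu> (J \<mu> (v s)) + g s = q s + J \<mu> (f s)" by (simp add: g_def)
      thus "((\<lambda>s. J \<mu> (v s)) has_vector_derivative (yosida \<nu> (J \<mu> (v s)) + g s)) (at s within {a..b})"
        using dJ[OF s] by simp
    qed
    hence "e t * norm (J \<mu> (v t)) \<le> M * norm (J \<mu> (v a)) + M * integral {a..t} (\<lambda>s. e s * norm (g s))"
      unfolding e_def .
    also have "norm (J \<mu> (v a)) \<le> 2 * M * norm x"
      using J_bound[OF \<mu>, of x] mild_start[OF v] t by simp
    also have "integral {a..t} (\<lambda>s. e s * norm (g s)) \<le> integral {a..t} (\<lambda>s. \<eta> + 2 * M * (e s * norm (f s)))"
    proof (rule integral_le)
      show "(\<lambda>s. e s * norm (g s)) integrable_on {a..t}"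
        by (intro integrable_continuous_interval continuous_on_subset[OF _ sub] continuous_intros cg' ce)
      show "(\<lambda>s. \<eta> + 2 * M * (e s * norm (f s))) integrable_on {a..t}"
        by (intro integrable_continuous_interval continuous_on_subset[OF _ sub] continuous_intros f ce)
      fix s assume "s \<in> {a..t}"
      hence s: "s \<in> {a..b}" using sub by auto
      have "norm (g s) \<le> norm (q s - J \<nu> (q s)) + norm (J \<mu> (f s))"
        unfolding g_def by (rule norm_triangle_ineq)
      also have "\<dots> \<le> \<eta> + 2 * M * norm (f s)"
        using \<nu>(1)[OF s] J_bound[OF \<mu>, of "f s"] by simp
      finally have "e s * norm (g s) \<le> e s * (\<eta> + 2 * M * norm (f s))"
        using e1[OF s] by (intro mult_left_mono)
      also have "\<dots> = e s * \<eta> + 2 * M * (e s * norm (f s))" by (simp add: algebra_simps)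
      also have "e s * \<eta> \<le> 1 * \<eta>" using e1[OF s] \<eta> by (intro mult_right_mono) auto
      finally show "e s * norm (g s) \<le> \<eta> + 2 * M * (e s * norm (f s))" by simp
    qed
    also have "integral {a..t} (\<lambda>s. \<eta> + 2 * M * (e s * norm (f s))) = (t - a) * \<eta> + 2 * M * I"
      unfolding I_def using t
      by (subst Henstock_Kurzweil_Integration.integral_add)
        (auto intro!: integrable_continuous_interval continuous_on_subset[OF _ sub] continuous_intros f ce)
    finally show ?thesis using M by (simp add: power2_eq_square algebra_simps)
  qed
  have "e t * norm (J \<mu> (v t)) \<le> 2 * M\<^sup>2 * norm x + 2 * M\<^sup>2 * I"
  proof (rule field_le_epsilon)
    fix \<delta> :: real assume \<delta>: "0 < \<delta>"
    have p: "0 < M * (t - a) + 1" using M t by (intro add_nonneg_pos) auto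
    have "M * (t - a) * (\<delta> / (M * (t - a) + 1)) \<le> \<delta>"
      using p \<delta> by (simp add: divide_le_eq algebra_simps)
    thus "e t * norm (J \<mu> (v t)) \<le> 2 * M\<^sup>2 * norm x + 2 * M\<^sup>2 * I + \<delta>"
      using main[of "\<delta> / (M * (t - a) + 1)"] p \<delta> by simp
  qed
  thus ?thesis by (simp add: e_def I_def)
qed

text \<open>Now \<mu> tends to infinity: v t lies in the closure of D, so \<open>J \<mu>\<close> (v
  t) tends to v t, while the bound of \<open>mild_estimate_J\<close> is free of \<mu>.\<close>

lemma mild_estimate:
  assumes v: "mild a b x f v" and f: "continuous_on {a..b} f" and t: "t \<in> {a..b}"
  shows "exp (- 2 * \<omega> * (t - a)) * norm (v t)
    \<le> 2 * M\<^sup>2 * norm x + 2 * M\<^sup>2 * integral {a..t} (\<lambda>s. exp (- 2 * \<omega> * (s - a)) * norm (f s))"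
proof (rule tendsto_upperbound)
  show "((\<lambda>\<mu>. exp (- 2 * \<omega> * (t - a)) * norm (J \<mu> (v t))) \<longlongrightarrow> exp (- 2 * \<omega> * (t - a)) * norm (v t)) at_top"
    by (intro tendsto_intros J_tendsto mildD(2)[OF v t])
  show "\<forall>\<^sub>F \<mu> in at_top. exp (- 2 * \<omega> * (t - a)) * norm (J \<mu> (v t))
    \<le> 2 * M\<^sup>2 * norm x + 2 * M\<^sup>2 * integral {a..t} (\<lambda>s. exp (- 2 * \<omega> * (s - a)) * norm (f s))"
    using eventually_gt_at_top[of \<omega>] eventually_ge_at_top[of "2 * \<omega>"]
    by eventually_elim (rule mild_estimate_J[OF v f t])
qed auto

text \<open>2 \<omega> undoes the exponential weight in \<open>mild_estimate\<close>; 2 M^2 \<beta>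
  is the Gronwall rate of a perturbation of size \<beta>.\<close>

abbreviation growth :: "real \<Rightarrow> real" where
  "growth \<beta> \<equiv> 2 * \<omega> + 2 * M\<^sup>2 * \<beta>"

text \<open>Allowing the forcing to be controlled by the solution itself makes this one estimate
  serve for uniqueness, growth, approximation errors and dependence on the coefficients. Gronwall is
  applied to the weighted norm.\<close>

lemma mild_bound:
  assumes v: "mild a b x f v" and f: "continuous_on {a..b} f" and t: "t \<in> {a..b}"
    and \<beta>: "0 \<le> \<beta>" and G: "0 \<le> G"
    and fb: "\<And>s. s \<in> {a..b} \<Longrightarrow> norm (f s) \<le> \<beta> * norm (v s) + G"
  shows "norm (v t) \<le> 2 * M\<^sup>2 * (norm x + (t - a) * G) * exp (growth \<beta> * (t - a))"
proof -
  define e where "e s = exp (- 2 * \<omega> * (s - a))" for s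
  define K where "K = 2 * M\<^sup>2"
  have K: "0 \<le> K" by (simp add: K_def)
  have ce: "continuous_on S e" for S unfolding e_def by (intro continuous_intros)
  have e1: "e s \<le> 1" "0 \<le> e s" if "s \<in> {a..b}" for s
    using that \<omega>_nonneg by (auto simp: e_def)
  note cv = mildD(1)[OF v]
  have subt: "{a..t} \<subseteq> {a..b}" using t by auto
  have "e t * norm (v t) \<le> exp (K * \<beta> * (t - a)) * (K * (norm x + (t - a) * G))"
  proof (rule gronwall)
    show "continuous_on {a..t} (\<lambda>s. e s * norm (v s))"
      by (rule continuous_on_subset[OF _ subt]) (intro continuous_intros cv ce)
    show "0 \<le> K * \<beta>" using K \<beta> by simp
    show "t \<in> {a..t}" using t by auto
    fix s assume s: "s \<in> {a..t}"
    hence s': "s \<in> {a..b}" and sub: "{a..s} \<subseteq> {a..b}" using t by auto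
    have est: "e s * norm (v s) \<le> K * norm x + K * integral {a..s} (\<lambda>s. e s * norm (f s))"
      using mild_estimate[OF v f s'] unfolding e_def K_def .
    have "integral {a..s} (\<lambda>s. e s * norm (f s)) \<le> integral {a..s} (\<lambda>s. \<beta> * (e s * norm (v s)) + G)"
    proof (rule integral_le)
      show "(\<lambda>s. e s * norm (f s)) integrable_on {a..s}"
        by (intro integrable_continuous_interval continuous_on_subset[OF _ sub] continuous_intros f ce)
      show "(\<lambda>s. \<beta> * (e s * norm (v s)) + G) integrable_on {a..s}"
        by (intro integrable_continuous_interval continuous_on_subset[OF _ sub] continuous_intros cv ce)
      fix r assume "r \<in> {a..s}"
      hence r: "r \<in> {a..b}" using sub by auto
      have "e r * norm (f r) \<le> e r * (\<beta> * norm (v r) + G)"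
        using fb[OF r] e1[OF r] by (intro mult_left_mono)
      also have "\<dots> = \<beta> * (e r * norm (v r)) + e r * G" by (simp add: algebra_simps)
      also have "e r * G \<le> 1 * G" using e1[OF r] G by (intro mult_right_mono) auto
      finally show "e r * norm (f r) \<le> \<beta> * (e r * norm (v r)) + G" by simp
    qed
    also have "integral {a..s} (\<lambda>s. \<beta> * (e s * norm (v s)) + G)
        = \<beta> * integral {a..s} (\<lambda>s. e s * norm (v s)) + (s - a) * G"
      using s by (subst Henstock_Kurzweil_Integration.integral_add)
        (auto intro!: integrable_continuous_interval continuous_on_subset[OF _ sub] continuous_intros cv ce)
    also have "(s - a) * G \<le> (t - a) * G" using s G by (intro mult_right_mono) auto
    finally have "K * integral {a..s} (\<lambda>s. e s * norm (f s))
        \<le> K * (\<beta> * integral {a..s} (\<lambda>s. e s * norm (v s)) + (t - a) * G)"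
      using K by (intro mult_left_mono) auto
    with est show "e s * norm (v s)
        \<le> K * (norm x + (t - a) * G) + K * \<beta> * integral {a..s} (\<lambda>s. e s * norm (v s))"
      by (simp add: algebra_simps)
  qed
  hence "exp (2 * \<omega> * (t - a)) * (e t * norm (v t))
      \<le> exp (2 * \<omega> * (t - a)) * (exp (K * \<beta> * (t - a)) * (K * (norm x + (t - a) * G)))"
    by (intro mult_left_mono) auto
  also have "exp (2 * \<omega> * (t - a)) * (e t * norm (v t)) = norm (v t)"
    by (simp add: e_def exp_minus)
  also have "exp (2 * \<omega> * (t - a)) * (exp (K * \<beta> * (t - a)) * (K * (norm x + (t - a) * G)))
      = K * (norm x + (t - a) * G) * exp ((2 * \<omega> + K * \<beta>) * (t - a))"
    by (simp add: distrib_right[of "2 * \<omega>"] exp_add)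
  finally show ?thesis by (simp add: K_def)
qed

section \<open>Existence of mild solutions\<close>

text \<open>Differences of mild solutions are mild solutions, so the a priori bound makes the
  approximations uniformly Cauchy. The limit satisfies the integrated equation because A is closed:
  its values on the integrals can be read off from the other, convergent terms.\<close>

lemma mild_limit:
  assumes f: "continuous_on {a..b} f" and ab: "a \<le> b"
    and approx: "\<And>e. 0 < e \<Longrightarrow> \<exists>x' f' v'. mild a b x' f' v' \<and> continuous_on {a..b} f' \<and>
      norm (x' - x) \<le> e \<and> (\<forall>s\<in>{a..b}. norm (f' s - f s) \<le> e)"
  shows "\<exists>v. mild a b x f v"
proof -
  define d where "d n = 1 / real (Suc n)" for n
  have d0: "0 < d n" for n by (simp add: d_def)
  have dlim: "d \<longlonglongrightarrow> 0" unfolding d_def by (rule LIMSEQ_inverse_real_of_nat[unfolded inverse_eq_divide])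
  have "\<exists>x' f' v'. \<forall>n. mild a b (x' n) (f' n) (v' n) \<and> continuous_on {a..b} (f' n) \<and>
      norm (x' n - x) \<le> d n \<and> (\<forall>s\<in>{a..b}. norm (f' n s - f s) \<le> d n)"
    using approx[OF d0] by metis
  then obtain x' f' v' where m: "\<And>n. mild a b (x' n) (f' n) (v' n)"
    and cf: "\<And>n. continuous_on {a..b} (f' n)"
    and x': "\<And>n. norm (x' n - x) \<le> d n"
    and f': "\<And>n s. s \<in> {a..b} \<Longrightarrow> norm (f' n s - f s) \<le> d n" by blast
  define C where "C = 2 * M\<^sup>2 * (1 + (b - a)) * exp (2 * \<omega> * (b - a))"
  have C: "0 < C" using ab M_ge_1 by (simp add: C_def add_pos_nonneg)
  have est: "norm (v' m t - v' n t) \<le> C * (d m + d n)" if t: "t \<in> {a..b}" for m n t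
  proof -
    have "norm (v' m t - v' n t) \<le> 2 * M\<^sup>2 * (norm (x' m - x' n) + (t - a) * (d m + d n))
        * exp ((2 * \<omega> + 2 * M\<^sup>2 * 0) * (t - a))"
    proof (rule mild_bound[OF mild_diff[OF m m cf cf] _ t])
      show "continuous_on {a..b} (\<lambda>s. f' m s - f' n s)" by (intro continuous_intros cf)
      show "norm (f' m s - f' n s) \<le> 0 * norm (v' m s - v' n s) + (d m + d n)" if "s \<in> {a..b}" for s
        using norm_triangle_ineq4[of "f' m s - f s" "f' n s - f s"] f'[OF that, of m] f'[OF that, of n] by simp
    qed (use d0[of m] d0[of n] in auto)
    also have "\<dots> \<le> 2 * M\<^sup>2 * ((1 + (b - a)) * (d m + d n)) * exp (2 * \<omega> * (b - a))"
    proof (intro mult_mono)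
      have "norm (x' m - x' n) \<le> d m + d n"
        using norm_triangle_ineq4[of "x' m - x" "x' n - x"] x'[of m] x'[of n] by simp
      moreover have "(t - a) * (d m + d n) \<le> (b - a) * (d m + d n)"
        using t d0[of m] d0[of n] by (intro mult_right_mono) auto
      ultimately show "norm (x' m - x' n) + (t - a) * (d m + d n) \<le> (1 + (b - a)) * (d m + d n)"
        by (simp add: algebra_simps)
      show "exp ((2 * \<omega> + 2 * M\<^sup>2 * 0) * (t - a)) \<le> exp (2 * \<omega> * (b - a))"
        using t \<omega>_nonneg by (simp add: mult_left_mono)
      show "0 \<le> 2 * M\<^sup>2 * ((1 + (b - a)) * (d m + d n))"
        using ab d0[of m] d0[of n] by simp
      show "0 \<le> norm (x' m - x' n) + (t - a) * (d m + d n)"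
        using t d0[of m] d0[of n] by simp
    qed auto
    finally show ?thesis by (simp add: C_def mult_ac)
  qed
  have "uniformly_Cauchy_on {a..b} v'"
  proof (rule uniformly_Cauchy_onI)
    fix e :: real assume "0 < e"
    hence "0 < e / (2 * C)" using C by simp
    from order_tendstoD(2)[OF dlim this] obtain N where N: "\<And>n. n \<ge> N \<Longrightarrow> d n < e / (2 * C)"
      unfolding eventually_sequentially by blast
    have "dist (v' m t) (v' n t) < e" if "m \<ge> N" "n \<ge> N" "t \<in> {a..b}" for m n t
    proof -
      have "C * (d m + d n) < C * (e / (2 * C) + e / (2 * C))"
        using N that C by (intro mult_strict_left_mono add_strict_mono) auto
      also have "\<dots> = e" using C by simp
      finally show ?thesis using est[OF that(3), of m n] by (simp add: dist_norm)
    qed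
    thus "\<exists>N. \<forall>t\<in>{a..b}. \<forall>m\<ge>N. \<forall>n\<ge>N. dist (v' m t) (v' n t) < e" by blast
  qed
  then obtain v where v: "uniform_limit {a..b} v' v sequentially"
    using Cauchy_uniformly_convergent uniformly_convergent_on_def by blast
  have flim: "uniform_limit {a..b} f' f sequentially"
  proof (rule uniform_limitI)
    fix e :: real assume "0 < e"
    from order_tendstoD(2)[OF dlim this]
    show "\<forall>\<^sub>F n in sequentially. \<forall>s\<in>{a..b}. dist (f' n s) (f s) < e"
      by eventually_elim (use f' in \<open>fastforce simp: dist_norm intro: le_less_trans\<close>)
  qed
  have "(\<lambda>n. norm (x' n - x)) \<longlonglongrightarrow> 0"
    by (rule tendsto_sandwich[OF _ _ tendsto_const dlim]) (use x' in auto)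
  hence xlim: "x' \<longlonglongrightarrow> x" by (simp add: LIM_zero_iff tendsto_norm_zero_iff)
  have "mild a b x f v" unfolding mild_def
  proof (intro conjI ballI)
    show "continuous_on {a..b} v"
      by (rule uniform_limit_theorem[OF _ v]) (auto intro!: always_eventually mildD(1)[OF m])
    fix t assume t: "t \<in> {a..b}"
    have vt: "(\<lambda>n. v' n t) \<longlonglongrightarrow> v t" using v t by (rule tendsto_uniform_limitI)
    show "v t \<in> closure D"
      by (rule Lim_in_closed_set[OF _ _ _ vt]) (use mildD(2)[OF m t] in auto)
    have iv: "(\<lambda>n. integral {a..t} (v' n)) \<longlonglongrightarrow> integral {a..t} v"
      by (rule integral_tendsto_uniform[OF v mildD(1)[OF m] t])
    have "(\<lambda>n. v' n t - x' n - integral {a..t} (f' n)) \<longlonglongrightarrow> v t - x - integral {a..t} f"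
      by (intro tendsto_intros vt xlim integral_tendsto_uniform[OF flim cf t])
    hence Alim: "(\<lambda>n. A (integral {a..t} (v' n))) \<longlonglongrightarrow> v t - x - integral {a..t} f"
      by (subst (asm) mildD(4)[OF m t]) simp
    show "integral {a..t} v \<in> D" by (rule A_closed(1)[OF iv Alim mildD(3)[OF m t]])
    show "v t = x + A (integral {a..t} v) + integral {a..t} f"
      using A_closed(2)[OF iv Alim mildD(3)[OF m t]] by simp
  qed
  thus ?thesis by blast
qed

text \<open>An operator that commutes with \<open>yosida \<mu>\<close> maps solutions of the Yosida
  equation to solutions. This bounds quantities such as \<open>yosida \<mu>\<close> (u t) by their
  initial values.\<close>

lemma yosida_commuting_bound:
  assumes \<mu>: "\<omega> < \<mu>" "2 * \<omega> \<le> \<mu>"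
    and u: "\<And>s. s \<in> {a..b} \<Longrightarrow> (u has_vector_derivative yosida \<mu> (u s)) (at s within {a..b})"
    and L: "bounded_linear L" "\<And>x. L (yosida \<mu> x) = yosida \<mu> (L x)" and t: "t \<in> {a..b}"
  shows "exp (- 2 * \<omega> * (t - a)) * norm (L (u t)) \<le> M * norm (L (u a))"
proof -
  have "((\<lambda>s. L (u s)) has_vector_derivative (yosida \<mu> (L (u s)) + 0)) (at s within {a..b})"
    if "s \<in> {a..b}" for s
    using bounded_linear.has_vector_derivative[OF L(1) u[OF that]] L(2) by simp
  from yosida_estimate[OF \<mu> _ this t] show ?thesis by simp
qed

text \<open>The difference of two Yosida flows solves the m-th equation with forcing
  \<open>L\<close> (\<open>u n\<close>), where \<open>L\<close> is the difference of the generators.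
  \<open>L\<close> commutes with them, so the forcing is controlled by \<open>L\<close> x, which is
  a difference of two vectors \<open>J\<close> (A x). These converge because A x lies in the closure
  of D.\<close>

lemma mild_exists_regular:
  assumes x: "x \<in> D" "A x \<in> closure D" and ab: "a \<le> b"
  shows "\<exists>v. mild a b x (\<lambda>_. 0) v"
proof -
  \<comment> \<open>This choice gives \<mu> > \<omega>, \<mu> \<ge> 2 \<omega> and \<mu> > 0 for
    every n.\<close>
  define \<mu> where "\<mu> n = 2 * \<omega> + real (Suc n)" for n
  have \<mu>: "\<omega> < \<mu> n" "2 * \<omega> \<le> \<mu> n" "0 < \<mu> n" for n
    using \<omega>_nonneg by (auto simp: \<mu>_def)
  have \<mu>_lim: "filterlim \<mu> at_top sequentially"
    unfolding \<mu>_def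
    by (rule filterlim_tendsto_add_at_top[OF tendsto_const
        filterlim_compose[OF filterlim_real_sequentially filterlim_Suc]])
  have "\<exists>u. u a = x \<and> (\<forall>t\<in>{a..b}. (u has_vector_derivative yosida (\<mu> n) (u t)) (at t within {a..b}))" for n
    using bounded_linear_ode_exists[OF bounded_linear_yosida[OF \<mu>(1)] ab] by metis
  then obtain u where ua: "\<And>n. u n a = x"
    and du: "\<And>n t. t \<in> {a..b} \<Longrightarrow> (u n has_vector_derivative yosida (\<mu> n) (u n t)) (at t within {a..b})"
    by metis
  define E where "E = exp (2 * \<omega> * (b - a))"
  have E: "exp (- 2 * \<omega> * (t - a)) * c \<le> d \<Longrightarrow> 0 \<le> c \<Longrightarrow> c \<le> E * d" if "t \<in> {a..b}" for t c d :: real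
  proof -
    assume cd: "exp (- 2 * \<omega> * (t - a)) * c \<le> d" and c: "0 \<le> c"
    have "c = exp (2 * \<omega> * (t - a)) * (exp (- 2 * \<omega> * (t - a)) * c)" by (simp add: exp_minus)
    also have "\<dots> \<le> E * d"
    proof (rule mult_mono[OF _ cd])
      show "exp (2 * \<omega> * (t - a)) \<le> E" using that \<omega>_nonneg by (simp add: E_def mult_left_mono)
    qed (use c in \<open>auto simp: E_def\<close>)
    finally show "c \<le> E * d" .
  qed
  have M: "0 < M" using M_ge_1 by simp
  have cu: "continuous_on {a..b} (u n)" for n
    unfolding continuous_on_eq_continuous_within
    by (intro ballI has_vector_derivative_continuous[OF du])
  have yos: "yosida (\<mu> n) x = J (\<mu> n) (A x)" for n by (simp add: J_A[OF \<mu>(1) x(1)])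
  have est: "norm (u m t - u n t) \<le> E * (M\<^sup>2 * (b - a) * norm (J (\<mu> m) (A x) - J (\<mu> n) (A x)))"
    if t: "t \<in> {a..b}" for m n t
  proof (rule E[OF t])
    define L where "L y = yosida (\<mu> m) y - yosida (\<mu> n) y" for y
    have L: "bounded_linear L" unfolding L_def
      by (intro bounded_linear_sub bounded_linear_yosida \<mu>)
    interpret Ym: bounded_linear "yosida (\<mu> m)" by (rule bounded_linear_yosida[OF \<mu>(1)])
    interpret Yn: bounded_linear "yosida (\<mu> n)" by (rule bounded_linear_yosida[OF \<mu>(1)])
    have Lc: "L (yosida (\<mu> n) y) = yosida (\<mu> n) (L y)" for y
      by (simp add: L_def Yn.diff yosida_commute[OF \<mu>(1) \<mu>(1), of m n])
    have cL: "continuous_on {a..b} (\<lambda>s. L (u n s))" by (rule bounded_linear.continuous_on[OF L cu])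
    have sub: "{a..t} \<subseteq> {a..b}" using t by auto
    have "exp (- 2 * \<omega> * (t - a)) * norm (u m t - u n t) \<le> M * norm (u m a - u n a)
        + M * integral {a..t} (\<lambda>s. exp (- 2 * \<omega> * (s - a)) * norm (L (u n s)))"
    proof (rule yosida_estimate[OF \<mu>(1,2) cL _ t])
      fix s assume s: "s \<in> {a..b}"
      show "((\<lambda>s. u m s - u n s) has_vector_derivative
          (yosida (\<mu> m) (u m s - u n s) + L (u n s))) (at s within {a..b})"
        using has_vector_derivative_diff[OF du[OF s] du[OF s], of m n] by (simp add: L_def Ym.diff)
    qed
    also have "\<dots> = M * integral {a..t} (\<lambda>s. exp (- 2 * \<omega> * (s - a)) * norm (L (u n s)))"
      by (simp add: ua)
    also have "\<dots> \<le> M * integral {a..t} (\<lambda>s. M * norm (L x))"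
    proof (intro mult_left_mono integral_le)
      show "(\<lambda>s. exp (- 2 * \<omega> * (s - a)) * norm (L (u n s))) integrable_on {a..t}"
        by (intro integrable_continuous_interval continuous_on_subset[OF _ sub] continuous_intros cL)
      show "exp (- 2 * \<omega> * (s - a)) * norm (L (u n s)) \<le> M * norm (L x)" if "s \<in> {a..t}" for s
        using yosida_commuting_bound[OF \<mu>(1,2) du L Lc, of s] that sub by (auto simp: ua)
    qed (use M in auto)
    also have "\<dots> = M\<^sup>2 * (t - a) * norm (L x)" using t by (simp add: power2_eq_square)
    also have "\<dots> \<le> M\<^sup>2 * (b - a) * norm (L x)"
      using t by (intro mult_right_mono mult_left_mono) auto
    finally show "exp (- 2 * \<omega> * (t - a)) * norm (u m t - u n t)
        \<le> M\<^sup>2 * (b - a) * norm (J (\<mu> m) (A x) - J (\<mu> n) (A x))"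
      by (simp add: L_def yos)
  qed simp
  have JA: "(\<lambda>n. J (\<mu> n) (A x)) \<longlonglongrightarrow> A x"
    by (rule filterlim_compose[OF J_tendsto[OF x(2)] \<mu>_lim])
  have "uniformly_Cauchy_on {a..b} u"
  proof (rule uniformly_Cauchy_onI)
    fix e :: real assume e: "0 < e"
    define c where "c = E * (M\<^sup>2 * (b - a)) + 1"
    have c: "0 < c" using ab M by (simp add: c_def E_def add_nonneg_pos)
    obtain N where N: "\<And>m n. m \<ge> N \<Longrightarrow> n \<ge> N \<Longrightarrow> norm (J (\<mu> m) (A x) - J (\<mu> n) (A x)) < e / c"
      using CauchyD[OF LIMSEQ_imp_Cauchy[OF JA], of "e / c"] e c by auto
    have "dist (u m t) (u n t) < e" if "m \<ge> N" "n \<ge> N" "t \<in> {a..b}" for m n t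
    proof -
      have "norm (u m t - u n t) \<le> (E * (M\<^sup>2 * (b - a))) * norm (J (\<mu> m) (A x) - J (\<mu> n) (A x))"
        using est[OF that(3)] by (simp add: mult_ac)
      also have "\<dots> \<le> c * norm (J (\<mu> m) (A x) - J (\<mu> n) (A x))"
        by (intro mult_right_mono) (auto simp: c_def)
      also have "\<dots> < c * (e / c)" using N[OF that(1,2)] c by (intro mult_strict_left_mono)
      finally show ?thesis using c by (simp add: dist_norm)
    qed
    thus "\<exists>N. \<forall>t\<in>{a..b}. \<forall>m\<ge>N. \<forall>n\<ge>N. dist (u m t) (u n t) < e" by blast
  qed
  then obtain v where v: "uniform_limit {a..b} u v sequentially"
    using Cauchy_uniformly_convergent uniformly_convergent_on_def by blast
  \<comment> \<open>Applying \<open>J\<close> puts the approximations into D, so A can be evaluated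
    on their integrals, and it gives exactly \<open>u n\<close> t - x there. The limit is unchanged:
    \<open>w n\<close> - \<open>u n\<close> is the bounded vector \<open>yosida\<close>
    (\<open>u n\<close>) divided by \<open>\<mu> n\<close>.\<close>
  define w where "w n s = J (\<mu> n) (u n s)" for n s
  have w: "uniform_limit {a..b} w v sequentially"
  proof -
    define c where "c = E * (M * (2 * M * norm (A x)))"
    have bd: "norm (w n s - u n s) \<le> c * inverse (\<mu> n)" if s: "s \<in> {a..b}" for n s
    proof -
      have "norm (yosida (\<mu> n) (u n s)) \<le> E * (M * norm (yosida (\<mu> n) (u n a)))"
        by (rule E[OF s yosida_commuting_bound[OF \<mu>(1,2) du bounded_linear_yosida[OF \<mu>(1)] refl s]]) auto
      also have "\<dots> \<le> c"
        unfolding c_def ua yos using M by (intro mult_left_mono J_bound \<mu>) (auto simp: E_def)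
      finally have "norm (yosida (\<mu> n) (u n s)) \<le> c" .
      moreover have "norm (yosida (\<mu> n) (u n s)) = \<mu> n * norm (w n s - u n s)"
        using \<mu>(3)[of n] by (simp add: yosida_def w_def)
      ultimately show ?thesis using \<mu>(3)[of n] by (simp add: field_simps)
    qed
    have "(\<lambda>n. c * inverse (\<mu> n)) \<longlonglongrightarrow> c * 0"
      by (intro tendsto_intros tendsto_inverse_0_at_top[OF \<mu>_lim])
    hence lim0: "(\<lambda>n. c * inverse (\<mu> n)) \<longlonglongrightarrow> 0" by simp
    have "uniform_limit {a..b} (\<lambda>n s. w n s - u n s) (\<lambda>_. 0) sequentially"
    proof (rule uniform_limitI)
      fix e :: real assume "0 < e"
      from order_tendstoD(2)[OF lim0 this]
      show "\<forall>\<^sub>F n in sequentially. \<forall>s\<in>{a..b}. dist (w n s - u n s) 0 < e"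
        by eventually_elim (use bd in \<open>fastforce intro: le_less_trans\<close>)
    qed
    from uniform_limit_add[OF this v] show ?thesis by simp
  qed
  have cw: "continuous_on {a..b} (w n)" for n
    unfolding w_def by (rule bounded_linear.continuous_on[OF bounded_linear_J[OF \<mu>(1)] cu])
  have "mild a b x (\<lambda>_. 0) v" unfolding mild_def
  proof (intro conjI ballI)
    show "continuous_on {a..b} v"
      by (rule uniform_limit_theorem[OF _ v]) (auto intro!: always_eventually cu)
    fix t assume t: "t \<in> {a..b}"
    have sub: "{a..t} \<subseteq> {a..b}" using t by auto
    have vt: "(\<lambda>n. u n t) \<longlonglongrightarrow> v t" using v t by (rule tendsto_uniform_limitI)
    have wt: "(\<lambda>n. w n t) \<longlonglongrightarrow> v t" using w t by (rule tendsto_uniform_limitI)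
    have "w n t \<in> closure D" for n unfolding w_def using J_in_D[OF \<mu>(1)] closure_subset by blast
    thus "v t \<in> closure D" by (intro Lim_in_closed_set[OF _ _ _ wt]) auto
    have wJ: "integral {a..t} (w n) = J (\<mu> n) (integral {a..t} (u n))" for n
      unfolding w_def
      by (rule integral_bounded_linear_continuous[OF bounded_linear_J[OF \<mu>(1)] continuous_on_subset[OF cu sub]])
    have iw: "(\<lambda>n. integral {a..t} (w n)) \<longlonglongrightarrow> integral {a..t} v"
      by (rule integral_tendsto_uniform[OF w cw t])
    have wD: "integral {a..t} (w n) \<in> D" for n unfolding wJ by (rule J_in_D[OF \<mu>(1)])
    have "A (integral {a..t} (w n)) = u n t - x" for n
    proof -
      have "A (integral {a..t} (w n)) = yosida (\<mu> n) (integral {a..t} (u n))"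
        unfolding wJ by (rule A_J[OF \<mu>(1)])
      also have "\<dots> = integral {a..t} (\<lambda>s. yosida (\<mu> n) (u n s))"
        by (rule integral_bounded_linear_continuous[OF bounded_linear_yosida[OF \<mu>(1)]
              continuous_on_subset[OF cu sub], symmetric])
      also have "((\<lambda>s. yosida (\<mu> n) (u n s)) has_integral (u n t - u n a)) {a..t}"
        by (rule fundamental_theorem_of_calculus)
          (use t in \<open>auto intro!: has_vector_derivative_within_subset[OF du sub]\<close>)
      hence "integral {a..t} (\<lambda>s. yosida (\<mu> n) (u n s)) = u n t - x"
        by (simp add: integral_unique ua)
      finally show ?thesis .
    qed
    hence Aw: "(\<lambda>n. A (integral {a..t} (w n))) \<longlonglongrightarrow> v t - x"
      by (auto intro!: tendsto_intros vt)
    show "integral {a..t} v \<in> D" by (rule A_closed(1)[OF iw Aw wD])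
    show "v t = x + A (integral {a..t} v) + integral {a..t} (\<lambda>_. 0)"
      using A_closed(2)[OF iw Aw wD] by simp
  qed
  thus ?thesis by blast
qed

text \<open>The vectors \<open>J \<mu>\<close> y with y in D are dense in the closure of D. They
  satisfy the regularity condition of \<open>mild_exists_regular\<close>, since A
  (\<open>J \<mu>\<close> y) = \<open>J \<mu>\<close> (A y) lies in D.\<close>

lemma mild_exists_homogeneous:
  assumes x: "x \<in> closure D" and ab: "a \<le> b"
  shows "\<exists>v. mild a b x (\<lambda>_. 0) v"
proof (rule mild_limit[OF _ ab])
  fix e :: real assume e: "0 < e"
  obtain y where y: "y \<in> D" "dist y x < e / 2"
    using x e unfolding closure_approachable by (meson half_gt_zero)
  have "((\<lambda>\<mu>. J \<mu> y) \<longlongrightarrow> y) at_top" using y closure_subset by (intro J_tendsto) auto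
  hence "\<forall>\<^sub>F \<mu> in at_top. dist (J \<mu> y) y < e / 2" using e by (intro tendstoD) auto
  hence "\<forall>\<^sub>F \<mu> in at_top. dist (J \<mu> y) y < e / 2 \<and> \<omega> < \<mu>"
    using eventually_gt_at_top[of \<omega>] by eventually_elim auto
  then obtain \<mu> where \<mu>: "dist (J \<mu> y) y < e / 2" "\<omega> < \<mu>" by (auto dest!: eventually_happens)
  have "A (J \<mu> y) \<in> D" using A_J[OF \<mu>(2)] J_A[OF \<mu>(2) y(1)] J_in_D[OF \<mu>(2)] by metis
  then obtain v where "mild a b (J \<mu> y) (\<lambda>_. 0) v"
    using mild_exists_regular[of "J \<mu> y" a b] J_in_D[OF \<mu>(2)] closure_subset ab by blast
  moreover have "norm (J \<mu> y - x) \<le> e"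
    using dist_triangle[of "J \<mu> y" x y] \<mu> y by (simp add: dist_norm)
  ultimately show "\<exists>x' f' v'. mild a b x' f' v' \<and> continuous_on {a..b} f' \<and>
      norm (x' - x) \<le> e \<and> (\<forall>s\<in>{a..b}. norm (f' s - 0) \<le> e)"
    using e by (intro exI[of _ "J \<mu> y"] exI[of _ "\<lambda>_. 0"] exI[of _ v]) auto
qed auto

text \<open>Forcing \<open>y \<in> X\<close> outside \<open>closure D\<close>: subtracting \<open>z = R \<mu> y\<close> leaves the forcing \<open>\<mu> z \<in> D\<close>.\<close>

lemma mild_exists_constant:
  assumes x: "x \<in> closure D" and ab: "a \<le> b"
  shows "\<exists>v. mild a b x (\<lambda>_. y) v"
proof -
  obtain \<mu> where \<mu>: "\<omega> < \<mu>" using gt_ex by blast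
  define z where "z = R \<mu> y"
  have z: "z \<in> D" unfolding z_def by (rule R_in_D[OF \<mu>])
  hence z': "z \<in> closure D" using closure_subset by blast
  obtain h where h: "mild a b z (\<lambda>_. 0) h" using mild_exists_homogeneous[OF z' ab] by blast
  obtain g where g: "mild a b (x - z) (\<lambda>_. 0) g"
    using mild_exists_homogeneous[OF closure_D_diff[OF x z'] ab] by blast
  \<comment> \<open>\<open>H\<close> absorbs the forcing \<mu> z by integrating the homogeneous
    solution from z. The constant z contributes the forcing -A z, and \<open>g\<close> corrects the
    initial value.\<close>
  have H: "mild a b (\<mu> *\<^sub>R 0) (\<lambda>t. \<mu> *\<^sub>R (z + integral {a..t} (\<lambda>_. 0))) (\<lambda>t. \<mu> *\<^sub>R integral {a..t} h)"
    by (rule mild_scale[OF mild_integral[OF h]]) auto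
  have "mild a b (z + (x - z) + \<mu> *\<^sub>R 0) (\<lambda>t. (- A z + 0) + \<mu> *\<^sub>R (z + integral {a..t} (\<lambda>_. 0)))
     (\<lambda>t. (z + g t) + \<mu> *\<^sub>R integral {a..t} h)"
    by (intro mild_add mild_const z g H continuous_intros) (auto intro!: continuous_intros)
  moreover have "\<mu> *\<^sub>R z - A z = y" unfolding z_def by (rule R_right[OF \<mu>])
  ultimately show ?thesis by (auto simp: add.commute)
qed

lemma mild_exists_affine:
  assumes x: "x \<in> closure D" and ab: "a \<le> b"
  shows "\<exists>v. mild a b x (\<lambda>t. y + (t - a) *\<^sub>R z) v"
proof -
  obtain p where p: "mild a b x (\<lambda>_. y) p" using mild_exists_constant[OF x ab] by blast
  have "0 \<in> closure D" by (rule subspace_0[OF subspace_closure_D])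
  then obtain q where q: "mild a b 0 (\<lambda>_. z) q" using mild_exists_constant ab by blast
  have "mild a b (x + 0) (\<lambda>t. y + (0 + integral {a..t} (\<lambda>_. z))) (\<lambda>t. p t + integral {a..t} q)"
    by (intro mild_add p mild_integral[OF q] continuous_intros indefinite_integral_continuous_1
        integrable_continuous_interval)
  hence "mild a b x (\<lambda>t. y + (t - a) *\<^sub>R z) (\<lambda>t. p t + integral {a..t} q)"
    unfolding add_0_right by (rule mild_cong) auto
  thus ?thesis by blast
qed

text \<open>Affine forcing on short intervals is solvable from every initial value, and such
  solutions can be concatenated. Uniform approximation of f then suffices by
  \<open>mild_limit\<close>.\<close>

theorem mild_exists:
  assumes f: "continuous_on {a..b} f" and x: "x \<in> closure D" and ab: "a \<le> b"
  shows "\<exists>v. mild a b x f v"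
proof (rule mild_limit[OF f ab])
  fix e :: real assume e: "0 < e"
  \<comment> \<open>Exact agreement with f at both ends makes neighbouring approximants join
    continuously. Solvability is demanded for every initial value, since the start on the right
    piece is the endpoint reached on the left one.\<close>
  define P where "P c d \<longleftrightarrow> a \<le> c \<and> d \<le> b \<longrightarrow> (\<exists>g. continuous_on {c..d} g \<and> g c = f c \<and> g d = f d \<and>
      (\<forall>s\<in>{c..d}. norm (g s - f s) \<le> e) \<and> (\<forall>x\<in>closure D. \<exists>v. mild c d x g v))" for c d
  have "P a b"
  proof (rule Bolzano[OF ab])
    fix p q r assume P: "P p q" "P q r" and pq: "p \<le> q" "q \<le> r"
    show "P p r" unfolding P_def
    proof (intro impI)
      assume "a \<le> p \<and> r \<le> b"
      with P pq obtain g h where g: "continuous_on {p..q} g" "g p = f p" "g q = f q"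
          "\<forall>s\<in>{p..q}. norm (g s - f s) \<le> e" "\<forall>x\<in>closure D. \<exists>v. mild p q x g v"
        and h: "continuous_on {q..r} h" "h q = f q" "h r = f r"
          "\<forall>s\<in>{q..r}. norm (h s - f s) \<le> e" "\<forall>x\<in>closure D. \<exists>v. mild q r x h v"
        unfolding P_def by (meson order_trans)
      define k where "k s = (if s \<le> q then g s else h s)" for s
      have pr: "{p..r} = {p..q} \<union> {q..r}" using pq by auto
      have ck: "continuous_on {p..r} k"
        unfolding k_def pr using g(1,3) h(1,2) by (intro continuous_on_If) auto
      have "\<exists>v. mild p r x k v" if x: "x \<in> closure D" for x
      proof -
        obtain v where "mild p q x g v" using g(5) x by blast
        hence v: "mild p q x k v" by (rule mild_cong) (auto simp: k_def)
        have "v q \<in> closure D" using mildD(2)[OF v, of q] pq by auto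
        then obtain w where "mild q r (v q) h w" using h(5) by blast
        hence w: "mild q r (v q) k w" by (rule mild_cong) (use g(3) h(2) in \<open>auto simp: k_def\<close>)
        show ?thesis using mild_concat[OF v w ck pq] by blast
      qed
      moreover have "\<forall>s\<in>{p..r}. norm (k s - f s) \<le> e" using g(4) h(4) by (auto simp: k_def)
      moreover have "k p = f p" "k r = f r" using g h pq by (auto simp: k_def)
      ultimately show "\<exists>g. continuous_on {p..r} g \<and> g p = f p \<and> g r = f r \<and>
        (\<forall>s\<in>{p..r}. norm (g s - f s) \<le> e) \<and> (\<forall>x\<in>closure D. \<exists>v. mild p r x g v)"
        using ck by blast
    qed
  next
    fix y assume y: "a \<le> y" "y \<le> b"
    obtain d where d: "0 < d" "\<And>s. s \<in> {a..b} \<Longrightarrow> dist s y < d \<Longrightarrow> dist (f s) (f y) < e / 2"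
      using f y e unfolding continuous_on_iff by (metis atLeastAtMost_iff half_gt_zero)
    have "P p q" if pq: "p \<le> y" "y \<le> q" "q - p < d" for p q
      unfolding P_def
    proof (intro impI)
      assume pq': "a \<le> p \<and> q \<le> b"
      have near: "norm (f s - f y) \<le> e / 2" if "s \<in> {p..q}" for s
      proof -
        have "\<bar>s - y\<bar> < d" using that pq by auto
        thus ?thesis using d(2)[of s] that pq' by (auto simp: dist_norm)
      qed
      show "\<exists>g. continuous_on {p..q} g \<and> g p = f p \<and> g q = f q \<and>
        (\<forall>s\<in>{p..q}. norm (g s - f s) \<le> e) \<and> (\<forall>x\<in>closure D. \<exists>v. mild p q x g v)"
      proof (cases "p = q")
        \<comment> \<open>A degenerate interval is handled apart because the slope below divides by
          q - p.\<close>
        case True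
        thus ?thesis using mild_exists_constant[of _ p q "f p"] e
          by (intro exI[of _ "\<lambda>_. f p"]) auto
      next
        case False
        hence lt: "p < q" using pq by simp
        define g where "g s = f p + (s - p) *\<^sub>R ((f q - f p) /\<^sub>R (q - p))" for s
        have "norm (g s - f s) \<le> e" if s: "s \<in> {p..q}" for s
        proof -
          have "norm (g s - f y) \<le> e / 2"
            unfolding g_def using s lt by (intro affine_interpolation_close near) auto
          thus ?thesis using near[OF s] norm_triangle_ineq4[of "g s - f y" "f s - f y"] by simp
        qed
        moreover have "continuous_on {p..q} g" unfolding g_def by (intro continuous_intros)
        moreover have "g p = f p" "g q = f q" using lt by (auto simp: g_def)
        moreover have "\<forall>x\<in>closure D. \<exists>v. mild p q x g v"
          unfolding g_def[abs_def] using lt by (intro ballI mild_exists_affine) auto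
        ultimately show ?thesis by blast
      qed
    qed
    thus "\<exists>d>0. \<forall>a b. a \<le> y \<and> y \<le> b \<and> b - a < d \<longrightarrow> P a b" using d(1) by blast
  qed
  then obtain g where "continuous_on {a..b} g" "\<forall>s\<in>{a..b}. norm (g s - f s) \<le> e"
      "\<forall>x\<in>closure D. \<exists>v. mild a b x g v"
    unfolding P_def by auto
  thus "\<exists>x' f' v'. mild a b x' f' v' \<and> continuous_on {a..b} f' \<and>
      norm (x' - x) \<le> e \<and> (\<forall>s\<in>{a..b}. norm (f' s - f s) \<le> e)"
    using x e by (metis norm_zero cancel_comm_monoid_add_class.diff_cancel less_imp_le)
qed

section \<open>Bounded perturbations\<close>

text \<open>Norm continuity is spelled out as an inequality on the closure of D, so it passes
  directly to sums and negatives. The bound \<beta> is global in time; the exponential bound of the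
  evolution family depends on this.\<close>

definition perturbation :: "(real \<Rightarrow> 'a \<Rightarrow> 'a) \<Rightarrow> real \<Rightarrow> bool" where
  "perturbation B \<beta> \<longleftrightarrow> 0 \<le> \<beta> \<and> (\<forall>t. linear_operator (closure D) (B t)) \<and>
     (\<forall>t. \<forall>x\<in>closure D. norm (B t x) \<le> \<beta> * norm x) \<and>
     (\<forall>t. \<forall>e>0. \<exists>d>0. \<forall>s. \<bar>s - t\<bar> < d \<longrightarrow> (\<forall>x\<in>closure D. norm (B s x - B t x) \<le> e * norm x))"

lemma perturbation_nonneg: "perturbation B \<beta> \<Longrightarrow> 0 \<le> \<beta>"
  and perturbation_bound: "perturbation B \<beta> \<Longrightarrow> x \<in> closure D \<Longrightarrow> norm (B t x) \<le> \<beta> * norm x"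
  and perturbation_add: "perturbation B \<beta> \<Longrightarrow> x \<in> closure D \<Longrightarrow> y \<in> closure D \<Longrightarrow> B t (x + y) = B t x + B t y"
  and perturbation_scale: "perturbation B \<beta> \<Longrightarrow> x \<in> closure D \<Longrightarrow> B t (c *\<^sub>R x) = c *\<^sub>R B t x"
  unfolding perturbation_def linear_operator_def by auto

lemma perturbation_diff:
  assumes "perturbation B \<beta>" "x \<in> closure D" "y \<in> closure D"
  shows "B t (x - y) = B t x - B t y"
  using perturbation_add[OF assms(1,2) closure_D_scale[OF assms(3), of "-1"], of t]
    perturbation_scale[OF assms(1,3), of t "-1"] by simp

lemma continuous_on_perturbation:
  assumes B: "perturbation B \<beta>" and u: "continuous_on T u" "u ` T \<subseteq> closure D"
  shows "continuous_on T (\<lambda>s. B s (u s))"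
  unfolding continuous_on_iff
proof (intro ballI allI impI)
  fix t and e :: real assume t: "t \<in> T" and e: "0 < e"
  have \<beta>: "0 \<le> \<beta>" by (rule perturbation_nonneg[OF B])
  have ut: "u t \<in> closure D" using u t by auto
  define e1 where "e1 = e / (2 * (norm (u t) + 1))"
  have n1: "0 < norm (u t) + 1" by (simp add: add_nonneg_pos)
  have e1: "0 < e1" using e n1 by (simp add: e1_def)
  obtain d1 where d1: "0 < d1"
      "\<And>s x. \<bar>s - t\<bar> < d1 \<Longrightarrow> x \<in> closure D \<Longrightarrow> norm (B s x - B t x) \<le> e1 * norm x"
    using B e1 unfolding perturbation_def by blast
  have "0 < e / (2 * (\<beta> + 1))" using e \<beta> by simp
  then obtain d2 where d2: "0 < d2" "\<And>s. s \<in> T \<Longrightarrow> dist s t < d2 \<Longrightarrow> dist (u s) (u t) < e / (2 * (\<beta> + 1))"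
    using u(1) t unfolding continuous_on_iff by blast
  show "\<exists>d>0. \<forall>s\<in>T. dist s t < d \<longrightarrow> dist (B s (u s)) (B t (u t)) < e"
  proof (intro exI conjI ballI impI)
    show "0 < min d1 d2" using d1 d2 by simp
    fix s assume s: "s \<in> T" "dist s t < min d1 d2"
    have us: "u s \<in> closure D" using u s by auto
    have "B s (u s) - B t (u t) = B s (u s - u t) + (B s (u t) - B t (u t))"
      by (simp add: perturbation_diff[OF B us ut])
    hence "norm (B s (u s) - B t (u t)) \<le> norm (B s (u s - u t)) + norm (B s (u t) - B t (u t))"
      by (metis norm_triangle_ineq)
    also have "\<dots> \<le> \<beta> * norm (u s - u t) + e1 * norm (u t)"
      using s d1(2)[of s "u t"] ut us
      by (intro add_mono perturbation_bound[OF B] closure_D_diff)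
        (auto simp: dist_real_def)
    also have "\<beta> * norm (u s - u t) \<le> \<beta> * (e / (2 * (\<beta> + 1)))"
      using d2(2)[of s] s \<beta> by (intro mult_left_mono) (auto simp: dist_norm)
    also have "\<beta> * (e / (2 * (\<beta> + 1))) \<le> e / 2" using \<beta> e by (simp add: field_simps)
    also have "e1 * norm (u t) < e / 2" using e n1 by (simp add: e1_def field_simps)
    finally show "dist (B s (u s)) (B t (u t)) < e" by (simp add: dist_norm)
  qed
qed

lemma mild_bound_perturbed:
  assumes B: "perturbation B \<beta>" and v: "mild a b x (\<lambda>s. B s (v s) + k s) v"
    and k: "continuous_on {a..b} k" and G: "0 \<le> G" "\<And>s. s \<in> {a..b} \<Longrightarrow> norm (k s) \<le> G"
    and t: "t \<in> {a..b}"
  shows "norm (v t) \<le> 2 * M\<^sup>2 * (norm x + (t - a) * G) * exp (growth \<beta> * (t - a))"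
proof (rule mild_bound[OF v _ t perturbation_nonneg[OF B] G(1)])
  show "continuous_on {a..b} (\<lambda>s. B s (v s) + k s)"
    using mildD(2)[OF v] by (intro continuous_intros k continuous_on_perturbation[OF B mildD(1)[OF v]]) auto
  show "norm (B s (v s) + k s) \<le> \<beta> * norm (v s) + G" if "s \<in> {a..b}" for s
    using G(2)[OF that] perturbation_bound[OF B mildD(2)[OF v that], of s]
    by (intro norm_triangle_le) linarith
qed

lemma mild_diff_perturbed:
  assumes B: "perturbation B \<beta>" and v: "mild a b x (\<lambda>s. B s (v s) + k s) v"
    and w: "mild a b y (\<lambda>s. B s (w s) + l s) w"
    and k: "continuous_on {a..b} k" and l: "continuous_on {a..b} l"
  shows "mild a b (x - y) (\<lambda>s. B s (v s - w s) + (k s - l s)) (\<lambda>s. v s - w s)"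
proof (rule mild_cong[OF mild_diff[OF v w]])
  show "continuous_on {a..b} (\<lambda>s. B s (v s) + k s)" "continuous_on {a..b} (\<lambda>s. B s (w s) + l s)"
    using mildD(2)[OF v] mildD(2)[OF w]
    by (auto intro!: continuous_intros k l continuous_on_perturbation[OF B]
        mildD(1)[OF v] mildD(1)[OF w])
  show "B s (v s) + k s - (B s (w s) + l s) = B s (v s - w s) + (k s - l s)" if "s \<in> {a..b}" for s
    by (simp add: perturbation_diff[OF B mildD(2)[OF v that] mildD(2)[OF w that]])
qed auto

lemma mild_exists_perturbed:
  assumes B: "perturbation B \<beta>" and k: "continuous_on {a..b} k" and x: "x \<in> closure D" and ab: "a \<le> b"
  shows "\<exists>v. mild a b x (\<lambda>s. B s (v s) + k s) v"
proof -
  define Rel where "Rel u v \<longleftrightarrow> mild a b x (\<lambda>s. B s (u s) + k s) v" for u v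
  \<comment> \<open>The Lipschitz constant read off from \<open>mild_estimate\<close>; the
    exponential removes the weight at the worst time b.\<close>
  define L where "L = exp (2 * \<omega> * (b - a)) * (2 * M\<^sup>2) * \<beta>"
  have \<beta>: "0 \<le> \<beta>" by (rule perturbation_nonneg[OF B])
  have cB: "continuous_on {a..b} (\<lambda>s. B s (u s) + k s)"
    if "continuous_on {a..b} u" "u ` {a..b} \<subseteq> closure D" for u
    by (intro continuous_intros k continuous_on_perturbation[OF B] that)
  obtain u v where u: "continuous_on {a..b} u" "u ` {a..b} \<subseteq> closure D" "Rel u v"
      "\<And>t. t \<in> {a..b} \<Longrightarrow> v t = u t"
  proof (rule volterra_fixpoint[of "closure D" x a b Rel L])
    show "\<exists>v. continuous_on {a..b} v \<and> v ` {a..b} \<subseteq> closure D \<and> Rel u v"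
      if u: "continuous_on {a..b} u" "u ` {a..b} \<subseteq> closure D" for u
      using mild_exists[OF cB[OF u] x ab] mildD(1,2) unfolding Rel_def by (metis image_subsetI)
    show "0 \<le> L" using \<beta> by (simp add: L_def)
    fix u u' v v' t
    assume u: "continuous_on {a..b} u" "u ` {a..b} \<subseteq> closure D"
      and u': "continuous_on {a..b} u'" "u' ` {a..b} \<subseteq> closure D"
      and r: "Rel u v" "Rel u' v'" and t: "t \<in> {a..b}"
    have sub: "{a..t} \<subseteq> {a..b}" using t by auto
    define g where "g s = B s (u s) + k s - (B s (u' s) + k s)" for s
    have cg: "continuous_on {a..b} g" unfolding g_def by (intro continuous_intros cB u u')
    have "mild a b (x - x) g (\<lambda>s. v s - v' s)"
      unfolding g_def by (rule mild_diff[OF r[unfolded Rel_def] cB[OF u] cB[OF u']])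
    from mild_estimate[OF this cg t]
    have "exp (- 2 * \<omega> * (t - a)) * norm (v t - v' t)
        \<le> 2 * M\<^sup>2 * integral {a..t} (\<lambda>s. exp (- 2 * \<omega> * (s - a)) * norm (g s))" by simp
    also have "\<dots> \<le> 2 * M\<^sup>2 * integral {a..t} (\<lambda>s. \<beta> * norm (u s - u' s))"
    proof (intro mult_left_mono integral_le)
      show "(\<lambda>s. exp (- 2 * \<omega> * (s - a)) * norm (g s)) integrable_on {a..t}"
        by (intro integrable_continuous_interval continuous_on_subset[OF _ sub] continuous_intros cg)
      show "(\<lambda>s. \<beta> * norm (u s - u' s)) integrable_on {a..t}"
        by (intro integrable_continuous_interval continuous_on_subset[OF _ sub] continuous_intros u u')
      fix s assume s: "s \<in> {a..t}"
      hence us: "u s \<in> closure D" "u' s \<in> closure D" using u u' sub by auto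
      have "g s = B s (u s - u' s)" by (simp add: g_def perturbation_diff[OF B us])
      hence "norm (g s) \<le> \<beta> * norm (u s - u' s)"
        using perturbation_bound[OF B closure_D_diff[OF us]] by simp
      hence "exp (- 2 * \<omega> * (s - a)) * norm (g s) \<le> 1 * (\<beta> * norm (u s - u' s))"
        using s \<omega>_nonneg by (intro mult_mono) auto
      thus "exp (- 2 * \<omega> * (s - a)) * norm (g s) \<le> \<beta> * norm (u s - u' s)" by simp
    qed auto
    finally have *: "exp (- 2 * \<omega> * (t - a)) * norm (v t - v' t)
      \<le> 2 * M\<^sup>2 * (\<beta> * integral {a..t} (\<lambda>s. norm (u s - u' s)))" by simp
    have "norm (v t - v' t) = exp (2 * \<omega> * (t - a)) * (exp (- 2 * \<omega> * (t - a)) * norm (v t - v' t))"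
      by (simp add: exp_minus)
    also have "\<dots> \<le> exp (2 * \<omega> * (b - a)) * (2 * M\<^sup>2 * (\<beta> * integral {a..t} (\<lambda>s. norm (u s - u' s))))"
    proof (rule mult_mono[OF _ *])
      show "exp (2 * \<omega> * (t - a)) \<le> exp (2 * \<omega> * (b - a))" using t \<omega>_nonneg by (simp add: mult_left_mono)
    qed auto
    also have "\<dots> = L * integral {a..t} (\<lambda>s. norm (u s - u' s))" by (simp add: L_def mult_ac)
    finally show "norm (v t - v' t) \<le> L * integral {a..t} (\<lambda>s. norm (u s - u' s))" .
  qed (use x in auto)
  have "mild a b x (\<lambda>s. B s (v s) + k s) v"
    by (rule mild_cong[OF u(3)[unfolded Rel_def]]) (use u(4) in auto)
  thus ?thesis by blast
qed

lemma mild_unique_perturbed: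
  assumes B: "perturbation B \<beta>" and k: "continuous_on {a..b} k"
    and v: "mild a b x (\<lambda>s. B s (v s) + k s) v" and w: "mild a b x (\<lambda>s. B s (w s) + k s) w"
    and t: "t \<in> {a..b}"
  shows "v t = w t"
  using mild_bound_perturbed[OF B mild_diff_perturbed[OF B v w k k] _ _ _ t, of 0]
  by (simp add: k)

text \<open>Well defined because mild solutions on \<open>[s, t]\<close> exist and are unique.\<close>

definition evol :: "(real \<Rightarrow> 'a \<Rightarrow> 'a) \<Rightarrow> real \<Rightarrow> real \<Rightarrow> 'a \<Rightarrow> 'a" where
  "evol B t s x = (SOME y. \<exists>v. mild s t x (\<lambda>r. B r (v r)) v \<and> y = v t)"

lemma continuous_on_mild_forcing:
  assumes "perturbation B \<beta>" and "mild a b x f v"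
  shows "continuous_on {a..b} (\<lambda>s. B s (v s))"
  using mildD(2)[OF assms(2)]
  by (intro continuous_on_perturbation[OF assms(1) mildD(1)[OF assms(2)]]) auto

lemma evol_eqI:
  assumes B: "perturbation B \<beta>" and v: "mild a b x (\<lambda>r. B r (v r)) v" and t: "t \<in> {a..b}"
  shows "evol B t a x = v t"
proof -
  have "mild a t x (\<lambda>r. B r (v r)) v"
    using mild_restrict[OF v continuous_on_mild_forcing[OF B v], of a t] mild_start[OF v] t by simp
  hence vt: "mild a t x (\<lambda>r. B r (v r) + 0) v" by simp
  show ?thesis unfolding evol_def
  proof (rule some_equality)
    show "\<exists>w. mild a t x (\<lambda>r. B r (w r)) w \<and> v t = w t" using vt by auto
    fix y assume "\<exists>w. mild a t x (\<lambda>r. B r (w r)) w \<and> y = w t"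
    then obtain w where w: "mild a t x (\<lambda>r. B r (w r) + 0) w" "y = w t" by auto
    show "y = v t" unfolding w(2) by (rule mild_unique_perturbed[OF B _ w(1) vt]) (use t in auto)
  qed
qed

lemma evol_mild:
  assumes B: "perturbation B \<beta>" and x: "x \<in> closure D" and ab: "a \<le> b"
  shows "mild a b x (\<lambda>r. B r (evol B r a x)) (\<lambda>r. evol B r a x)"
proof -
  obtain v where "mild a b x (\<lambda>r. B r (v r) + 0) v"
    using mild_exists_perturbed[OF B _ x ab, of "\<lambda>_. 0"] by auto
  hence v: "mild a b x (\<lambda>r. B r (v r)) v" by simp
  show ?thesis by (rule mild_cong[OF v]) (simp_all add: evol_eqI[OF B v])
qed

section \<open>Algebraic laws and growth of the evolution family\<close>

lemma evol_refl: "perturbation B \<beta> \<Longrightarrow> x \<in> closure D \<Longrightarrow> evol B s s x = x"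
  using mild_start[OF evol_mild[of B \<beta> x s s]] by simp

lemma evol_closure: "perturbation B \<beta> \<Longrightarrow> x \<in> closure D \<Longrightarrow> s \<le> t \<Longrightarrow> evol B t s x \<in> closure D"
  using mildD(2)[OF evol_mild[of B \<beta> x s t], of t] by simp

lemma evol_cocycle:
  assumes B: "perturbation B \<beta>" and x: "x \<in> closure D" and rst: "r \<le> s" "s \<le> t"
  shows "evol B t s (evol B s r x) = evol B t r x"
proof -
  have rt: "r \<le> t" using rst by simp
  note m = evol_mild[OF B x rt]
  show ?thesis
    by (rule evol_eqI[OF B mild_restrict[OF m continuous_on_mild_forcing[OF B m], of s t]]) (use rst in auto)
qed

lemma evol_scale:
  assumes B: "perturbation B \<beta>" and x: "x \<in> closure D" and st: "s \<le> t"
  shows "evol B t s (c *\<^sub>R x) = c *\<^sub>R evol B t s x"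
proof -
  note m = evol_mild[OF B x st]
  have "mild s t (c *\<^sub>R x) (\<lambda>r. B r (c *\<^sub>R evol B r s x)) (\<lambda>r. c *\<^sub>R evol B r s x)"
    by (rule mild_cong[OF mild_scale[OF m]]) (simp_all add: perturbation_scale[OF B] evol_closure[OF B x])
  from evol_eqI[OF B this] show ?thesis using st by simp
qed

lemma evol_add:
  assumes B: "perturbation B \<beta>" and x: "x \<in> closure D" and y: "y \<in> closure D" and st: "s \<le> t"
  shows "evol B t s (x + y) = evol B t s x + evol B t s y"
proof -
  note m = evol_mild[OF B x st] and n = evol_mild[OF B y st]
  have "mild s t (x + y) (\<lambda>r. B r (evol B r s x + evol B r s y)) (\<lambda>r. evol B r s x + evol B r s y)"
    by (rule mild_cong[OF mild_add[OF m n continuous_on_mild_forcing[OF B m] continuous_on_mild_forcing[OF B n]]])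
      (simp_all add: perturbation_add[OF B] evol_closure[OF B x] evol_closure[OF B y])
  from evol_eqI[OF B this] show ?thesis using st by simp
qed

lemma evol_diff:
  assumes B: "perturbation B \<beta>" and x: "x \<in> closure D" and y: "y \<in> closure D" and st: "s \<le> t"
  shows "evol B t s (x - y) = evol B t s x - evol B t s y"
  using evol_add[OF B x closure_D_scale[OF y, of "-1"] st]
    evol_scale[OF B y st, of "-1"] by simp

lemma evol_bound:
  assumes B: "perturbation B \<beta>" and x: "x \<in> closure D" and st: "s \<le> t"
  shows "norm (evol B t s x) \<le> 2 * M\<^sup>2 * exp (growth \<beta> * (t - s)) * norm x"
  using mild_bound_perturbed[OF B, of s t x "\<lambda>r. evol B r s x" "\<lambda>_. 0" 0 t] evol_mild[OF B x st] st
  by (simp add: mult_ac)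

text \<open>One constant serves all pairs of times whose distance is at most T, wherever they lie on
  the line.\<close>

lemma evol_bound_local:
  assumes B: "perturbation B \<beta>"
  obtains C where "0 < C"
    "\<And>x s t. x \<in> closure D \<Longrightarrow> s \<le> t \<Longrightarrow> t - s \<le> T \<Longrightarrow> norm (evol B t s x) \<le> C * norm x"
proof
  show "0 < 2 * M\<^sup>2 * exp (growth \<beta> * T)" using M_ge_1 by simp
  fix x s t assume x: "x \<in> closure D" and st: "s \<le> t" "t - s \<le> T"
  have "growth \<beta> * (t - s) \<le> growth \<beta> * T"
    using st \<omega>_nonneg perturbation_nonneg[OF B] by (intro mult_left_mono) auto
  hence "2 * M\<^sup>2 * exp (growth \<beta> * (t - s)) * norm x
      \<le> 2 * M\<^sup>2 * exp (growth \<beta> * T) * norm x"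
    by (intro mult_right_mono mult_left_mono) auto
  thus "norm (evol B t s x) \<le> 2 * M\<^sup>2 * exp (growth \<beta> * T) * norm x"
    using evol_bound[OF B x st(1)] by linarith
qed

section \<open>Continuity of the evolution family\<close>

text \<open>The orbit is compared with the constant y, which solves the same equation with the extra
  forcing -A y - B r y. The resulting Lipschitz bound depends on t - s only.\<close>

lemma evol_regular_bound:
  assumes B: "perturbation B \<beta>" and y: "y \<in> D" and st: "s \<le> t"
  shows "norm (evol B t s y - y) \<le> 2 * M\<^sup>2 * ((t - s) * (norm (A y) + \<beta> * norm y))
    * exp (growth \<beta> * (t - s))"
proof -
  have y': "y \<in> closure D" using y closure_subset by blast
  have cy: "continuous_on {s..t} (\<lambda>r. B r y)"
    using y' by (intro continuous_on_perturbation[OF B]) auto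
  have 1: "mild s t y (\<lambda>r. B r (evol B r s y) + 0) (\<lambda>r. evol B r s y)"
    using evol_mild[OF B y' st] by simp
  have 2: "mild s t y (\<lambda>r. B r y + (- A y - B r y)) (\<lambda>_. y)" using mild_const[OF y] by simp
  have cg: "continuous_on {s..t} (\<lambda>r. 0 - (- A y - B r y))" by (intro continuous_intros cy)
  have "mild s t (y - y) (\<lambda>r. B r (evol B r s y - y) + (0 - (- A y - B r y))) (\<lambda>r. evol B r s y - y)"
    by (rule mild_diff_perturbed[OF B 1 2]) (intro continuous_intros cy)+
  moreover have "norm (0 - (- A y - B r y)) \<le> norm (A y) + \<beta> * norm y" for r
    using norm_triangle_ineq[of "A y" "B r y"] perturbation_bound[OF B y', of r] by (simp add: add.commute)
  moreover have "0 \<le> norm (A y) + \<beta> * norm y" using perturbation_nonneg[OF B] by simp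
  ultimately have "norm (evol B t s y - y) \<le> 2 * M\<^sup>2 * (norm (y - y) + (t - s) * (norm (A y) + \<beta> * norm y))
    * exp (growth \<beta> * (t - s))"
    using st by (intro mild_bound_perturbed[OF B _ cg]) auto
  thus ?thesis by simp
qed

text \<open>Continuity in t is continuity of a mild solution. For s, the cocycle law shifts the
  difference to U(t,s') applied to U(s',s) y - y, which \<open>evol_regular_bound\<close>
  controls.\<close>

lemma continuous_evol_regular:
  assumes B: "perturbation B \<beta>" and y: "y \<in> D" and t0: "s0 \<le> t0" and e: "0 < e"
  shows "\<exists>d>0. \<forall>t s. s \<le> t \<and> \<bar>t - t0\<bar> < d \<and> \<bar>s - s0\<bar> < d \<longrightarrow> norm (evol B t s y - evol B t0 s0 y) < e"
proof -
  have y': "y \<in> closure D" using y closure_subset by blast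
  have \<beta>: "0 \<le> \<beta>" by (rule perturbation_nonneg[OF B])
  \<comment> \<open>Both times will move by less than 1, so t - s grows by at most 2.\<close>
  define T where "T = t0 - s0 + 2"
  obtain C where C: "0 < C"
    "\<And>x s t. x \<in> closure D \<Longrightarrow> s \<le> t \<Longrightarrow> t - s \<le> T \<Longrightarrow> norm (evol B t s x) \<le> C * norm x"
    using evol_bound_local[OF B] by blast
  define K where "K = 2 * M\<^sup>2 * (norm (A y) + \<beta> * norm y) * exp (growth \<beta> * T)"
  have K0: "0 \<le> K" using \<beta> by (simp add: K_def)
  have K: "norm (evol B t s y - y) \<le> K * (t - s)" if "s \<le> t" "t - s \<le> T" for s t
  proof -
    have "growth \<beta> * (t - s) \<le> growth \<beta> * T"
      using that \<omega>_nonneg \<beta> by (intro mult_left_mono) auto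
    hence "2 * M\<^sup>2 * ((t - s) * (norm (A y) + \<beta> * norm y)) * exp (growth \<beta> * (t - s))
      \<le> 2 * M\<^sup>2 * ((t - s) * (norm (A y) + \<beta> * norm y)) * exp (growth \<beta> * T)"
      using that \<omega>_nonneg \<beta> by (intro mult_left_mono) auto
    thus ?thesis using evol_regular_bound[OF B y that(1)] by (simp add: K_def mult_ac)
  qed
  have shift: "norm (evol B t s y - evol B t s' y) \<le> C * K * (s' - s)" if "s \<le> s'" "s' \<le> t" "t - s \<le> T" for s s' t
  proof -
    have cl: "evol B s' s y \<in> closure D" by (rule evol_closure[OF B y' that(1)])
    have "evol B t s y - evol B t s' y = evol B t s' (evol B s' s y - y)"
      using evol_cocycle[OF B y' that(1,2)] evol_diff[OF B cl y' that(2)] by simp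
    also have "norm \<dots> \<le> C * norm (evol B s' s y - y)"
      using that by (intro C closure_D_diff[OF cl y']) auto
    also have "\<dots> \<le> C * (K * (s' - s))" using K[of s s'] that C(1) by (intro mult_left_mono) auto
    finally show ?thesis by (simp add: mult_ac)
  qed
  have "continuous_on {s0..t0 + 1} (\<lambda>t. evol B t s0 y)"
    using mildD(1)[OF evol_mild[OF B y', of s0 "t0 + 1"]] t0 by simp
  then obtain d1 where d1: "0 < d1"
      "\<And>t. t \<in> {s0..t0 + 1} \<Longrightarrow> dist t t0 < d1 \<Longrightarrow> dist (evol B t s0 y) (evol B t0 s0 y) < e / 2"
    using e t0 unfolding continuous_on_iff by (metis atLeastAtMost_iff half_gt_zero less_eq_real_def less_add_one)
  define q where "q = C * K + K + 1"
  define d where "d = min (min d1 1) (e / (2 * q))"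
  have q: "0 < q" using C(1) K0 by (simp add: q_def add_nonneg_pos)
  have d: "0 < d" "d \<le> d1" "d \<le> 1" using d1(1) e q by (auto simp: d_def)
  have "q * d \<le> q * (e / (2 * q))" using q by (intro mult_left_mono) (auto simp: d_def)
  also have "\<dots> = e / 2" using q by simp
  finally have qd: "q * d \<le> e / 2" .
  show ?thesis
  proof (intro exI conjI allI impI)
    show "0 < d" by (rule d)
    fix t s assume ts: "s \<le> t \<and> \<bar>t - t0\<bar> < d \<and> \<bar>s - s0\<bar> < d"
    hence T: "t - s \<le> T" "t - s0 \<le> T" using d(3) by (auto simp: T_def)
    show "norm (evol B t s y - evol B t0 s0 y) < e"
    proof (cases "s0 \<le> t")
      case True
      have "norm (evol B t s y - evol B t s0 y) \<le> C * K * \<bar>s - s0\<bar>"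
        using shift[of s s0 t] shift[of s0 s t] True ts T
        by (cases "s \<le> s0") (auto simp: norm_minus_commute)
      also have "\<dots> \<le> C * K * d" using ts C(1) K0 by (intro mult_left_mono) auto
      also have "\<dots> \<le> q * d" using K0 d(1) by (intro mult_right_mono) (auto simp: q_def)
      finally have 1: "norm (evol B t s y - evol B t s0 y) \<le> e / 2" using qd by linarith
      have "norm (evol B t s0 y - evol B t0 s0 y) < e / 2"
        using d1(2)[of t] True ts d by (auto simp: dist_norm)
      thus ?thesis
        using 1 norm_triangle_ineq[of "evol B t s y - evol B t s0 y" "evol B t s0 y - evol B t0 s0 y"] by simp
    next
      case False
      have "norm (evol B t s y - y) \<le> K * (t - s)" using ts T by (intro K) auto
      moreover have "norm (evol B t0 s0 y - y) \<le> K * (t0 - s0)" using t0 by (intro K) (auto simp: T_def)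
      ultimately have "norm (evol B t s y - evol B t0 s0 y) \<le> K * (t - s) + K * (t0 - s0)"
        using norm_triangle_ineq4[of "evol B t s y - y" "evol B t0 s0 y - y"] by simp
      also have "\<dots> = K * ((t - s) + (t0 - s0))" by (simp add: algebra_simps)
      also have "\<dots> \<le> K * (2 * d)" using ts False K0 by (intro mult_left_mono) auto
      also have "\<dots> < e"
      proof -
        have "K * d < q * d" using C(1) K0 d(1)
          by (intro mult_strict_right_mono) (auto simp: q_def add_nonneg_pos)
        thus ?thesis using qd by simp
      qed
      finally show ?thesis .
    qed
  qed
qed

text \<open>The local bound extends continuity from y in D to its closure, jointly with the initial
  vector.\<close>

lemma continuous_on_evol:
  assumes B: "perturbation B \<beta>"
  shows "continuous_on {(t, s, x). s \<le> t \<and> x \<in> closure D} (\<lambda>(t, s, x). evol B t s x)"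
  unfolding continuous_on_iff
proof (intro ballI allI impI)
  fix p :: "real \<times> real \<times> 'a" and e :: real
  assume p: "p \<in> {(t, s, x). s \<le> t \<and> x \<in> closure D}" and e: "0 < e"
  obtain t0 s0 x0 where pp: "p = (t0, s0, x0)" by (metis prod_cases3)
  have st: "s0 \<le> t0" and x0: "x0 \<in> closure D" using p pp by auto
  obtain C where C: "0 < C" "\<And>x s t. x \<in> closure D \<Longrightarrow> s \<le> t \<Longrightarrow> t - s \<le> t0 - s0 + 2 \<Longrightarrow>
      norm (evol B t s x) \<le> C * norm x"
    using evol_bound_local[OF B] by blast
  \<comment> \<open>The vector x is within 2 r of y and x0 within r, so the three errors are at most
    e/3, e/6 and e/3.\<close>
  define r where "r = e / (6 * C)"
  have r: "0 < r" "C * r = e / 6" using e C by (auto simp: r_def)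
  obtain y where y: "y \<in> D" "dist y x0 < r" using x0 r unfolding closure_approachable by blast
  have y': "y \<in> closure D" using y closure_subset by blast
  obtain d where d: "0 < d" "\<And>t s. s \<le> t \<Longrightarrow> \<bar>t - t0\<bar> < d \<Longrightarrow> \<bar>s - s0\<bar> < d \<Longrightarrow>
      norm (evol B t s y - evol B t0 s0 y) < e / 3"
    using continuous_evol_regular[OF B y(1) st, of "e / 3"] e by auto
  show "\<exists>d>0. \<forall>z\<in>{(t, s, x). s \<le> t \<and> x \<in> closure D}. dist z p < d \<longrightarrow>
     dist (case z of (t, s, x) \<Rightarrow> evol B t s x) (case p of (t, s, x) \<Rightarrow> evol B t s x) < e"
  proof (intro exI conjI ballI impI)
    show "0 < min (min d 1) r" using d r by simp
    fix z assume z: "z \<in> {(t, s, x). s \<le> t \<and> x \<in> closure D}" "dist z p < min (min d 1) r"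
    obtain t s x where zz: "z = (t, s, x)" by (metis prod_cases3)
    have ts: "s \<le> t" and x: "x \<in> closure D" using z(1) zz by simp_all
    have dt: "dist t t0 < min (min d 1) r" and "dist (s, x) (s0, x0) < min (min d 1) r"
      using z(2) dist_fst_le[of z "(t0, s0, x0)"] dist_snd_le[of z "(t0, s0, x0)"]
      unfolding zz pp by auto
    hence ds: "dist s s0 < min (min d 1) r" and dx: "dist x x0 < min (min d 1) r"
      using dist_fst_le[of "(s, x)" "(s0, x0)"] dist_snd_le[of "(s, x)" "(s0, x0)"] by auto
    have T: "t - s \<le> t0 - s0 + 2" using dt ds by (auto simp: dist_real_def)
    have "norm (x - y) \<le> 2 * r"
      using dx y(2) dist_triangle[of x y x0] by (simp add: dist_norm dist_commute norm_minus_commute)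
    hence "C * norm (x - y) \<le> C * (2 * r)" using C(1) by (intro mult_left_mono) auto
    moreover have "norm (evol B t s (x - y)) \<le> C * norm (x - y)"
      by (intro C closure_D_diff[OF x y'] ts T)
    ultimately have 1: "norm (evol B t s (x - y)) \<le> e / 3" using r by simp
    have "C * norm (x0 - y) \<le> C * r"
      using C(1) y(2) by (intro mult_left_mono) (auto simp: dist_norm norm_minus_commute)
    moreover have "norm (evol B t0 s0 (x0 - y)) \<le> C * norm (x0 - y)"
      by (intro C closure_D_diff[OF x0 y'] st) auto
    ultimately have 2: "norm (evol B t0 s0 (x0 - y)) \<le> e / 6" using r by simp
    have 3: "norm (evol B t s y - evol B t0 s0 y) < e / 3"
      using dt ds ts by (intro d) (auto simp: dist_real_def)
    define p1 p2 p3 where "p1 = evol B t s (x - y)" and "p2 = evol B t s y - evol B t0 s0 y"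
      and "p3 = evol B t0 s0 (x0 - y)"
    have "evol B t s x - evol B t0 s0 x0 = p1 + p2 - p3"
      unfolding p1_def p2_def p3_def using evol_diff[OF B x y' ts] evol_diff[OF B x0 y' st] by simp
    hence "norm (evol B t s x - evol B t0 s0 x0) \<le> norm p1 + norm p2 + norm p3"
      using norm_triangle_ineq4[of "p1 + p2" p3] norm_triangle_ineq[of p1 p2] by simp
    hence "norm (evol B t s x - evol B t0 s0 x0) < e"
      using 1 2 3 e unfolding p1_def p2_def p3_def by linarith
    thus "dist (case z of (t, s, x) \<Rightarrow> evol B t s x)
        (case p of (t, s, x) \<Rightarrow> evol B t s x) < e"
      by (simp add: zz pp dist_norm)
  qed
qed

lemma continuous_on_evol_compose:
  assumes B: "perturbation B \<beta>" and "continuous_on S f" "continuous_on S g" "continuous_on S h"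
    and "\<And>z. z \<in> S \<Longrightarrow> g z \<le> f z" "\<And>z. z \<in> S \<Longrightarrow> h z \<in> closure D"
  shows "continuous_on S (\<lambda>z. evol B (f z) (g z) (h z))"
proof -
  have "continuous_on S (\<lambda>z. (f z, g z, h z))" by (intro continuous_intros assms)
  from continuous_on_compose2[OF continuous_on_evol[OF B] this] show ?thesis using assms by auto
qed

lemma mild_solution_iff:
  "mild_solution D A B a x u \<longleftrightarrow> (\<forall>b. mild a b x (\<lambda>s. B s (u s)) u)"
proof
  assume "mild_solution D A B a x u"
  thus "\<forall>b. mild a b x (\<lambda>s. B s (u s)) u"
    unfolding mild_solution_def mild_def
    by (auto intro: continuous_on_subset)
next
  assume m: "\<forall>b. mild a b x (\<lambda>s. B s (u s)) u"
  have "continuous_on {a..} u" unfolding continuous_on_eq_continuous_within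
  proof
    fix t assume t: "t \<in> {a..}"
    have "at t within {a..} = at t within {a..t + 1}"
      by (rule at_within_nhd[of _ "{..<t + 1}"]) auto
    moreover have "continuous (at t within {a..t + 1}) u"
      using mildD(1)[OF m[rule_format, of "t + 1"]] t
      by (auto simp: continuous_on_eq_continuous_within)
    ultimately show "continuous (at t within {a..}) u" by simp
  qed
  moreover have "u t \<in> closure D \<and> integral {a..t} u \<in> D \<and>
      u t = x + A (integral {a..t} u) + integral {a..t} (\<lambda>s. B s (u s))" if "a \<le> t" for t
    using mildD(2-4)[OF m[rule_format, of t], of t] that by auto
  ultimately show "mild_solution D A B a x u" unfolding mild_solution_def by blast
qed

lemma evolution_family_of_evol:
  assumes B: "perturbation B \<beta>"
  shows "evolution_family_of D A B (evol B)"
proof -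
  define K where "K = 2 * M\<^sup>2"
  define w where "w = 2 * \<omega> + 2 * M\<^sup>2 * \<beta>"
  have bd: "norm (evol B t s x) \<le> K * exp (w * (t - s)) * norm x" if "x \<in> closure D" "s \<le> t" for s t x
    unfolding K_def w_def by (rule evol_bound[OF B that])
  have "bounded_linear_on (closure D) (evol B t s)" if "s \<le> t" for t s
    unfolding bounded_linear_on_def linear_operator_def
    using bd that evol_add[OF B] evol_scale[OF B] subspace_closure_D by blast
  moreover have "continuous_on {(t, s). s \<le> t} (\<lambda>(t, s). evol B t s x)" if "x \<in> closure D" for x
    unfolding case_prod_beta'
    by (rule continuous_on_evol_compose[OF B]) (auto intro!: continuous_intros simp: that)
  ultimately have 1: "evolution_family (closure D) (evol B)"
    unfolding evolution_family_def
    using evol_closure[OF B] evol_refl[OF B] evol_cocycle[OF B] by auto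
  have "onorm_on (closure D) (evol B t s) \<le> K * exp (w * (t - s))" if st: "s \<le> t" for t s
    unfolding onorm_on_def
  proof (rule cSUP_least)
    show "closure D \<noteq> {}" using zero_D by auto
    fix x assume "x \<in> closure D"
    thus "norm (evol B t s x) / norm x \<le> K * exp (w * (t - s))"
      using bd[OF _ st, of x] by (cases "x = 0") (auto simp: divide_le_eq K_def)
  qed
  hence 2: "exponentially_bounded (closure D) (evol B)"
    unfolding exponentially_bounded_def by blast
  have "mild_solution D A B a x u \<longleftrightarrow> (\<forall>t\<ge>a. u t = evol B t a x)" if x: "x \<in> closure D" for a x u
  proof
    assume "mild_solution D A B a x u"
    hence m: "mild a b x (\<lambda>s. B s (u s)) u" for b by (simp add: mild_solution_iff)
    show "\<forall>t\<ge>a. u t = evol B t a x" by (auto intro!: evol_eqI[OF B m, symmetric])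
  next
    assume u: "\<forall>t\<ge>a. u t = evol B t a x"
    have "mild a b x (\<lambda>s. B s (u s)) u" for b
    proof (cases "a \<le> b")
      case True
      show ?thesis by (rule mild_cong[OF evol_mild[OF B x True]]) (use u in auto)
    qed (auto simp: mild_def)
    thus "mild_solution D A B a x u" by (simp add: mild_solution_iff)
  qed
  with 1 2 show ?thesis unfolding evolution_family_of_def by blast
qed

section \<open>The variation of constants formula\<close>

text \<open>Over a short step the effect of the forcing is (s' - s) k s up to higher order. The
  function (r - s) k s is itself a mild solution for an explicit forcing, because k s lies in D.
  Only forcings are therefore compared.\<close>

lemma duhamel_step:
  assumes B: "perturbation B \<beta>" and k: "continuous_on {a..b} k" "\<And>s. s \<in> {a..b} \<Longrightarrow> k s \<in> D"
    and w: "mild a b x (\<lambda>s. B s (w s) + k s) w"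
    and s: "a \<le> s" "s \<le> s'" "s' \<le> b"
    and \<eta>: "\<And>r. r \<in> {s..s'} \<Longrightarrow> norm (k r - k s) \<le> \<eta>" and c: "norm (A (k s)) + \<beta> * norm (k s) \<le> c"
  shows "norm (w s' - evol B s' s (w s) - (s' - s) *\<^sub>R k s)
    \<le> 2 * M\<^sup>2 * ((s' - s) * (\<eta> + (s' - s) * c)) * exp (growth \<beta> * (s' - s))"
proof -
  have ks: "k s \<in> D" using k(2) s by auto
  hence ks': "k s \<in> closure D" using closure_subset by blast
  have sub: "{s..s'} \<subseteq> {a..b}" using s by auto
  have ck: "continuous_on {s..s'} k" by (rule continuous_on_subset[OF k(1) sub])
  have ws: "w s \<in> closure D" using mildD(2)[OF w] s by auto
  have "continuous_on {a..b} (\<lambda>s. B s (w s) + k s)"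
    by (intro continuous_intros continuous_on_mild_forcing[OF B w] k)
  hence 1: "mild s s' (w s) (\<lambda>r. B r (w r) + k r) w" using s by (intro mild_restrict[OF w]) auto
  have 2: "mild s s' (w s) (\<lambda>r. B r (evol B r s (w s)) + 0) (\<lambda>r. evol B r s (w s))"
    using evol_mild[OF B ws s(2)] by simp
  have 3: "mild s s' (w s - w s) (\<lambda>r. B r (w r - evol B r s (w s)) + (k r - 0)) (\<lambda>r. w r - evol B r s (w s))"
    by (rule mild_diff_perturbed[OF B 1 2 ck]) simp
  \<comment> \<open>What must be added to B so that (r - s) k s solves the equation; it deviates
    from k s by a term of order r - s.\<close>
  define l where "l r = k s - (r - s) *\<^sub>R A (k s) - B r ((r - s) *\<^sub>R k s)" for r
  have 4: "mild s s' 0 (\<lambda>r. B r ((r - s) *\<^sub>R k s) + l r) (\<lambda>r. (r - s) *\<^sub>R k s)"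
    by (rule mild_cong[OF mild_integral[OF mild_const[OF ks]]]) (auto simp: l_def)
  have cl: "continuous_on {s..s'} l"
    unfolding l_def using ks'
    by (intro continuous_intros continuous_on_perturbation[OF B])
      (auto intro: closure_D_scale)
  have ck0: "continuous_on {s..s'} (\<lambda>r. k r - 0)" using ck by simp
  have 5: "mild s s' (w s - w s - 0)
     (\<lambda>r. B r (w r - evol B r s (w s) - (r - s) *\<^sub>R k s) + (k r - 0 - l r))
     (\<lambda>r. w r - evol B r s (w s) - (r - s) *\<^sub>R k s)"
    by (rule mild_diff_perturbed[OF B 3 4 ck0 cl])
  have \<eta>0: "0 \<le> \<eta>" using \<eta>[of s] s norm_ge_zero[of "k s - k s"] by auto
  have c0: "0 \<le> c" using c perturbation_nonneg[OF B] by (smt (verit) norm_ge_zero mult_nonneg_nonneg)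
  have bd: "norm (k r - 0 - l r) \<le> \<eta> + (s' - s) * c" if r: "r \<in> {s..s'}" for r
  proof -
    have eq: "k r - 0 - l r = (k r - k s) + (r - s) *\<^sub>R (A (k s) + B r (k s))"
      unfolding l_def perturbation_scale[OF B ks'] by (simp add: algebra_simps)
    have "norm ((k r - k s) + (r - s) *\<^sub>R (A (k s) + B r (k s)))
        \<le> norm (k r - k s) + (r - s) * norm (A (k s) + B r (k s))"
      using norm_triangle_ineq[of "k r - k s" "(r - s) *\<^sub>R (A (k s) + B r (k s))"] r by simp
    hence 1: "norm (k r - 0 - l r) \<le> norm (k r - k s) + (r - s) * norm (A (k s) + B r (k s))"
      unfolding eq .
    have "norm (A (k s) + B r (k s)) \<le> c"
      using norm_triangle_ineq[of "A (k s)" "B r (k s)"] perturbation_bound[OF B ks', of r] c by simp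
    hence "(r - s) * norm (A (k s) + B r (k s)) \<le> (s' - s) * c"
      using r c0 by (intro mult_mono) auto
    thus ?thesis using 1 \<eta>[OF r] by simp
  qed
  have "norm (w s' - evol B s' s (w s) - (s' - s) *\<^sub>R k s)
    \<le> 2 * M\<^sup>2 * (norm (w s - w s - 0) + (s' - s) * (\<eta> + (s' - s) * c)) * exp (growth \<beta> * (s' - s))"
    using \<eta>0 c0 s by (intro mild_bound_perturbed[OF B 5 _ _ bd] continuous_intros ck cl) auto
  thus ?thesis by simp
qed

text \<open>The function s to U(t,s) w(s) goes from 0 at s = a to w(t) at s = t. Continuity of A k
  bounds the second-order error of \<open>duhamel_step\<close> uniformly in s, so the increments
  match those of the integral of \<psi>.\<close>

lemma duhamel:
  assumes B: "perturbation B \<beta>" and k: "continuous_on {a..b} k" "\<And>s. s \<in> {a..b} \<Longrightarrow> k s \<in> D"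
    and Ak: "continuous_on {a..b} (\<lambda>s. A (k s))"
    and w: "mild a b 0 (\<lambda>s. B s (w s) + k s) w" and t: "t \<in> {a..b}"
  shows "w t = integral {a..t} (\<lambda>s. evol B t s (k s))"
proof -
  have \<beta>: "0 \<le> \<beta>" by (rule perturbation_nonneg[OF B])
  have at: "a \<le> t" and sub: "{a..t} \<subseteq> {a..b}" using t by auto
  have kc: "k s \<in> closure D" if "s \<in> {a..b}" for s using k(2)[OF that] closure_subset by blast
  note wc = mildD(2)[OF w]
  define \<phi> where "\<phi> s = evol B t s (w s)" for s
  define \<psi> where "\<psi> s = evol B t s (k s)" for s
  have c\<psi>: "continuous_on {a..t} \<psi>"
    unfolding \<psi>_def using sub kc
    by (intro continuous_on_evol_compose[OF B] continuous_intros continuous_on_subset[OF k(1) sub]) auto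
  define G where "G s = \<phi> s - integral {a..s} \<psi>" for s
  obtain C where C: "0 < C" "\<And>x s t. x \<in> closure D \<Longrightarrow> s \<le> t \<Longrightarrow> t - s \<le> b - a \<Longrightarrow>
      norm (evol B t s x) \<le> C * norm x"
    using evol_bound_local[OF B] by blast
  have "continuous_on {a..b} (\<lambda>s. norm (A (k s)) + \<beta> * norm (k s))"
    by (intro continuous_intros k Ak)
  hence "bounded ((\<lambda>s. norm (A (k s)) + \<beta> * norm (k s)) ` {a..b})"
    by (intro compact_imp_bounded compact_continuous_image) auto
  then obtain c where c: "0 < c" "\<And>s. s \<in> {a..b} \<Longrightarrow> norm (A (k s)) + \<beta> * norm (k s) \<le> c"
    unfolding bounded_pos by (auto simp: abs_le_iff)
  define K where "K = 2 * M\<^sup>2 * exp (growth \<beta> * (b - a))"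
  have K: "0 \<le> K" by (simp add: K_def)
  \<comment> \<open>The slope is taken at the right end s'. By the cocycle law everything then
    factors through U(t,s') and only the one-step error and k s - k s' remain inside.\<close>
  have step: "norm (G s' - G s) \<le> (C * (K * (\<eta> + (s' - s) * c) + \<eta>) + \<eta>') * (s' - s)"
    if s: "a \<le> s" "s \<le> s'" "s' \<le> t" and \<eta>: "\<And>r. r \<in> {s..s'} \<Longrightarrow> norm (k r - k s) \<le> \<eta>"
      and \<eta>': "\<And>r. r \<in> {s..s'} \<Longrightarrow> norm (\<psi> s' - \<psi> r) \<le> \<eta>'" for s s' \<eta> \<eta>'
  proof -
    have sb: "s \<in> {a..b}" "s' \<in> {a..b}" "s' \<le> b" "t - s' \<le> b - a" using s t by auto
    have \<eta>0: "0 \<le> \<eta>" using \<eta>[of s] s norm_ge_zero[of "k s - k s"] by auto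
    define h where "h = s' - s"
    have h: "0 \<le> h" "h \<le> b - a" using s t by (auto simp: h_def)
    define e where "e = w s' - evol B s' s (w s) - h *\<^sub>R k s"
    have ew: "evol B s' s (w s) \<in> closure D" by (rule evol_closure[OF B wc[OF sb(1)] s(2)])
    have ec: "e \<in> closure D" unfolding e_def
      by (intro closure_D_diff closure_D_scale wc kc ew sb)
    have hk: "h *\<^sub>R (k s - k s') \<in> closure D"
      by (intro closure_D_diff closure_D_scale kc sb)
    have "norm e \<le> 2 * M\<^sup>2 * (h * (\<eta> + h * c)) * exp (growth \<beta> * h)"
      unfolding e_def h_def by (rule duhamel_step[OF B k w s(1,2) sb(3) \<eta> c(2)[OF sb(1)]])
    also have "\<dots> \<le> 2 * M\<^sup>2 * (h * (\<eta> + h * c)) * exp (growth \<beta> * (b - a))"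
    proof -
      have "growth \<beta> * h \<le> growth \<beta> * (b - a)"
        using h \<omega>_nonneg \<beta> by (intro mult_left_mono) auto
      thus ?thesis using h \<eta>0 c(1) by (intro mult_left_mono) auto
    qed
    also have "\<dots> = K * (h * (\<eta> + h * c))" by (simp add: K_def)
    finally have e: "norm e \<le> K * (h * (\<eta> + h * c))" .
    have "norm (h *\<^sub>R (k s - k s')) \<le> h * \<eta>"
      using h \<eta>[of s'] s by (simp add: norm_minus_commute mult_left_mono)
    hence "norm (e + h *\<^sub>R (k s - k s')) \<le> K * (h * (\<eta> + h * c)) + h * \<eta>"
      using e by (intro norm_triangle_le) linarith
    hence "C * norm (e + h *\<^sub>R (k s - k s')) \<le> C * (K * (h * (\<eta> + h * c)) + h * \<eta>)"
      using C(1) by (intro mult_left_mono) auto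
    moreover have "norm (evol B t s' (e + h *\<^sub>R (k s - k s'))) \<le> C * norm (e + h *\<^sub>R (k s - k s'))"
      by (intro C closure_D_add[OF ec hk] s sb)
    moreover have "\<phi> s' - \<phi> s - h *\<^sub>R \<psi> s' = evol B t s' (e + h *\<^sub>R (k s - k s'))"
    proof -
      have "e + h *\<^sub>R (k s - k s') = w s' - evol B s' s (w s) - h *\<^sub>R k s'"
        by (simp add: e_def algebra_simps)
      moreover have "evol B t s' (w s' - evol B s' s (w s) - h *\<^sub>R k s')
          = evol B t s' (w s') - evol B t s' (evol B s' s (w s)) - h *\<^sub>R evol B t s' (k s')"
        using ew wc[OF sb(2)] kc[OF sb(2)] s(3)
        by (simp add: evol_diff[OF B] evol_scale[OF B] closure_D_diff
            closure_D_scale)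
      ultimately show ?thesis
        by (simp add: \<phi>_def \<psi>_def evol_cocycle[OF B wc[OF sb(1)] s(2,3)])
    qed
    ultimately have 1: "norm (\<phi> s' - \<phi> s - h *\<^sub>R \<psi> s') \<le> C * (K * (h * (\<eta> + h * c)) + h * \<eta>)" by simp
    have sub': "{s..s'} \<subseteq> {a..t}" using s by auto
    have "integral {a..s'} \<psi> = integral {a..s} \<psi> + integral {s..s'} \<psi>"
      by (rule integral_combine_continuous[OF c\<psi> s])
    moreover have "integral {s..s'} (\<lambda>r. \<psi> s' - \<psi> r) = h *\<^sub>R \<psi> s' - integral {s..s'} \<psi>"
      using s by (subst Henstock_Kurzweil_Integration.integral_diff)
        (auto simp: h_def intro!: integrable_continuous_interval continuous_on_subset[OF c\<psi> sub'])
    moreover have "norm (integral {s..s'} (\<lambda>r. \<psi> s' - \<psi> r)) \<le> \<eta>' * (s' - s)"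
      by (intro integral_bound s \<eta>' continuous_intros continuous_on_subset[OF c\<psi> sub'])
    ultimately have "G s' - G s = (\<phi> s' - \<phi> s - h *\<^sub>R \<psi> s') + integral {s..s'} (\<lambda>r. \<psi> s' - \<psi> r)"
        "norm (integral {s..s'} (\<lambda>r. \<psi> s' - \<psi> r)) \<le> \<eta>' * h"
      by (simp_all add: G_def h_def)
    hence "norm (G s' - G s) \<le> C * (K * (h * (\<eta> + h * c)) + h * \<eta>) + \<eta>' * h"
      using 1 by (metis add_mono norm_triangle_le)
    thus ?thesis by (simp add: h_def[symmetric] algebra_simps)
  qed
  have "G t = G a"
  proof (rule constant_of_small_increments[OF at])
    fix e :: real assume e: "0 < e"
    \<comment> \<open>The oscillation of k, the oscillation of \<psi> and the second-order term each
      receive e/4.\<close>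
    define p \<eta> where "p = C * (K + 1)" and "\<eta> = e / (4 * p)"
    have "0 < p" using C(1) K by (simp add: p_def)
    hence \<eta>: "0 < \<eta>" "p * \<eta> = e / 4" using e by (simp_all add: \<eta>_def)
    obtain d1 where d1: "0 < d1" "\<And>r s. r \<in> {a..b} \<Longrightarrow> s \<in> {a..b} \<Longrightarrow> dist s r < d1 \<Longrightarrow> dist (k s) (k r) < \<eta>"
      using compact_uniformly_continuous[OF k(1)] \<eta>(1) unfolding uniformly_continuous_on_def by auto
    obtain d2 where d2: "0 < d2" "\<And>r s. r \<in> {a..t} \<Longrightarrow> s \<in> {a..t} \<Longrightarrow> dist s r < d2 \<Longrightarrow> dist (\<psi> s) (\<psi> r) < e / 4"
      using compact_uniformly_continuous[OF c\<psi>] e unfolding uniformly_continuous_on_def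
      by (metis compact_Icc divide_pos_pos zero_less_numeral)
    define q where "q = C * K * c + 1"
    have q: "0 < q" using C(1) K c(1) by (simp add: q_def add_nonneg_pos)
    define d where "d = min (min d1 d2) (e / (4 * q))"
    have d: "0 < d" "d \<le> d1" "d \<le> d2" using d1 d2 e q by (auto simp: d_def)
    have "q * d \<le> q * (e / (4 * q))" using q by (intro mult_left_mono) (auto simp: d_def)
    hence qd: "q * d \<le> e / 4" using q by simp
    show "\<exists>d>0. \<forall>s s'. a \<le> s \<longrightarrow> s \<le> s' \<longrightarrow> s' \<le> t \<longrightarrow> s' - s < d \<longrightarrow> norm (G s' - G s) \<le> e * (s' - s)"
    proof (intro exI conjI allI impI)
      show "0 < d" by (rule d)
      fix s s' assume s: "a \<le> s" "s \<le> s'" "s' \<le> t" "s' - s < d"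
      have "norm (G s' - G s) \<le> (C * (K * (\<eta> + (s' - s) * c) + \<eta>) + e / 4) * (s' - s)"
      proof (rule step[OF s(1-3)])
        fix r assume r: "r \<in> {s..s'}"
        show "norm (k r - k s) \<le> \<eta>"
          using d1(2)[of s r] r s d t by (auto simp: dist_norm)
        show "norm (\<psi> s' - \<psi> r) \<le> e / 4"
          using d2(2)[of r s'] r s d t by (auto simp: dist_norm)
      qed
      also have "\<dots> \<le> e * (s' - s)"
      proof (rule mult_right_mono)
        have "C * (K * (\<eta> + (s' - s) * c) + \<eta>) = p * \<eta> + C * K * c * (s' - s)"
          by (simp add: p_def algebra_simps)
        also have "C * K * c * (s' - s) \<le> q * d"
          using s C(1) K c(1) by (intro mult_mono) (auto simp: q_def)
        finally show "C * (K * (\<eta> + (s' - s) * c) + \<eta>) + e / 4 \<le> e" using \<eta>(2) qd e by linarith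
      qed (use s in auto)
      finally show "norm (G s' - G s) \<le> e * (s' - s)" .
    qed
  qed
  moreover have "\<phi> t = w t" unfolding \<phi>_def by (rule evol_refl[OF B wc[OF t]])
  moreover have "w a = 0" using mild_start[OF w] t by simp
  hence "\<phi> a = 0" unfolding \<phi>_def
    using evol_scale[OF B subspace_0[OF subspace_closure_D] at, of 0] by simp
  ultimately show ?thesis by (simp add: G_def \<psi>_def[abs_def])
qed

section \<open>Regularized forcing\<close>

text \<open>\<open>J \<mu>\<close> is bounded and commutes with A on D, so it can be applied to the
  integrated equation term by term.\<close>

lemma mild_J:
  assumes v: "mild a b x f v" and f: "continuous_on {a..b} f" and \<mu>: "\<omega> < \<mu>"
  shows "mild a b (J \<mu> x) (\<lambda>s. J \<mu> (f s)) (\<lambda>s. J \<mu> (v s))"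
  unfolding mild_def
proof (intro conjI ballI)
  interpret J: bounded_linear "J \<mu>" by (rule bounded_linear_J[OF \<mu>])
  note cv = mildD(1)[OF v]
  show "continuous_on {a..b} (\<lambda>s. J \<mu> (v s))" by (rule J.continuous_on[OF cv])
  fix t assume t: "t \<in> {a..b}"
  have sub: "{a..t} \<subseteq> {a..b}" using t by auto
  show "J \<mu> (v t) \<in> closure D" using J_in_D[OF \<mu>] closure_subset by blast
  have i: "integral {a..t} (\<lambda>s. J \<mu> (h s)) = J \<mu> (integral {a..t} h)" if "continuous_on {a..b} h" for h
    by (rule integral_bounded_linear_continuous[OF J.bounded_linear_axioms continuous_on_subset[OF that sub]])
  show "integral {a..t} (\<lambda>s. J \<mu> (v s)) \<in> D" unfolding i[OF cv] by (rule J_in_D[OF \<mu>])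
  show "J \<mu> (v t) = J \<mu> x + A (integral {a..t} (\<lambda>s. J \<mu> (v s))) + integral {a..t} (\<lambda>s. J \<mu> (f s))"
    unfolding i[OF cv] i[OF f] A_J[OF \<mu>] J_A[OF \<mu> mildD(3)[OF v t], symmetric]
    by (subst mildD(4)[OF v t]) (simp add: J.add)
qed

text \<open>With \<open>W\<close> the mild solution for the forcing \<open>J \<mu> g\<close>, the function \<open>W - w - (J \<mu> p - p)\<close>
  has the forcing \<open>B (W - w)\<close>, in which \<open>J \<mu> g - g\<close> no longer occurs.\<close>

lemma yosida_convolution_error:
  assumes B: "perturbation B \<beta>" and g: "continuous_on {a..b} g"
    and p: "mild a b 0 g p" and w: "mild a b 0 (\<lambda>s. B s (w s) + g s) w"
    and \<mu>: "\<omega> < \<mu>" and \<eta>: "\<And>s. s \<in> {a..b} \<Longrightarrow> norm (J \<mu> (p s) - p s) \<le> \<eta>"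
    and t: "t \<in> {a..b}" and T: "b - a \<le> T"
  shows "norm (integral {a..t} (\<lambda>s. evol B t s (J \<mu> (g s))) - w t)
    \<le> (2 * M\<^sup>2 * (T * \<beta>) * exp (growth \<beta> * T) + 1) * \<eta>"
proof -
  have ab: "a \<le> b" using t by simp
  have \<beta>: "0 \<le> \<beta>" by (rule perturbation_nonneg[OF B])
  have \<eta>0: "0 \<le> \<eta>" using \<eta>[OF t] norm_ge_zero order_trans by blast
  have T0: "0 \<le> t - a" "t - a \<le> T" "0 \<le> T" using t T by auto
  have cJ: "continuous_on {a..b} (\<lambda>s. J \<mu> (g s))"
    by (rule bounded_linear.continuous_on[OF bounded_linear_J[OF \<mu>] g])
  have cA: "continuous_on {a..b} (\<lambda>s. A (J \<mu> (g s)))"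
    unfolding A_J[OF \<mu>] by (rule bounded_linear.continuous_on[OF bounded_linear_yosida[OF \<mu>] g])
  obtain W where W: "mild a b 0 (\<lambda>s. B s (W s) + J \<mu> (g s)) W"
    using mild_exists_perturbed[OF B cJ subspace_0[OF subspace_closure_D] ab] by blast
  have Wt: "W t = integral {a..t} (\<lambda>s. evol B t s (J \<mu> (g s)))"
    by (rule duhamel[OF B cJ J_in_D[OF \<mu>] cA W t])
  have cW: "continuous_on {a..b} (\<lambda>s. B s (W s) + J \<mu> (g s))"
    and cw: "continuous_on {a..b} (\<lambda>s. B s (w s) + g s)"
    by (intro continuous_intros continuous_on_mild_forcing[OF B W] continuous_on_mild_forcing[OF B w] cJ g)+
  have 1: "mild a b (0 - 0) (\<lambda>s. B s (W s) + J \<mu> (g s) - (B s (w s) + g s)) (\<lambda>s. W s - w s)"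
    by (rule mild_diff[OF W w cW cw])
  have 2: "mild a b (J \<mu> 0 - 0) (\<lambda>s. J \<mu> (g s) - g s) (\<lambda>s. J \<mu> (p s) - p s)"
    by (rule mild_diff[OF mild_J[OF p g \<mu>] p cJ g])
  have m: "mild a b (0 - 0 - (J \<mu> 0 - 0))
     (\<lambda>s. B s (W s) + J \<mu> (g s) - (B s (w s) + g s) - (J \<mu> (g s) - g s))
     (\<lambda>s. W s - w s - (J \<mu> (p s) - p s))"
    by (intro mild_diff[OF 1 2] continuous_intros cW cw cJ g)
  have "0 - 0 - (J \<mu> 0 - 0) = 0"
    using linear_0[OF bounded_linear.linear[OF bounded_linear_J[OF \<mu>]]] by simp
  note m = m[unfolded this]
  have e: "mild a b 0 (\<lambda>s. B s (W s - w s)) (\<lambda>s. W s - w s - (J \<mu> (p s) - p s))"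
    by (rule mild_cong[OF m]) (simp_all add: perturbation_diff[OF B mildD(2)[OF W] mildD(2)[OF w]])
  have Ww: "W s - w s \<in> closure D" if "s \<in> {a..b}" for s
    by (intro closure_D_diff mildD(2)[OF W that] mildD(2)[OF w that])
  have cB: "continuous_on {a..b} (\<lambda>s. B s (W s - w s))"
    using Ww by (intro continuous_on_perturbation[OF B] continuous_intros mildD(1)[OF W] mildD(1)[OF w]) auto
  have "norm (W t - w t - (J \<mu> (p t) - p t))
      \<le> 2 * M\<^sup>2 * (norm (0::'a) + (t - a) * (\<beta> * \<eta>)) * exp (growth \<beta> * (t - a))"
  proof (rule mild_bound[OF e cB t \<beta>])
    show "0 \<le> \<beta> * \<eta>" using \<beta> \<eta>0 by simp
    fix s assume s: "s \<in> {a..b}"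
    \<comment> \<open>The forcing contains W - w, not the function being estimated. The triangle
      inequality exchanges one for the other at the cost of \<eta>, which is the form that
      \<open>mild_bound\<close> accepts.\<close>
    have "norm (W s - w s) \<le> norm (W s - w s - (J \<mu> (p s) - p s)) + \<eta>"
      using norm_triangle_ineq[of "W s - w s - (J \<mu> (p s) - p s)" "J \<mu> (p s) - p s"] \<eta>[OF s] by simp
    hence "\<beta> * norm (W s - w s) \<le> \<beta> * (norm (W s - w s - (J \<mu> (p s) - p s)) + \<eta>)"
      using \<beta> by (intro mult_left_mono)
    thus "norm (B s (W s - w s)) \<le> \<beta> * norm (W s - w s - (J \<mu> (p s) - p s)) + \<beta> * \<eta>"
      using perturbation_bound[OF B Ww[OF s], of s] by (simp add: algebra_simps)
  qed
  also have "\<dots> \<le> 2 * M\<^sup>2 * (T * (\<beta> * \<eta>)) * exp (growth \<beta> * T)"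
  proof -
    have "growth \<beta> * (t - a) \<le> growth \<beta> * T"
      using T0 \<omega>_nonneg \<beta> by (intro mult_left_mono) auto
    moreover have "(t - a) * (\<beta> * \<eta>) \<le> T * (\<beta> * \<eta>)" using T0 \<beta> \<eta>0 by (intro mult_right_mono) auto
    ultimately show ?thesis using T0 \<beta> \<eta>0 by (intro mult_mono) auto
  qed
  finally have "norm (W t - w t) \<le> 2 * M\<^sup>2 * (T * (\<beta> * \<eta>)) * exp (growth \<beta> * T) + \<eta>"
    using norm_triangle_ineq[of "W t - w t - (J \<mu> (p t) - p t)" "J \<mu> (p t) - p t"] \<eta>[OF t] by simp
  thus ?thesis unfolding Wt by (simp add: algebra_simps)
qed

text \<open>The distance d does not depend on s. This comes from the bounds in t - s alone together
  with density of D, and it makes the finite net of initial times possible.\<close>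

lemma evol_uniformly_strongly_continuous:
  assumes B: "perturbation B \<beta>" and x: "x \<in> closure D" and e: "0 < e"
  shows "\<exists>d>0. \<forall>s t. s \<le> t \<longrightarrow> t - s < d \<longrightarrow> norm (evol B t s x - x) \<le> e"
proof -
  obtain C where C: "0 < C" "\<And>x s t. x \<in> closure D \<Longrightarrow> s \<le> t \<Longrightarrow> t - s \<le> 1 \<Longrightarrow>
      norm (evol B t s x) \<le> C * norm x"
    using evol_bound_local[OF B] by blast
  define q r where "q = C + 1" and "r = e / (2 * q)"
  have r: "0 < r" "q * r = e / 2"
  proof -
    have "0 < q" using C(1) by (simp add: q_def)
    thus "0 < r" "q * r = e / 2" using e by (simp_all add: r_def)
  qed
  obtain y where y: "y \<in> D" "dist y x < r" using x r unfolding closure_approachable by blast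
  have y': "y \<in> closure D" using y closure_subset by blast
  define w where "w = 2 * \<omega> + 2 * M\<^sup>2 * \<beta>"
  have w0: "0 \<le> w" using \<omega>_nonneg perturbation_nonneg[OF B] by (simp add: w_def)
  define K where "K = 2 * M\<^sup>2 * (norm (A y) + \<beta> * norm y) * exp w + 1"
  have K: "0 < K" using perturbation_nonneg[OF B] by (simp add: K_def add_nonneg_pos)
  show ?thesis
  proof (intro exI conjI allI impI)
    show "0 < min 1 (e / (2 * K))" using e K by simp
    fix s t assume st: "s \<le> t" "t - s < min 1 (e / (2 * K))"
    have xy: "x - y \<in> closure D" by (rule closure_D_diff[OF x y'])
    have "w * (t - s) \<le> w" using st w0 by (simp add: mult_left_le)
    hence "2 * M\<^sup>2 * ((t - s) * (norm (A y) + \<beta> * norm y)) * exp (w * (t - s))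
        \<le> 2 * M\<^sup>2 * ((t - s) * (norm (A y) + \<beta> * norm y)) * exp w"
      using st perturbation_nonneg[OF B] by (intro mult_left_mono) auto
    also have "\<dots> \<le> K * (t - s)" using st by (simp add: K_def algebra_simps)
    also have "\<dots> \<le> K * (e / (2 * K))" using st K by (intro mult_left_mono) auto
    also have "\<dots> = e / 2" using K by simp
    finally have 1: "norm (evol B t s y - y) \<le> e / 2"
      using evol_regular_bound[OF B y(1) st(1)] unfolding w_def by linarith
    have "norm (evol B t s (x - y)) \<le> C * norm (x - y)" using st by (intro C xy) auto
    hence "norm (evol B t s (x - y) - (x - y)) \<le> q * norm (x - y)"
      using norm_triangle_ineq4[of "evol B t s (x - y)" "x - y"] by (simp add: q_def algebra_simps)
    also have "\<dots> \<le> q * r"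
      using y(2) C(1) by (intro mult_left_mono) (auto simp: q_def dist_norm norm_minus_commute)
    finally have 2: "norm (evol B t s (x - y) - (x - y)) \<le> e / 2" using r by simp
    have eq: "evol B t s x - x = (evol B t s (x - y) - (x - y)) + (evol B t s y - y)"
      using evol_diff[OF B x y' st(1)] by simp
    show "norm (evol B t s x - x) \<le> e"
      unfolding eq by (rule norm_triangle_le) (use 1 2 in linarith)
  qed
qed



section \<open>Almost periodic coefficients as bounded perturbations\<close>

lemma perturbation_almost_periodic:
  assumes F: "almost_periodic_operators (closure D) F"
  shows "\<exists>\<beta>. perturbation F \<beta>"
proof -
  obtain \<beta> where \<beta>: "0 \<le> \<beta>" "\<And>t x. x \<in> closure D \<Longrightarrow> norm (F t x) \<le> \<beta> * norm x"
    using almost_periodic_operators_bounded[OF F] by blast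
  have bl: "bounded_linear_on (closure D) (F t)" for t
    using F by (simp add: almost_periodic_operators_def)
  have "\<exists>d>0. \<forall>s. \<bar>s - t\<bar> < d \<longrightarrow> (\<forall>x\<in>closure D. norm (F s x - F t x) \<le> e * norm x)" if e: "0 < e" for t e
  proof -
    obtain d where d: "0 < d" "\<And>s. \<bar>s - t\<bar> < d \<Longrightarrow> op_dist (closure D) (F s) (F t) < e"
      using F e unfolding almost_periodic_operators_def almost_periodic_def by blast
    have "norm (F s x - F t x) \<le> e * norm x" if "\<bar>s - t\<bar> < d" "x \<in> closure D" for s x
      using op_dist_bound[OF bl bl that(2), of s t] mult_right_mono[OF less_imp_le[OF d(2)[OF that(1)]], of "norm x"]
      by simp
    thus ?thesis using d(1) by blast
  qed
  thus ?thesis using \<beta> bl unfolding perturbation_def bounded_linear_on_def by blast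
qed

lemma perturbation_minus:
  assumes F: "perturbation F \<beta>" and V: "perturbation V \<gamma>"
  shows "perturbation (\<lambda>s x. F s x - V s x) (\<beta> + \<gamma>)"
  unfolding perturbation_def
proof (intro conjI allI ballI impI)
  show "0 \<le> \<beta> + \<gamma>" using perturbation_nonneg[OF F] perturbation_nonneg[OF V] by simp
  show "linear_operator (closure D) (\<lambda>x. F t x - V t x)" for t
    using F V by (intro linear_operator_diff) (auto simp: perturbation_def)
  show "norm (F t x - V t x) \<le> (\<beta> + \<gamma>) * norm x" if "x \<in> closure D" for t x
    using norm_triangle_ineq4[of "F t x" "V t x"] perturbation_bound[OF F that, of t]
      perturbation_bound[OF V that, of t] by (simp add: algebra_simps)
  fix t and e :: real assume "0 < e"
  hence e: "0 < e / 2" by simp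
  obtain d1 where d1: "0 < d1" "\<And>s x. \<bar>s - t\<bar> < d1 \<Longrightarrow> x \<in> closure D \<Longrightarrow> norm (F s x - F t x) \<le> e / 2 * norm x"
    using F e unfolding perturbation_def by blast
  obtain d2 where d2: "0 < d2" "\<And>s x. \<bar>s - t\<bar> < d2 \<Longrightarrow> x \<in> closure D \<Longrightarrow> norm (V s x - V t x) \<le> e / 2 * norm x"
    using V e unfolding perturbation_def by blast
  have "norm (F s x - V s x - (F t x - V t x)) \<le> e * norm x"
    if "\<bar>s - t\<bar> < min d1 d2" "x \<in> closure D" for s x
    using d1(2)[of s x] d2(2)[of s x] that norm_triangle_ineq4[of "F s x - F t x" "V s x - V t x"]
    by (simp add: algebra_simps)
  thus "\<exists>d>0. \<forall>s. \<bar>s - t\<bar> < d \<longrightarrow> (\<forall>x\<in>closure D. norm (F s x - V s x - (F t x - V t x)) \<le> e * norm x)"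
    using d1(1) d2(1) by (intro exI[of _ "min d1 d2"]) auto
qed

lemma perturbation_zero: "perturbation (\<lambda>_ _. 0) 0"
  unfolding perturbation_def linear_operator_def using subspace_closure_D by (auto intro: exI[of _ 1])

lemma perturbation_uminus:
  assumes "perturbation V \<gamma>"
  shows "perturbation (\<lambda>s x. - V s x) \<gamma>"
  using perturbation_minus[OF perturbation_zero assms] by simp

section \<open>Convergence of the regularized integrals, uniform in both times\<close>

lemma mild_bound_forcing:
  assumes v: "mild a b x f v" and f: "continuous_on {a..b} f" and G: "0 \<le> G"
    and fG: "\<And>s. s \<in> {a..b} \<Longrightarrow> norm (f s) \<le> G" and t: "t \<in> {a..b}" and T: "b - a \<le> T"
  shows "norm (v t) \<le> 2 * M\<^sup>2 * exp (2 * \<omega> * T) * (norm x + (t - a) * G)"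
proof -
  have "2 * \<omega> * (t - a) \<le> 2 * \<omega> * T" using t T \<omega>_nonneg by (intro mult_left_mono) auto
  hence "2 * M\<^sup>2 * (norm x + (t - a) * G) * exp (2 * \<omega> * (t - a))
      \<le> 2 * M\<^sup>2 * (norm x + (t - a) * G) * exp (2 * \<omega> * T)"
    using t G by (intro mult_left_mono) auto
  thus ?thesis using mild_bound[OF v f t, of 0 G] G fG by (simp add: mult_ac)
qed

text \<open>Uniformity in \<open>t\<^sub>0\<close> comes from a finite net of initial times: \<open>P c\<close> stays close to \<open>P t\<^sub>0\<close>
  for \<open>c \<le> t\<^sub>0\<close> near \<open>t\<^sub>0\<close>, and each \<open>P c\<close> has a compact range in \<open>closure D\<close>.\<close>

lemma uniform_limit_yosida_convolution:
  assumes F: "perturbation F \<beta>F" and Bv: "perturbation Bv \<beta>" and Bu: "perturbation Bu \<beta>u"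
    and sum: "\<And>s x. Bu s x = F s x + Bv s x" and x: "x \<in> closure D"
  shows "uniform_limit {(t, t0). a \<le> t0 \<and> t0 \<le> t \<and> t \<le> b}
    (\<lambda>\<mu> (t, t0). integral {t0..t} (\<lambda>s. evol Bv t s (J \<mu> (F s (evol Bu s t0 x)))))
    (\<lambda>(t, t0). evol Bu t t0 x - evol Bv t t0 x) at_top"
proof (cases "a \<le> b")
  case False
  hence "{(t, t0). a \<le> t0 \<and> t0 \<le> t \<and> t \<le> b} = {}" by auto
  thus ?thesis unfolding uniform_limit_iff by (simp only: ball_empty) simp
next
  case ab: True
  define T where "T = b - a"
  have T: "0 \<le> T" using ab by (simp add: T_def)
  have M: "0 < M" using M_ge_1 by simp
  have \<beta>F: "0 \<le> \<beta>F" by (rule perturbation_nonneg[OF F])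
  obtain C where C: "0 < C" "\<And>x s t. x \<in> closure D \<Longrightarrow> s \<le> t \<Longrightarrow> t - s \<le> T \<Longrightarrow>
      norm (evol Bu t s x) \<le> C * norm x"
    using evol_bound_local[OF Bu] by blast
  define g where "g t0 s = F s (evol Bu s t0 x)" for t0 s
  have cg: "continuous_on {t0..b} (g t0)" if "t0 \<le> b" for t0
    unfolding g_def by (rule continuous_on_mild_forcing[OF F evol_mild[OF Bu x that]])
  have "\<exists>p. mild t0 b 0 (g t0) p" if "t0 \<le> b" for t0
    by (rule mild_exists[OF cg[OF that] subspace_0[OF subspace_closure_D] that])
  then obtain P where P: "\<And>t0. t0 \<le> b \<Longrightarrow> mild t0 b 0 (g t0) (P t0)" by metis
  define Gm where "Gm = \<beta>F * (C * norm x)"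
  have Gm: "0 \<le> Gm" using \<beta>F C(1) by (simp add: Gm_def)
  have gb: "norm (g t0 s) \<le> Gm" if "a \<le> t0" "t0 \<le> s" "s \<le> b" for t0 s
  proof -
    have "norm (g t0 s) \<le> \<beta>F * norm (evol Bu s t0 x)"
      unfolding g_def by (intro perturbation_bound[OF F] evol_closure[OF Bu x] that)
    also have "\<dots> \<le> Gm"
      unfolding Gm_def using that \<beta>F by (intro mult_left_mono C x) (auto simp: T_def)
    finally show ?thesis .
  qed
  define E where "E = 2 * M\<^sup>2 * exp (2 * \<omega> * T)"
  have E: "0 < E" using M by (simp add: E_def)
  \<comment> \<open>A solution from 0 is still small shortly after its start; at t0 this is the
    initial gap between \<open>P c\<close> and \<open>P t0\<close>.\<close>
  have Pb: "norm (P c t) \<le> E * ((t - c) * Gm)" if "a \<le> c" "c \<le> t" "t \<le> b" for c t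
  proof -
    have cb: "c \<le> b" using that by simp
    have "norm (P c t) \<le> E * (norm (0::'a) + (t - c) * Gm)"
      unfolding E_def using that
      by (intro mild_bound_forcing[OF P[OF cb] cg[OF cb] Gm]) (auto intro!: gb simp: T_def)
    thus ?thesis by simp
  qed
  \<comment> \<open>On [t0, b] the two solutions differ in their initial value,
    \<open>P c t0\<close> against 0, and in their forcing, by F s applied to U(s,t0)(U(t0,c) x - x).
    Both are small when t0 - c is small.\<close>
  have Pclose: "norm (P t0 t - P c t) \<le> E * (E * ((t0 - c) * Gm) + T * (\<beta>F * (C * \<epsilon>)))"
    if c: "a \<le> c" "c \<le> t0" "t0 \<le> t" "t \<le> b" and \<epsilon>: "norm (evol Bu t0 c x - x) \<le> \<epsilon>" for c t0 t \<epsilon>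
  proof -
    have cb: "c \<le> b" and t0b: "t0 \<le> b" using c by auto
    have \<epsilon>0: "0 \<le> \<epsilon>" using \<epsilon> norm_ge_zero order_trans by blast
    have cg': "continuous_on {t0..b} (g c)"
      by (rule continuous_on_subset[OF cg[OF cb]]) (use c in auto)
    have "mild t0 b (P c t0) (g c) (P c)"
      using c by (intro mild_restrict[OF P[OF cb] cg[OF cb]]) auto
    from mild_diff[OF this P[OF t0b] cg' cg[OF t0b]]
    have m: "mild t0 b (P c t0 - 0) (\<lambda>s. g c s - g t0 s) (\<lambda>s. P c s - P t0 s)" .
    have "norm (P c t - P t0 t) \<le> E * (norm (P c t0 - 0) + (t - t0) * (\<beta>F * (C * \<epsilon>)))"
      unfolding E_def
    proof (rule mild_bound_forcing[OF m])
      show "continuous_on {t0..b} (\<lambda>s. g c s - g t0 s)" by (intro continuous_intros cg' cg t0b)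
      show "0 \<le> \<beta>F * (C * \<epsilon>)" using \<beta>F C(1) \<epsilon>0 by simp
      show "t \<in> {t0..b}" "b - t0 \<le> T" using c by (auto simp: T_def)
      fix s assume s: "s \<in> {t0..b}"
      have cs: "c \<le> s" using c s by simp
      have e1: "evol Bu t0 c x \<in> closure D" by (rule evol_closure[OF Bu x c(2)])
      have e2: "evol Bu s t0 (evol Bu t0 c x - x) = evol Bu s c x - evol Bu s t0 x"
        using s evol_diff[OF Bu e1 x, of t0 s] evol_cocycle[OF Bu x c(2), of s] by simp
      have cl: "evol Bu t0 c x - x \<in> closure D" by (rule closure_D_diff[OF e1 x])
      have "g c s - g t0 s = F s (evol Bu s t0 (evol Bu t0 c x - x))"
        unfolding g_def e2 using s
        by (intro perturbation_diff[OF F, symmetric] evol_closure[OF Bu x] cs) auto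
      also have "norm \<dots> \<le> \<beta>F * norm (evol Bu s t0 (evol Bu t0 c x - x))"
        using s by (intro perturbation_bound[OF F] evol_closure[OF Bu cl]) auto
      also have "\<dots> \<le> \<beta>F * (C * norm (evol Bu t0 c x - x))"
        using s c \<beta>F by (intro mult_left_mono C cl) (auto simp: T_def)
      also have "\<dots> \<le> \<beta>F * (C * \<epsilon>)" using \<beta>F C(1) \<epsilon> by (intro mult_left_mono) auto
      finally show "norm (g c s - g t0 s) \<le> \<beta>F * (C * \<epsilon>)" .
    qed
    also have "\<dots> \<le> E * (E * ((t0 - c) * Gm) + T * (\<beta>F * (C * \<epsilon>)))"
    proof (intro mult_left_mono add_mono mult_right_mono)
      show "norm (P c t0 - 0) \<le> E * ((t0 - c) * Gm)" using Pb[of c t0] c by simp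
    qed (use c T_def E \<beta>F C(1) \<epsilon>0 in auto)
    finally show ?thesis by (simp add: norm_minus_commute)
  qed
  define K where "K = 2 * M\<^sup>2 * (T * \<beta>) * exp (growth \<beta> * T) + 1"
  have K: "1 \<le> K" using T perturbation_nonneg[OF Bv] by (simp add: K_def)
  show ?thesis
  proof (rule uniform_limitI)
    fix e :: real assume e: "0 < e"
    define \<eta> where "\<eta> = e / (2 * K)"
    have \<eta>: "0 < \<eta>" "K * \<eta> < e" using e K by (auto simp: \<eta>_def)
    \<comment> \<open>The tolerances are chosen backwards: \<open>K\<close> \<eta> < e for the final
      error, \<open>q\<close> \<rho> = \<eta>/2 for replacing \<open>P t0\<close> by
      \<open>P c\<close> under \<open>J \<mu>\<close> and the identity, and \<open>k1\<close> d +
      \<open>k2\<close> \<epsilon> \<le> \<rho> for the distance in \<open>Pclose\<close>.\<close>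
    define q \<rho> where "q = 2 * M + 1" and "\<rho> = \<eta> / (2 * q)"
    have "0 < q" using M by (simp add: q_def)
    hence \<rho>: "0 < \<rho>" "q * \<rho> = \<eta> / 2" using \<eta>(1) by (simp_all add: \<rho>_def)
    define k1 k2 where "k1 = E * (E * Gm) + 1" and "k2 = E * (T * (\<beta>F * C)) + 1"
    have k: "0 < k1" "0 < k2" using E Gm T \<beta>F C(1) by (auto simp: k1_def k2_def add_nonneg_pos)
    define \<epsilon> where "\<epsilon> = \<rho> / (2 * k2)"
    have \<epsilon>: "0 < \<epsilon>" "k2 * \<epsilon> = \<rho> / 2" using \<rho>(1) k(2) by (simp_all add: \<epsilon>_def)
    obtain d0 where d0: "0 < d0" "\<And>s t. s \<le> t \<Longrightarrow> t - s < d0 \<Longrightarrow> norm (evol Bu t s x - x) \<le> \<epsilon>"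
      using evol_uniformly_strongly_continuous[OF Bu x \<epsilon>(1)] by blast
    define d where "d = min d0 (\<rho> / (2 * k1))"
    have d: "0 < d" "d \<le> d0" using d0(1) \<rho>(1) k(1) by (auto simp: d_def)
    have "k1 * d \<le> k1 * (\<rho> / (2 * k1))" using k(1) by (intro mult_left_mono) (auto simp: d_def)
    hence kd: "k1 * d \<le> \<rho> / 2" using k(1) by simp
    obtain N where N: "finite N" "N \<subseteq> {a..b}" "\<And>t. t \<in> {a..b} \<Longrightarrow> \<exists>c\<in>N. c \<le> t \<and> t - c < d"
      using finite_left_net[OF d(1)] by blast
    \<comment> \<open>Finitely many continuous curves form one compact set, so a single threshold
      for \<mu> works for all of them.\<close>
    define S where "S = (\<Union>c\<in>N. P c ` {c..b})"
    have cpt: "compact (P c ` {c..b})" if "c \<in> N" for c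
      using that N(2) by (intro compact_continuous_image mildD(1)[OF P]) auto
    have "compact S" unfolding S_def using N(1) cpt by (intro compact_UN) auto
    moreover have "S \<subseteq> closure D" unfolding S_def using N(2) mildD(2)[OF P] by fastforce
    ultimately have "\<forall>\<^sub>F \<mu> in at_top. \<forall>y\<in>S. dist (J \<mu> y) y < \<eta> / 2"
      using \<eta>(1) by (intro uniform_limitD[OF uniform_limit_J]) auto
    thus "\<forall>\<^sub>F \<mu> in at_top. \<forall>z\<in>{(t, t0). a \<le> t0 \<and> t0 \<le> t \<and> t \<le> b}.
       dist (case z of (t, t0) \<Rightarrow> integral {t0..t} (\<lambda>s. evol Bv t s (J \<mu> (F s (evol Bu s t0 x)))))
         (case z of (t, t0) \<Rightarrow> evol Bu t t0 x - evol Bv t t0 x) < e"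
      using eventually_gt_at_top[of \<omega>] eventually_ge_at_top[of "2 * \<omega>"]
    proof eventually_elim
      case (elim \<mu>)
      interpret J: bounded_linear "J \<mu>" by (rule bounded_linear_J[OF elim(2)])
      have Jp: "norm (J \<mu> (P t0 s) - P t0 s) \<le> \<eta>" if t0: "a \<le> t0" "t0 \<le> s" "s \<le> b" for t0 s
      proof -
        obtain c where c: "c \<in> N" "c \<le> t0" "t0 - c < d" using N(3)[of t0] t0 by auto
        have ca: "a \<le> c" using c N by auto
        have "norm (P t0 s - P c s) \<le> E * (E * ((t0 - c) * Gm) + T * (\<beta>F * (C * \<epsilon>)))"
          using c ca t0 d by (intro Pclose d0) auto
        also have "\<dots> = E * (E * Gm) * (t0 - c) + E * (T * (\<beta>F * C)) * \<epsilon>" by (simp add: algebra_simps)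
        also have "\<dots> \<le> k1 * d + k2 * \<epsilon>"
          using c E Gm T \<beta>F C(1) \<epsilon>(1) by (intro add_mono mult_mono) (auto simp: k1_def k2_def)
        finally have close: "norm (P t0 s - P c s) \<le> \<rho>" using kd \<epsilon>(2) by simp
        have "P c s \<in> S" unfolding S_def using c t0 by (intro UN_I[of c]) auto
        hence 1: "norm (J \<mu> (P c s) - P c s) \<le> \<eta> / 2" using elim(1) by (auto simp: dist_norm less_imp_le)
        have eq: "J \<mu> (P t0 s) - P t0 s
            = (J \<mu> (P t0 s - P c s) - (P t0 s - P c s)) + (J \<mu> (P c s) - P c s)"
          by (simp add: J.diff)
        have "norm (J \<mu> (P t0 s - P c s) - (P t0 s - P c s)) \<le> q * norm (P t0 s - P c s)"
          using norm_triangle_ineq4[of "J \<mu> (P t0 s - P c s)" "P t0 s - P c s"]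
            J_bound[OF elim(2,3), of "P t0 s - P c s"] by (simp add: q_def algebra_simps)
        also have "\<dots> \<le> q * \<rho>" using close \<open>0 < q\<close> by (intro mult_left_mono) auto
        finally have 2: "norm (J \<mu> (P t0 s - P c s) - (P t0 s - P c s)) \<le> \<eta> / 2" using \<rho>(2) by simp
        show ?thesis unfolding eq by (rule norm_triangle_le) (use 1 2 in linarith)
      qed
      have "norm (integral {t0..t} (\<lambda>s. evol Bv t s (J \<mu> (g t0 s))) - (evol Bu t t0 x - evol Bv t t0 x)) < e"
        if t: "a \<le> t0" "t0 \<le> t" "t \<le> b" for t t0
      proof -
        have t0b: "t0 \<le> b" using t by simp
        have 1: "mild t0 b x (\<lambda>s. Bv s (evol Bu s t0 x) + g t0 s) (\<lambda>s. evol Bu s t0 x)"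
          by (rule mild_cong[OF evol_mild[OF Bu x t0b]]) (auto simp: g_def sum)
        have 2: "mild t0 b x (\<lambda>s. Bv s (evol Bv s t0 x) + 0) (\<lambda>s. evol Bv s t0 x)"
          using evol_mild[OF Bv x t0b] by simp
        have w: "mild t0 b 0 (\<lambda>s. Bv s (evol Bu s t0 x - evol Bv s t0 x) + g t0 s)
            (\<lambda>s. evol Bu s t0 x - evol Bv s t0 x)"
          using mild_diff_perturbed[OF Bv 1 2 cg[OF t0b]] by simp
        have "norm (integral {t0..t} (\<lambda>s. evol Bv t s (J \<mu> (g t0 s))) - (evol Bu t t0 x - evol Bv t t0 x)) \<le> K * \<eta>"
          unfolding K_def using t
          by (intro yosida_convolution_error[OF Bv cg[OF t0b] P[OF t0b] w elim(2)] Jp) (auto simp: T_def)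
        thus ?thesis using \<eta>(2) by simp
      qed
      thus ?case by (auto simp: g_def dist_norm)
    qed
  qed
qed

section \<open>Continuous dependence on the coefficients\<close>

text \<open>\<delta> must be fixed before B' is known, so the bound \<beta>' of B' may not enter.
  The difference B' v - B u is split so that only \<beta>, \<delta> and the size of the unperturbed
  orbit appear. Since \<delta> \<le> 1, the rate \<beta> + 1 covers all admissible B'.\<close>

lemma evol_continuous_dependence:
  assumes B: "perturbation B \<beta>" and x: "x \<in> closure D" and e: "0 < e"
  shows "\<exists>\<delta>>0. \<forall>B' \<beta>' t0 t v. perturbation B' \<beta>' \<longrightarrow>
    (\<forall>s\<in>{a..b}. \<forall>y\<in>closure D. norm (B' s y - B s y) \<le> \<delta> * norm y) \<longrightarrow>
    a \<le> t0 \<longrightarrow> t0 \<le> t \<longrightarrow> t \<le> b \<longrightarrow> mild t0 t x (\<lambda>s. B' s (v s)) v \<longrightarrow> norm (v t - evol B t t0 x) < e"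
proof -
  have \<beta>: "0 \<le> \<beta>" by (rule perturbation_nonneg[OF B])
  \<comment> \<open>The maximum keeps \<open>T\<close> nonnegative when b < a, where the claim is
    vacuous.\<close>
  define T where "T = max (b - a) 0"
  obtain C where C: "0 < C" "\<And>x s t. x \<in> closure D \<Longrightarrow> s \<le> t \<Longrightarrow> t - s \<le> T \<Longrightarrow>
      norm (evol B t s x) \<le> C * norm x"
    using evol_bound_local[OF B] by blast
  define w where "w = 2 * \<omega> + 2 * M\<^sup>2 * (\<beta> + 1)"
  have w: "0 \<le> w" using \<beta> \<omega>_nonneg by (simp add: w_def)
  define K where "K = 2 * M\<^sup>2 * (T * (C * norm x)) * exp (w * T) + 1"
  have K: "0 < K" using C(1) by (simp add: K_def T_def add_nonneg_pos)
  define \<delta> where "\<delta> = min 1 (e / (2 * K))"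
  have \<delta>: "0 < \<delta>" "\<delta> \<le> 1" using e K by (auto simp: \<delta>_def)
  have "K * \<delta> \<le> K * (e / (2 * K))" using K by (intro mult_left_mono) (auto simp: \<delta>_def)
  hence K\<delta>: "K * \<delta> < e" using K e by simp
  have "norm (v t - evol B t t0 x) < e"
    if B': "perturbation B' \<beta>'" and near: "\<forall>s\<in>{a..b}. \<forall>y\<in>closure D. norm (B' s y - B s y) \<le> \<delta> * norm y"
      and t: "a \<le> t0" "t0 \<le> t" "t \<le> b" and v: "mild t0 t x (\<lambda>s. B' s (v s)) v" for B' \<beta>' t0 t v
  proof -
    define u where "u s = evol B s t0 x" for s
    have u: "mild t0 t x (\<lambda>s. B s (u s)) u"
      using evol_mild[OF B x t(2)] by (simp add: u_def[abs_def])
    have cv: "continuous_on {t0..t} (\<lambda>s. B' s (v s))" by (rule continuous_on_mild_forcing[OF B' v])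
    have cu: "continuous_on {t0..t} (\<lambda>s. B s (u s))" by (rule continuous_on_mild_forcing[OF B u])
    have m: "mild t0 t (x - x) (\<lambda>s. B' s (v s) - B s (u s)) (\<lambda>s. v s - u s)"
      by (rule mild_diff[OF v u cv cu])
    have "norm (v t - u t) \<le> 2 * M\<^sup>2 * (norm (x - x) + (t - t0) * (\<delta> * (C * norm x)))
        * exp ((2 * \<omega> + 2 * M\<^sup>2 * (\<beta> + 1)) * (t - t0))"
    proof (rule mild_bound[OF m])
      show "continuous_on {t0..t} (\<lambda>s. B' s (v s) - B s (u s))" by (intro continuous_intros cv cu)
      show "0 \<le> \<delta> * (C * norm x)" using \<delta> C(1) by simp
      fix s assume s: "s \<in> {t0..t}"
      have sab: "s \<in> {a..b}" using s t by auto
      have vc: "v s \<in> closure D" and uc: "u s \<in> closure D"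
        using mildD(2)[OF v s] mildD(2)[OF u s] by auto
      have "B' s (v s) - B s (u s) = (B' s (v s) - B s (v s)) + B s (v s - u s)"
        by (simp add: perturbation_diff[OF B vc uc])
      hence "norm (B' s (v s) - B s (u s)) \<le> norm (B' s (v s) - B s (v s)) + norm (B s (v s - u s))"
        by (metis norm_triangle_ineq)
      also have "\<dots> \<le> \<delta> * norm (v s) + \<beta> * norm (v s - u s)"
        using near sab vc uc
        by (intro add_mono perturbation_bound[OF B] closure_D_diff) auto
      also have "\<delta> * norm (v s) \<le> \<delta> * (norm (v s - u s) + norm (u s))"
        using \<delta> norm_triangle_sub[of "v s" "u s"] by (intro mult_left_mono) (auto simp: add.commute)
      also have "\<dots> \<le> 1 * norm (v s - u s) + \<delta> * (C * norm x)"
      proof -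
        have "norm (u s) \<le> C * norm x"
          unfolding u_def using s t by (intro C x) (auto simp: T_def)
        hence "\<delta> * norm (u s) \<le> \<delta> * (C * norm x)" using \<delta> by (intro mult_left_mono) auto
        moreover have "\<delta> * norm (v s - u s) \<le> 1 * norm (v s - u s)"
          using \<delta> by (intro mult_right_mono) auto
        ultimately show ?thesis by (simp add: distrib_left)
      qed
      finally show "norm (B' s (v s) - B s (u s)) \<le> (\<beta> + 1) * norm (v s - u s) + \<delta> * (C * norm x)"
        by (simp add: algebra_simps)
    qed (use t \<beta> in auto)
    also have "\<dots> \<le> 2 * M\<^sup>2 * (T * (\<delta> * (C * norm x))) * exp (w * T)"
    proof -
      have tT: "t - t0 \<le> T" using t by (simp add: T_def)
      have "w * (t - t0) \<le> w * T" using tT w by (intro mult_left_mono) auto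
      moreover have "(t - t0) * (\<delta> * (C * norm x)) \<le> T * (\<delta> * (C * norm x))"
        using tT \<delta> C(1) by (intro mult_right_mono) auto
      ultimately show ?thesis
        using t \<delta> C(1) unfolding w_def by (intro mult_mono) (auto simp: T_def)
    qed
    also have "\<dots> \<le> K * \<delta>" using \<delta> by (simp add: K_def algebra_simps)
    finally show ?thesis using K\<delta> by (simp add: u_def)
  qed
  thus ?thesis using \<delta>(1) by blast
qed

end

theorem theorem2p6:
  fixes A :: "'a::banach \<Rightarrow> 'a" and D P P\<^sub>0 :: "'a set"
    and F V :: "real \<Rightarrow> 'a \<Rightarrow> 'a" and \<omega>\<^sub>A M\<^sub>A :: real
  assumes "hille_yosida D A \<omega>\<^sub>A M\<^sub>A"
    and "almost_periodic_operators (closure D) F"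
    and "almost_periodic_operators (closure D) V"
    and "positive_cone P" and "normal_cone P" and "generating_cone UNIV P"
    and "positive_cone P\<^sub>0" and "normal_cone P\<^sub>0" and "generating_cone (closure D) P\<^sub>0"
    and "resolvent_positive P D A"
    and "\<exists>\<mu>\<^sub>1>\<omega>\<^sub>A. \<forall>t. \<forall>\<phi>\<in>P\<^sub>0. \<mu>\<^sub>1 *\<^sub>R \<phi> - V t \<phi> \<in> P"
    and "\<forall>t. \<forall>\<phi>\<in>P\<^sub>0. F t \<phi> \<in> P"
  shows "\<exists>U \<Gamma>.
    evolution_family_of D A (\<lambda>t x. F t x - V t x) U \<and>
    evolution_family_of D A (\<lambda>t x. - V t x) \<Gamma> \<and>
    (\<forall>u\<^sub>0\<in>closure D. \<forall>t\<^sub>0. \<forall>t\<ge>t\<^sub>0.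
       (\<forall>\<mu>>\<omega>\<^sub>A. (\<lambda>s. \<Gamma> t s (\<mu> *\<^sub>R resolvent D A \<mu> (F s (U s t\<^sub>0 u\<^sub>0)))) integrable_on {t\<^sub>0..t}) \<and>
       (\<exists>L\<in>closure D.
          ((\<lambda>\<mu>. integral {t\<^sub>0..t} (\<lambda>s. \<Gamma> t s (\<mu> *\<^sub>R resolvent D A \<mu> (F s (U s t\<^sub>0 u\<^sub>0)))))
             \<longlongrightarrow> L) at_top \<and>
          U t t\<^sub>0 u\<^sub>0 = \<Gamma> t t\<^sub>0 u\<^sub>0 + L)) \<and>
    (\<forall>u\<^sub>0\<in>closure D. \<forall>a b.
       uniform_limit {(t, t\<^sub>0). a \<le> t\<^sub>0 \<and> t\<^sub>0 \<le> t \<and> t \<le> b}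
         (\<lambda>\<mu> (t, t\<^sub>0). integral {t\<^sub>0..t}
            (\<lambda>s. \<Gamma> t s (\<mu> *\<^sub>R resolvent D A \<mu> (F s (U s t\<^sub>0 u\<^sub>0)))))
         (\<lambda>(t, t\<^sub>0). U t t\<^sub>0 u\<^sub>0 - \<Gamma> t t\<^sub>0 u\<^sub>0) at_top) \<and>
    continuous_on {(t, t\<^sub>0, u\<^sub>0). t\<^sub>0 \<le> t \<and> u\<^sub>0 \<in> closure D} (\<lambda>(t, t\<^sub>0, u\<^sub>0). U t t\<^sub>0 u\<^sub>0) \<and>
    (\<forall>u\<^sub>0\<in>closure D. \<forall>a b. \<forall>\<epsilon>>0. \<exists>\<delta>>0. \<forall>F' V'.
       almost_periodic_operators (closure D) F' \<longrightarrow>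
       almost_periodic_operators (closure D) V' \<longrightarrow>
       (\<forall>s\<in>{a..b}. op_dist (closure D) (F' s) (F s) < \<delta> \<and> op_dist (closure D) (V' s) (V s) < \<delta>) \<longrightarrow>
       (\<forall>t\<^sub>0 t u'. a \<le> t\<^sub>0 \<longrightarrow> t\<^sub>0 \<le> t \<longrightarrow> t \<le> b \<longrightarrow>
          mild_solution D A (\<lambda>s x. F' s x - V' s x) t\<^sub>0 u\<^sub>0 u' \<longrightarrow> norm (u' t - U t t\<^sub>0 u\<^sub>0) < \<epsilon>))"
proof -
  note hyA = \<open>hille_yosida D A \<omega>\<^sub>A M\<^sub>A\<close>
  note apF = \<open>almost_periodic_operators (closure D) F\<close>
  note apV = \<open>almost_periodic_operators (closure D) V\<close>
  \<comment> \<open>The locale requires a nonnegative growth bound.\<close>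
  interpret hille_yosida_operator D A "max \<omega>\<^sub>A 0" M\<^sub>A
    by standard (rule hille_yosida_mono[OF hyA], auto)
  obtain \<beta> where F: "perturbation F \<beta>" using perturbation_almost_periodic[OF apF] by blast
  obtain \<gamma> where V: "perturbation V \<gamma>" using perturbation_almost_periodic[OF apV] by blast
  define Bu where "Bu = (\<lambda>t x. F t x - V t x)"
  define Bv where "Bv = (\<lambda>t x. - V t x)"
  have Bu: "perturbation Bu (\<beta> + \<gamma>)" unfolding Bu_def by (rule perturbation_minus[OF F V])
  have Bv: "perturbation Bv \<gamma>" unfolding Bv_def by (rule perturbation_uminus[OF V])
  have unif: "uniform_limit {(t, t0). a \<le> t0 \<and> t0 \<le> t \<and> t \<le> b}
      (\<lambda>\<mu> (t, t0). integral {t0..t} (\<lambda>s. evol Bv t s (\<mu> *\<^sub>R resolvent D A \<mu> (F s (evol Bu s t0 x)))))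
      (\<lambda>(t, t0). evol Bu t t0 x - evol Bv t t0 x) at_top" if "x \<in> closure D" for x a b
    using uniform_limit_yosida_convolution[OF F Bv Bu _ that, of a b]
    by (simp add: Bu_def Bv_def J_def)
  \<comment> \<open>Every \<mu> above the original bound is included, so the facts on the resolvent
    come from the resolvent set itself and not from the locale.\<close>
  have int: "(\<lambda>s. evol Bv t s (\<mu> *\<^sub>R resolvent D A \<mu> (F s (evol Bu s t0 x)))) integrable_on {t0..t}"
    if x: "x \<in> closure D" and t: "t0 \<le> t" and \<mu>: "\<omega>\<^sub>A < \<mu>" for x t t0 \<mu>
  proof (rule integrable_continuous_interval, rule continuous_on_evol_compose[OF Bv])
    have \<mu>': "\<mu> \<in> resolvent_set D A" using hyA \<mu> by (auto simp: hille_yosida_def)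
    have "continuous_on {t0..t} (\<lambda>s. F s (evol Bu s t0 x))"
      by (rule continuous_on_mild_forcing[OF F evol_mild[OF Bu x t]])
    thus "continuous_on {t0..t} (\<lambda>s. \<mu> *\<^sub>R resolvent D A \<mu> (F s (evol Bu s t0 x)))"
      using \<mu>' by (intro continuous_intros bounded_linear.continuous_on[of "resolvent D A \<mu>"])
        (auto simp: resolvent_set_def)
    show "\<mu> *\<^sub>R resolvent D A \<mu> (F s (evol Bu s t0 x)) \<in> closure D" for s
      using D_scale[OF resolvent_in_domain[OF \<mu>']] closure_subset by blast
  qed (auto intro!: continuous_intros)
  have lim: "\<exists>L\<in>closure D.
      ((\<lambda>\<mu>. integral {t0..t} (\<lambda>s. evol Bv t s (\<mu> *\<^sub>R resolvent D A \<mu> (F s (evol Bu s t0 x))))) \<longlongrightarrow> L) at_top \<and>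
      evol Bu t t0 x = evol Bv t t0 x + L" if x: "x \<in> closure D" and t: "t0 \<le> t" for x t t0
  proof (intro bexI conjI)
    show "evol Bu t t0 x - evol Bv t t0 x \<in> closure D"
      by (intro closure_D_diff evol_closure[OF Bu x t] evol_closure[OF Bv x t])
    show "((\<lambda>\<mu>. integral {t0..t} (\<lambda>s. evol Bv t s (\<mu> *\<^sub>R resolvent D A \<mu> (F s (evol Bu s t0 x)))))
        \<longlongrightarrow> evol Bu t t0 x - evol Bv t t0 x) at_top"
      using tendsto_uniform_limitI[OF unif[OF x, of t0 t], of "(t, t0)"] t by simp
  qed simp
  have dep: "\<exists>\<delta>>0. \<forall>F' V'.
       almost_periodic_operators (closure D) F' \<longrightarrow>
       almost_periodic_operators (closure D) V' \<longrightarrow>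
       (\<forall>s\<in>{a..b}. op_dist (closure D) (F' s) (F s) < \<delta> \<and> op_dist (closure D) (V' s) (V s) < \<delta>) \<longrightarrow>
       (\<forall>t0 t u'. a \<le> t0 \<longrightarrow> t0 \<le> t \<longrightarrow> t \<le> b \<longrightarrow>
          mild_solution D A (\<lambda>s x. F' s x - V' s x) t0 x u' \<longrightarrow> norm (u' t - evol Bu t t0 x) < \<epsilon>)"
    if x: "x \<in> closure D" and \<epsilon>: "0 < \<epsilon>" for x a b \<epsilon>
  proof -
    obtain \<delta> where \<delta>: "0 < \<delta>" "\<And>B' \<beta>' t0 t v. perturbation B' \<beta>' \<Longrightarrow>
        \<forall>s\<in>{a..b}. \<forall>y\<in>closure D. norm (B' s y - Bu s y) \<le> \<delta> * norm y \<Longrightarrow>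
        a \<le> t0 \<Longrightarrow> t0 \<le> t \<Longrightarrow> t \<le> b \<Longrightarrow> mild t0 t x (\<lambda>s. B' s (v s)) v \<Longrightarrow> norm (v t - evol Bu t t0 x) < \<epsilon>"
      using evol_continuous_dependence[OF Bu x \<epsilon>, of a b] by blast
    show ?thesis
    \<comment> \<open>F and V each get half of the tolerance, since the perturbation is their
      difference.\<close>
    proof (intro exI[of _ "\<delta> / 2"] conjI allI impI)
      show "0 < \<delta> / 2" using \<delta> by simp
      fix F' V' t0 t u'
      assume apF': "almost_periodic_operators (closure D) F'" and apV': "almost_periodic_operators (closure D) V'"
        and near: "\<forall>s\<in>{a..b}. op_dist (closure D) (F' s) (F s) < \<delta> / 2 \<and> op_dist (closure D) (V' s) (V s) < \<delta> / 2"
        and t: "a \<le> t0" "t0 \<le> t" "t \<le> b" and u': "mild_solution D A (\<lambda>s x. F' s x - V' s x) t0 x u'"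
      obtain \<beta>' \<gamma>' where F': "perturbation F' \<beta>'" and V': "perturbation V' \<gamma>'"
        using perturbation_almost_periodic apF' apV' by blast
      have "norm (F' s y - V' s y - Bu s y) \<le> \<delta> * norm y" if s: "s \<in> {a..b}" and y: "y \<in> closure D" for s y
      proof -
        have "norm (F' s y - F s y) \<le> op_dist (closure D) (F' s) (F s) * norm y"
          and "norm (V' s y - V s y) \<le> op_dist (closure D) (V' s) (V s) * norm y"
          using apF apF' apV apV' by (auto simp: almost_periodic_operators_def intro!: op_dist_bound y)
        moreover have "op_dist (closure D) (F' s) (F s) * norm y \<le> \<delta> / 2 * norm y"
          and "op_dist (closure D) (V' s) (V s) * norm y \<le> \<delta> / 2 * norm y"
          using near[rule_format, OF s] by (simp_all only: mult_right_mono less_imp_le norm_ge_zero)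
        moreover have eq: "F' s y - V' s y - Bu s y = (F' s y - F s y) - (V' s y - V s y)"
          by (simp add: Bu_def)
        ultimately show ?thesis
          unfolding eq using norm_triangle_ineq4[of "F' s y - F s y" "V' s y - V s y"] by simp
      qed
      thus "norm (u' t - evol Bu t t0 x) < \<epsilon>"
        using u' by (intro \<delta>(2)[OF perturbation_minus[OF F' V']] t) (auto simp: mild_solution_iff)
    qed
  qed
  show ?thesis
    using evolution_family_of_evol[OF Bu] evolution_family_of_evol[OF Bv] int lim unif
      continuous_on_evol[OF Bu] dep
    unfolding Bu_def[symmetric] Bv_def[symmetric]
    by (intro exI[of _ "evol Bu"] exI[of _ "evol Bv"] conjI ballI allI impI) assumption+
qed

end
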